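(* Let $n\ge 1$. The charge map, composed with the quotient map $\mathbb{C}[z_1,\ldots,z_n]\to \mathbb{C}[z_1,\ldots,z_n]_{S_n}$ to the ring of coinvariants, $$\mathrm{Ch}:\mathbb{C}[S_n]\to \mathbb{C}[z_1,\ldots,z_n]_{S_n},$$ is an isomorphism of left $S_n$-modules, and the (images of the) weight vectors $$\overline{v}_{T,T'}=\mathrm{Ch}(v_{T,T'})=p_T\cdot\sigma_{T,T'}\cdot p_{T'}\cdot z^{\mathrm{ch}(T')},$$ where $(T,T')$ runs over all pairs of standard tableaux with $n$ boxes having the same shape, form a basis of $\mathbb{C}[z_1,\ldots,z_n]_{S_n}$.
   Context: Tableaux and Jucys-Murphy elements. Permutations compose as functions. $X_k=(1\ k)+(2\ k)+\cdots+(k-1\ k)\in\mathbb{C}[S_n]$, with $X_1=0$. The content of a box of a Young diagram (rows counted from the top, columns from the left) is (column index) $-$ (row index). A standard tableau of shape $\lambda\vdash n$ is a filling of the boxes of $\lambda$ by $1,\ldots,n$, each used once, increasing along rows to the right and down columns. $b(T,i)$ is the box of $T$ containing $i$, and $T^{(i)}$ is the subtableau of $T$ formed by $1,\ldots,i$. Projectors. An outer corner of a Young diagram is a location where one box can be added to give a Young diagram. For $2\le k\le n$ let $b=b(T,k)$ and let $b_1,\ldots,b_j$ be the outer corners of the shape of $T^{(k-1)}$ other than $b$. Put $$p_{T^{(k-1)},T^{(k)}}(X_k)=\prod_{i=1}^j\frac{X_k-\mathrm{cont}(b_i)}{\mathrm{cont}(b)-\mathrm{cont}(b_i)},\qquad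 p_T=\prod_{k=2}^n p_{T^{(k-1)},T^{(k)}}(X_k)\in\mathbb{C}[S_n].$$ Weight basis of $\mathbb{C}[S_n]$. For standard tableaux $T,T'$ of the same shape, $\sigma_{T,T'}\in S_n$ is the permutation sending, for each box, the entry of $T'$ in that box to the entry of $T$ in that box. Put $v_{T,T'}=p_T\,\sigma_{T,T'}\,p_{T'}\in\mathbb{C}[S_n]$; in particular $v_{T,T}=p_T$. Put $V_{\bullet,T'}=\mathbb{C}[S_n]\cdot p_{T'}$. It is known that $\mathbb{C}[S_n]=\bigoplus_{T'}V_{\bullet,T'}$ over all standard tableaux $T'$ with $n$ boxes, each $V_{\bullet,T'}$ is an irreducible left $S_n$-module, and $\{v_{T,T'}\}_T$ is a basis of $V_{\bullet,T'}$. Charge. For a standard tableau $T$ with $n$ boxes, its charge vector $(w_1,\ldots,w_n)$ is defined by $w_1=0$, and $w_{i+1}=w_i$ if $\mathrm{cont}(b(T,i+1))>\mathrm{cont}(b(T,i))$, $w_{i+1}=w_i+1$ if $\mathrm{cont}(b(T,i+1))<\mathrm{cont}(b(T,i))$. The charge monomial is $z^{\mathrm{ch}(T)}=\prod_{i=1}^n z_i^{w_i}$. Charge map. $S_n$ acts on the left on $\mathbb{C}[z_1,\ldots,z_n]$ by $\sigma\cdot z_i=z_{\sigma(i)}$. Identify $\mathbb{C}[S_n]$ with the span $M^{(n-1)}[z_1,\ldots,z_n]$ of the monomials whose exponents are a rearrangement of $0,1,\ldots,n-1$, via $\sigma\mapsto\sigma\cdot z_2z_3^2\cdots z_n^{n-1}$.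 For each $T$, $\mathrm{Ch}_T$ is the linear map commuting with the left action of $S_n$ and determined by $\prod_i z_i^{i-1}\mapsto z^{\mathrm{ch}(T)}$; i.e. on $\mathbb{C}[S_n]$ it is $a\mapsto a\cdot z^{\mathrm{ch}(T)}$. The charge map $\mathrm{Ch}=\bigoplus_T\mathrm{Ch}_T$ on $\mathbb{C}[S_n]=\bigoplus_T V_{\bullet,T}$ is the linear map whose restriction to $V_{\bullet,T}$ is $\mathrm{Ch}_T|_{V_{\bullet,T}}$, for every $T$. Coinvariants. $\mathbb{C}[z_1,\ldots,z_n]_{S_n}=\mathbb{C}[z_1,\ldots,z_n]/I_n^+$, where $I_n^+$ is the ideal generated by the symmetric polynomials of positive degree (with zero constant term), with the induced left $S_n$-action. *)

theory Defs
  imports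
    "HOL-Algebra.Sym_Groups"
    "HOL-Algebra.QuotRing"
    "HOL-Library.Poly_Mapping"
    "Jordan_Normal_Form.VS_Connect"
begin

section \<open>Young diagrams and standard tableaux\<close>

text \<open>
  A box is a pair (row, column); rows are counted from the top and columns from the left, both
  starting at 0.  The content does not depend on the choice of the starting index.
\<close>

type_synonym box = "nat \<times> nat"

definition content :: "box \<Rightarrow> int" where
  "content b = int (snd b) - int (fst b)"

definition young_diagram :: "box set \<Rightarrow> bool" where
  "young_diagram D \<longleftrightarrow> finite D \<and> (\<forall>(r, c) \<in> D. \<forall>r' \<le> r. \<forall>c' \<le> c. (r', c') \<in> D)"

definition outer_corners :: "box set \<Rightarrow> box set" where
  "outer_corners D = {b. b \<notin> D \<and> young_diagram (insert b D)}"

text \<open>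
  A tableau is a partial map from boxes to entries; its shape is the domain of the map.
\<close>

type_synonym tableau = "box \<rightharpoonup> nat"

definition standard_tableaux :: "nat \<Rightarrow> tableau set" where
  "standard_tableaux n = {T.
     young_diagram (dom T) \<and>
     bij_betw (\<lambda>b. the (T b)) (dom T) {1..n} \<and>
     (\<forall>r c c'. (r, c) \<in> dom T \<and> (r, c') \<in> dom T \<and> c < c' \<longrightarrow> the (T (r, c)) < the (T (r, c'))) \<and>
     (\<forall>r r' c. (r, c) \<in> dom T \<and> (r', c) \<in> dom T \<and> r < r' \<longrightarrow> the (T (r, c)) < the (T (r', c)))}"

definition box_of :: "tableau \<Rightarrow> nat \<Rightarrow> box" where
  "box_of T i = (THE b. T b = Some i)"

definition subtableau :: "tableau \<Rightarrow> nat \<Rightarrow> tableau" where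
  "subtableau T i = T |` {b \<in> dom T. the (T b) \<le> i}"

definition same_shape_pairs :: "nat \<Rightarrow> (tableau \<times> tableau) set" where
  "same_shape_pairs n =
     {(T, T'). T \<in> standard_tableaux n \<and> T' \<in> standard_tableaux n \<and> dom T = dom T'}"

definition sigma :: "nat \<Rightarrow> tableau \<Rightarrow> tableau \<Rightarrow> nat \<Rightarrow> nat" where
  "sigma n T T' i = (if i \<in> {1..n} then the (T (box_of T' i)) else i)"


section \<open>The group algebra of the symmetric group\<close>

text \<open>
  The group algebra over the complex numbers consists of the formal linear combinations of group
  elements.  The multiplication of type class \<open>times\<close> on \<open>poly_mapping\<close> is not used here, since
  it is the convolution for an additive structure on the keys.
\<close>

definition group_algebra ::
    "('g, 'm) monoid_scheme \<Rightarrow> (complex, 'g \<Rightarrow>\<^sub>0 complex) module" where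
  "group_algebra G =
     \<lparr> carrier = {a. Poly_Mapping.keys a \<subseteq> carrier G},
       mult = (\<lambda>a b. \<Sum>x\<in>Poly_Mapping.keys a. \<Sum>y\<in>Poly_Mapping.keys b.
                Poly_Mapping.single (x \<otimes>\<^bsub>G\<^esub> y)
                  (Poly_Mapping.lookup a x * Poly_Mapping.lookup b y)),
       one = Poly_Mapping.single \<one>\<^bsub>G\<^esub> 1,
       zero = 0,
       add = (+),
       smult = (\<lambda>c a. Poly_Mapping.map ((*) c) a) \<rparr>"

abbreviation CS :: "nat \<Rightarrow> (complex, (nat \<Rightarrow> nat) \<Rightarrow>\<^sub>0 complex) module" where
  "CS n \<equiv> group_algebra (sym_group n)"

abbreviation perm_elt :: "(nat \<Rightarrow> nat) \<Rightarrow> ((nat \<Rightarrow> nat) \<Rightarrow>\<^sub>0 complex)" where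
  "perm_elt \<sigma> \<equiv> Poly_Mapping.single \<sigma> 1"

definition left_mult ::
    "nat \<Rightarrow> (nat \<Rightarrow> nat) \<Rightarrow> ((nat \<Rightarrow> nat) \<Rightarrow>\<^sub>0 complex) \<Rightarrow> ((nat \<Rightarrow> nat) \<Rightarrow>\<^sub>0 complex)" where
  "left_mult n \<sigma> a = perm_elt \<sigma> \<otimes>\<^bsub>CS n\<^esub> a"

definition jucys_murphy :: "nat \<Rightarrow> ((nat \<Rightarrow> nat) \<Rightarrow>\<^sub>0 complex)" where
  "jucys_murphy k = (\<Sum>i\<in>{1..<k}. perm_elt (transpose i k))"

definition eval_in_CS ::
    "nat \<Rightarrow> complex poly \<Rightarrow> ((nat \<Rightarrow> nat) \<Rightarrow>\<^sub>0 complex) \<Rightarrow> ((nat \<Rightarrow> nat) \<Rightarrow>\<^sub>0 complex)" where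
  "eval_in_CS n p x = (\<Sum>j\<le>Polynomial.degree p. Polynomial.coeff p j \<odot>\<^bsub>CS n\<^esub> (x [^]\<^bsub>CS n\<^esub> j))"

definition step_poly :: "tableau \<Rightarrow> nat \<Rightarrow> complex poly" where
  "step_poly T k =
     (let b = box_of T k; c = of_int (content b) in
      \<Prod>b' \<in> outer_corners (dom (subtableau T (k - 1))) - {b}.
        let c' = of_int (content b') in
        Polynomial.smult (1 / (c - c')) [:- c', 1:])"

text \<open>The factors for different \<open>k\<close> are multiplied in increasing order of \<open>k\<close> (they commute).\<close>

definition tableau_proj :: "nat \<Rightarrow> tableau \<Rightarrow> ((nat \<Rightarrow> nat) \<Rightarrow>\<^sub>0 complex)" where
  "tableau_proj n T =
     foldr (\<lambda>k a. eval_in_CS n (step_poly T k) (jucys_murphy k) \<otimes>\<^bsub>CS n\<^esub> a) [2..<Suc n] \<one>\<^bsub>CS n\<^esub>"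

definition weight_vec :: "nat \<Rightarrow> tableau \<Rightarrow> tableau \<Rightarrow> ((nat \<Rightarrow> nat) \<Rightarrow>\<^sub>0 complex)" where
  "weight_vec n T T' =
     tableau_proj n T \<otimes>\<^bsub>CS n\<^esub> perm_elt (sigma n T T') \<otimes>\<^bsub>CS n\<^esub> tableau_proj n T'"

definition V_of :: "nat \<Rightarrow> tableau \<Rightarrow> ((nat \<Rightarrow> nat) \<Rightarrow>\<^sub>0 complex) set" where
  "V_of n T' = {a \<otimes>\<^bsub>CS n\<^esub> tableau_proj n T' | a. a \<in> carrier (CS n)}"


section \<open>Polynomials in the variables indexed by 1, ..., n\<close>

text \<open>A monomial is a finitely supported exponent vector.\<close>

type_synonym mpoly = "(nat \<Rightarrow>\<^sub>0 nat) \<Rightarrow>\<^sub>0 complex"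

definition var :: "nat \<Rightarrow> mpoly" where
  "var i = Poly_Mapping.single (Poly_Mapping.single i 1) 1"

definition const :: "complex \<Rightarrow> mpoly" where
  "const c = Poly_Mapping.single 0 c"

definition poly_algebra :: "nat \<Rightarrow> (complex, mpoly) module" where
  "poly_algebra n =
     \<lparr> carrier = {p. \<forall>m\<in>Poly_Mapping.keys p. Poly_Mapping.keys m \<subseteq> {1..n}},
       mult = (*), one = 1, zero = 0, add = (+),
       smult = (\<lambda>c p. const c * p) \<rparr>"

text \<open>The substitution \<open>var i \<mapsto> var (\<sigma> i)\<close>.\<close>

definition perm_act :: "(nat \<Rightarrow> nat) \<Rightarrow> mpoly \<Rightarrow> mpoly" where
  "perm_act \<sigma> p = (\<Sum>m\<in>Poly_Mapping.keys p.
     const (Poly_Mapping.lookup p m) *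
       (\<Prod>i\<in>Poly_Mapping.keys m. var (\<sigma> i) ^ Poly_Mapping.lookup m i))"

definition alg_act :: "((nat \<Rightarrow> nat) \<Rightarrow>\<^sub>0 complex) \<Rightarrow> mpoly \<Rightarrow> mpoly" where
  "alg_act a p = (\<Sum>\<sigma>\<in>Poly_Mapping.keys a.
     const (Poly_Mapping.lookup a \<sigma>) * perm_act \<sigma> p)"


section \<open>Charge\<close>

text \<open>
  The contents of the boxes of \<open>i\<close> and \<open>i + 1\<close> in a standard tableau are never equal, so the two
  branches of the conditional are the two cases of the definition.  The value at 0 is irrelevant.
\<close>

fun charge :: "tableau \<Rightarrow> nat \<Rightarrow> nat" where
  "charge T 0 = 0"
| "charge T (Suc 0) = 0"
| "charge T (Suc (Suc i)) =
     (if content (box_of T (Suc (Suc i))) > content (box_of T (Suc i))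
      then charge T (Suc i) else charge T (Suc i) + 1)"

definition charge_monomial :: "nat \<Rightarrow> tableau \<Rightarrow> mpoly" where
  "charge_monomial n T = (\<Prod>i\<in>{1..n}. var i ^ charge T i)"

text \<open>
  The charge map is determined on the group algebra only; outside of it the function is made
  \<open>undefined\<close> so that the description is unique.
\<close>

definition charge_map :: "nat \<Rightarrow> ((nat \<Rightarrow> nat) \<Rightarrow>\<^sub>0 complex) \<Rightarrow> mpoly" where
  "charge_map n =
     (THE f. f \<in> extensional (carrier (CS n)) \<and>
             f \<in> LinearCombinations.module_hom class_ring (CS n) (poly_algebra n) \<and>
             (\<forall>T\<in>standard_tableaux n. \<forall>a\<in>V_of n T. f a = alg_act a (charge_monomial n T)))"


section \<open>Coinvariants\<close>

definition symmetric_pos :: "nat \<Rightarrow> mpoly set" where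
  "symmetric_pos n = {p \<in> carrier (poly_algebra n).
     (\<forall>\<sigma>\<in>carrier (sym_group n). perm_act \<sigma> p = p) \<and> Poly_Mapping.lookup p 0 = 0}"

definition coinv_ideal :: "nat \<Rightarrow> mpoly set" where
  "coinv_ideal n = Idl\<^bsub>poly_algebra n\<^esub> (symmetric_pos n)"

definition coinv_class :: "nat \<Rightarrow> mpoly \<Rightarrow> mpoly set" where
  "coinv_class n p = coinv_ideal n +>\<^bsub>poly_algebra n\<^esub> p"

text \<open>
  The quotient ring, with scalar multiplication induced from representatives (as in
  \<open>rcoset_mult\<close>, which gives the ring multiplication of the quotient).
\<close>

definition coinvariants :: "nat \<Rightarrow> (complex, mpoly set) module" where
  "coinvariants n = ring.extend (poly_algebra n Quot coinv_ideal n)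
     \<lparr> smult = (\<lambda>c C. \<Union>p\<in>C. coinv_class n (c \<odot>\<^bsub>poly_algebra n\<^esub> p)) \<rparr>"

definition coinv_act :: "nat \<Rightarrow> (nat \<Rightarrow> nat) \<Rightarrow> mpoly set \<Rightarrow> mpoly set" where
  "coinv_act n \<sigma> C = (\<Union>p\<in>C. coinv_class n (perm_act \<sigma> p))"


section \<open>Isomorphisms of modules over a group\<close>

definition G_module_iso ::
    "('g, 'm) monoid_scheme \<Rightarrow>
     (complex, 'v, 'a) module_scheme \<Rightarrow> ('g \<Rightarrow> 'v \<Rightarrow> 'v) \<Rightarrow>
     (complex, 'w, 'b) module_scheme \<Rightarrow> ('g \<Rightarrow> 'w \<Rightarrow> 'w) \<Rightarrow> ('v \<Rightarrow> 'w) \<Rightarrow> bool" where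
  "G_module_iso G V actV W actW f \<longleftrightarrow>
     linear_map class_ring V W f \<and>
     bij_betw f (carrier V) (carrier W) \<and>
     (\<forall>g\<in>carrier G. \<forall>v\<in>carrier V. f (actV g v) = actW g (f v))"

end

theory Submission
  imports Defs "HOL-Library.Function_Algebras"
begin

text \<open>
  A standard tableau is the path of Young diagrams that its boxes trace out.  By the argument of
  Okounkov and Vershik, \<open>p\<^sub>T\<close> projects onto the vectors on which the Jucys-Murphy
  elements act by the contents along the path of \<open>T\<close>; hence the \<open>p\<^sub>T\<close> are orthogonal idempotents
  with sum 1, and \<open>Ch(a) = \<Sum>\<^sub>T a p\<^sub>T z\<^bsup>ch(T)\<^esup>\<close>.

  Surjectivity.  Let \<open>L\<close> be the sum of the image of \<open>Ch\<close> and the coinvariant ideal.  It suffices to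
  show that sorted monomials lie in \<open>L\<close>, by induction on the sum of the squares of the exponents.
  Let \<open>z\<^sup>\<beta>\<close> be one, let \<open>S\<close> be its set of ascents, and multiply a smaller monomial by an
  elementary symmetric polynomial: if some ascent is greater than 1 or \<open>\<beta> 1 > 0\<close>, this gives
  \<open>z\<^sup>\<beta> \<in> L\<close>, and otherwise it shows for each \<open>k \<in> S\<close> that the symmetrization of \<open>z\<^sup>\<beta>\<close> over an
  interval around \<open>k\<close> lies in \<open>L\<close>.  In the second case \<open>z\<^sup>\<beta>\<close> is the charge monomial of
  all tableaux with descent set \<open>S\<close>, and \<open>p\<^sub>T z\<^sup>\<beta> \<in> L\<close> follows for every \<open>T\<close>: a descent of \<open>T\<close> outside
  \<open>S\<close> is removed with the invariance of \<open>z\<^sup>\<beta>\<close> under a simple transposition, a missing descent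
  with a symmetrization.

  Injectivity.  There are \<open>n!\<close> pairs of standard tableaux of the same shape.  The functions on the
  orbit of a point with distinct coordinates have dimension \<open>n!\<close>, and symmetric polynomials are
  constant on the orbit, so homogeneous polynomials that span the coinvariants restrict to a
  spanning set of these functions.  Hence the \<open>n!\<close> images of the weight vectors, which are
  homogeneous, are linearly independent.
\<close>

section \<open>Standard tableaux as paths of Young diagrams\<close>

definition right :: "box \<Rightarrow> box" where "right b = (fst b, Suc (snd b))"
definition below :: "box \<Rightarrow> box" where "below b = (Suc (fst b), snd b)"

lemma content_right [simp]: "content (right b) = content b + 1"
  and content_below [simp]: "content (below b) = content b - 1"
  by (auto simp: content_def right_def below_def)

lemma right_below_neq [simp]:
  "right b \<noteq> b" "below b \<noteq> b" "right b \<noteq> below b" "b \<noteq> right b" "b \<noteq> below b" "below b \<noteq> right b"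
  by (auto simp: right_def below_def prod_eq_iff)

lemma young_diagram_finite: "young_diagram D \<Longrightarrow> finite D"
  by (simp add: young_diagram_def)

lemma young_diagram_down: "young_diagram D \<Longrightarrow> (r, c) \<in> D \<Longrightarrow> r' \<le> r \<Longrightarrow> c' \<le> c \<Longrightarrow> (r', c') \<in> D"
  unfolding young_diagram_def by blast

lemma young_diagram_empty [simp]: "young_diagram {}"
  by (simp add: young_diagram_def)

lemma young_diagram_insert: "b \<in> outer_corners D \<Longrightarrow> young_diagram (insert b D)"
  by (simp add: outer_corners_def)

lemma outer_corner_not_mem: "b \<in> outer_corners D \<Longrightarrow> b \<notin> D"
  by (simp add: outer_corners_def)

text \<open>Only the neighbours above and to the left have to be tested: every other box of the
  rectangle spanned by the new box lies weakly above and to the left of one of them.\<close>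

lemma outer_corners_iff:
  assumes "young_diagram D"
  shows "(r, c) \<in> outer_corners D \<longleftrightarrow>
    (r, c) \<notin> D \<and> (r = 0 \<or> (r - 1, c) \<in> D) \<and> (c = 0 \<or> (r, c - 1) \<in> D)"
proof
  assume a: "(r, c) \<in> outer_corners D"
  have y: "young_diagram (insert (r, c) D)" using a by (rule young_diagram_insert)
  have "r = 0 \<or> (r - 1, c) \<in> D"
    using young_diagram_down[OF y, of r c "r - 1" c] by (cases r) auto
  moreover have "c = 0 \<or> (r, c - 1) \<in> D"
    using young_diagram_down[OF y, of r c r "c - 1"] by (cases c) auto
  ultimately show "(r, c) \<notin> D \<and> (r = 0 \<or> (r - 1, c) \<in> D) \<and> (c = 0 \<or> (r, c - 1) \<in> D)"
    using outer_corner_not_mem[OF a] by simp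
next
  assume a: "(r, c) \<notin> D \<and> (r = 0 \<or> (r - 1, c) \<in> D) \<and> (c = 0 \<or> (r, c - 1) \<in> D)"
  have "(r', c') \<in> insert (r, c) D" if "r' \<le> r" "c' \<le> c" for r' c'
  proof (cases "r' = r")
    case True
    show ?thesis
    proof (cases "c' = c")
      case False
      with a that True young_diagram_down[OF assms, of r "c - 1" r' c'] show ?thesis by auto
    qed (use True in auto)
  next
    case False
    with a that young_diagram_down[OF assms, of "r - 1" c r' c'] show ?thesis by auto
  qed
  then show "(r, c) \<in> outer_corners D"
    using a assms unfolding outer_corners_def young_diagram_def by auto
qed

text \<open>Of two distinct outer corners neither is weakly above and to the left of the other, so
  one lies strictly higher and strictly further right, and the two differences add up in the
  content. Contents therefore distinguish corners, and two corners never have consecutive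
  contents.\<close>

lemma outer_corners_content_diff:
  assumes D: "young_diagram D" and x: "x \<in> outer_corners D" and y: "y \<in> outer_corners D"
    and neq: "x \<noteq> y"
  shows "\<bar>content x - content y\<bar> \<ge> 2"
proof -
  have aux: "\<not> (a \<le> a' \<and> b \<le> b')"
    if "(a, b) \<in> outer_corners D" "(a', b') \<in> outer_corners D" "(a, b) \<noteq> (a', b')" for a b a' b'
  proof
    assume le: "a \<le> a' \<and> b \<le> b'"
    have "(a, b) \<in> insert (a', b') D"
      using young_diagram_down[OF young_diagram_insert[OF that(2)]] le by blast
    with that(1,3) show False using outer_corner_not_mem by auto
  qed
  obtain a b where x': "x = (a, b)" by (cases x)
  obtain a' b' where y': "y = (a', b')" by (cases y)
  have "\<not> (a \<le> a' \<and> b \<le> b')" "\<not> (a' \<le> a \<and> b' \<le> b)"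
    using aux[of a b a' b'] aux[of a' b' a b] x y neq by (auto simp: x' y')
  then show ?thesis by (auto simp: x' y' content_def)
qed

lemma outer_corners_content_eq:
  assumes "young_diagram D" "x \<in> outer_corners D" "y \<in> outer_corners D" "content x = content y"
  shows "x = y"
  using outer_corners_content_diff[OF assms(1-3)] assms(4) by auto

lemma finite_outer_corners:
  assumes D: "young_diagram D"
  shows "finite (outer_corners D)"
proof (rule finite_subset)
  show "outer_corners D \<subseteq> insert (0, 0) (right ` D \<union> below ` D)"
  proof
    fix x assume x: "x \<in> outer_corners D"
    obtain a b where [simp]: "x = (a, b)" by (cases x)
    have "(a = 0 \<or> (a - 1, b) \<in> D) \<and> (b = 0 \<or> (a, b - 1) \<in> D)"
      using x outer_corners_iff[OF D] by simp
    then show "x \<in> insert (0, 0) (right ` D \<union> below ` D)"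
      by (cases a; cases b) (force simp: right_def below_def image_iff)+
  qed
  show "finite (insert (0, 0) (right ` D \<union> below ` D))"
    using young_diagram_finite[OF D] by auto
qed

lemma outer_corners_empty [simp]: "outer_corners {} = {(0, 0)}"
  using outer_corners_iff[OF young_diagram_empty] by auto

lemma outer_corners_nonempty:
  assumes D: "young_diagram D"
  shows "outer_corners D \<noteq> {}"
proof -
  have "finite (snd ` D)" using young_diagram_finite[OF D] by simp
  then obtain c where "c \<notin> snd ` D" using ex_new_if_finite[OF infinite_UNIV_nat] by blast
  then have ex: "\<exists>c. (0, c) \<notin> D" by (force simp: image_iff)
  define c where "c = (LEAST c. (0, c) \<notin> D)"
  have 1: "(0, c) \<notin> D" unfolding c_def using ex by (rule LeastI_ex)
  have "c = 0 \<or> (0, c - 1) \<in> D"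
    using not_less_Least[of "c - 1" "\<lambda>c. (0, c) \<notin> D", folded c_def] by (cases c) auto
  then have "(0, c) \<in> outer_corners D" using 1 outer_corners_iff[OF D] by simp
  then show ?thesis by blast
qed

lemma outer_corners_insert:
  assumes D: "young_diagram D" and b: "b \<in> outer_corners D"
  shows "outer_corners (insert b D) =
    (outer_corners D - {b}) \<union> (outer_corners (insert b D) \<inter> {right b, below b})" (is "?L = ?R")
proof (intro Set.set_eqI)
  fix x :: box
  have D': "young_diagram (insert b D)" using b by (rule young_diagram_insert)
  obtain r c where [simp]: "x = (r, c)" by (cases x)
  obtain br bc where [simp]: "b = (br, bc)" by (cases b)
  have 1: "x \<in> outer_corners D" if "x \<in> outer_corners (insert b D)" "x \<notin> {right b, below b}"
    using that unfolding \<open>x = (r, c)\<close> outer_corners_iff[OF D] outer_corners_iff[OF D']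
    by (cases r; cases c) (auto simp: right_def below_def)
  have 2: "x \<in> outer_corners (insert b D)" if "x \<in> outer_corners D" "x \<noteq> b"
    using that unfolding \<open>x = (r, c)\<close> outer_corners_iff[OF D] outer_corners_iff[OF D'] by auto
  have 3: "b \<notin> outer_corners (insert b D)" using outer_corner_not_mem by blast
  show "x \<in> ?L \<longleftrightarrow> x \<in> ?R" using 1 2 3 by blast
qed

section \<open>Paths of Young diagrams and their contents\<close>

definition is_path :: "nat \<Rightarrow> (nat \<Rightarrow> box) \<Rightarrow> bool" where
  "is_path n t \<longleftrightarrow> (\<forall>k\<in>{1..n}. t k \<in> outer_corners (t ` {1..<k}))"

text \<open>The fixed value outside the interval makes a path a single function, so that there are
  finitely many of them and equality of functions is equality of paths.\<close>

definition paths :: "nat \<Rightarrow> (nat \<Rightarrow> box) set" where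
  "paths n = {t. is_path n t \<and> (\<forall>k. k \<notin> {1..n} \<longrightarrow> t k = (0, 0))}"

lemma is_path_0 [simp]: "is_path 0 t"
  by (simp add: is_path_def)

lemma is_path_Suc: "is_path (Suc n) t \<longleftrightarrow> is_path n t \<and> t (Suc n) \<in> outer_corners (t ` {1..n})"
proof -
  have "{1..Suc n} = insert (Suc n) {1..n}" "{1..<Suc n} = {1..n}" by auto
  then show ?thesis by (simp add: is_path_def conj_commute)
qed

lemma is_path_mono: "is_path n t \<Longrightarrow> m \<le> n \<Longrightarrow> is_path m t"
  by (auto simp: is_path_def)

lemma is_path_corner: "is_path n t \<Longrightarrow> 1 \<le> k \<Longrightarrow> k \<le> n \<Longrightarrow> t k \<in> outer_corners (t ` {1..<k})"
  by (auto simp: is_path_def)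

lemma is_path_cong: "(\<And>k. k \<in> {1..n} \<Longrightarrow> t k = u k) \<Longrightarrow> is_path n t = is_path n u"
  unfolding is_path_def
  by (intro ball_cong refl arg_cong2[where f = "(\<in>)"] arg_cong[where f = outer_corners] image_cong) auto

lemma image_Suc_interval: "t ` {1..Suc n} = insert (t (Suc n)) (t ` {1..n})"
  by (simp add: atLeastAtMostSuc_conv)

lemma is_path_young: "is_path n t \<Longrightarrow> young_diagram (t ` {1..n})"
proof (induction n)
  case (Suc n)
  then show ?case unfolding image_Suc_interval by (simp add: is_path_Suc young_diagram_insert)
qed simp

lemma is_path_young': "is_path n t \<Longrightarrow> 1 \<le> k \<Longrightarrow> k \<le> n \<Longrightarrow> young_diagram (t ` {1..<k})"
  using is_path_young[OF is_path_mono, of n t "k - 1"] atLeastLessThanSuc_atLeastAtMost[of 1 "k - 1"]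
  by auto

lemma is_path_neq:
  assumes "is_path n t" "1 \<le> i" "i < j" "j \<le> n"
  shows "t i \<noteq> t j"
proof -
  have "t j \<notin> t ` {1..<j}"
    using outer_corner_not_mem[OF is_path_corner[OF assms(1), of j]] assms by simp
  moreover have "t i \<in> t ` {1..<j}" using assms by simp
  ultimately show ?thesis by metis
qed

lemma is_path_inj: "is_path n t \<Longrightarrow> inj_on t {1..n}"
  by (rule inj_onI) (metis atLeastAtMost_iff is_path_neq linorder_neqE_nat)

text \<open>At each step the next box is an outer corner of the diagram reached so far, and the
  corners of one diagram have distinct contents. This is what turns joint eigenvalues into
  paths.\<close>

lemma is_path_eqI:
  assumes t: "is_path n t" and u: "is_path n u"
    and c: "\<And>k. k \<in> {1..n} \<Longrightarrow> content (t k) = content (u k)"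
    and k: "k \<in> {1..n}"
  shows "t k = u k"
  using k
proof (induction k rule: less_induct)
  case (less k)
  have "t ` {1..<k} = u ` {1..<k}" using less by (intro image_cong) auto
  then show ?case
    using outer_corners_content_eq[OF is_path_young'[OF t] is_path_corner[OF t], of k "u k"]
      is_path_corner[OF u, of k] c[OF less.prems] less.prems by auto
qed

lemma paths_eqI:
  assumes t: "t \<in> paths n" and u: "u \<in> paths n"
    and c: "\<And>k. k \<in> {1..n} \<Longrightarrow> content (t k) = content (u k)"
  shows "t = u"
proof
  fix k
  show "t k = u k"
    using is_path_eqI[of n t u k] assms by (cases "k \<in> {1..n}") (auto simp: paths_def)
qed

lemma paths_Suc:
  "bij_betw (\<lambda>(t, b). t(Suc n := b)) (SIGMA t:paths n. outer_corners (t ` {1..n})) (paths (Suc n))"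
proof (rule bij_betwI[where g = "\<lambda>t. (t(Suc n := (0, 0)), t (Suc n))"])
  have img: "(t(Suc n := b)) ` {1..n} = t ` {1..n}" for t :: "nat \<Rightarrow> box" and b
    by (intro image_cong) auto
  have pth: "is_path n (t(Suc n := b)) = is_path n t" for t b
    by (rule is_path_cong) auto
  show "(\<lambda>(t, b). t(Suc n := b)) \<in> (SIGMA t:paths n. outer_corners (t ` {1..n})) \<rightarrow> paths (Suc n)"
    by (auto simp: paths_def is_path_Suc img pth simp del: fun_upd_apply)
      (auto simp: le_Suc_eq)
  show "(\<lambda>t. (t(Suc n := (0, 0)), t (Suc n))) \<in> paths (Suc n) \<rightarrow>
      (SIGMA t:paths n. outer_corners (t ` {1..n}))"
    by (auto simp: paths_def is_path_Suc img pth simp del: fun_upd_apply)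
      (auto simp: le_Suc_eq)
qed (auto simp: paths_def fun_eq_iff)

lemma paths_0: "paths 0 = {\<lambda>_. (0, 0)}"
  by (auto simp: paths_def)

lemma finite_paths: "finite (paths n)"
proof (induction n)
  case (Suc n)
  have "finite (SIGMA t:paths n. outer_corners (t ` {1..n}))"
    using Suc by (intro finite_SigmaI finite_outer_corners is_path_young) (auto simp: paths_def)
  then show ?case using bij_betw_finite[OF paths_Suc] by blast
qed (simp add: paths_0)

section \<open>Exchanging two consecutive steps of a path\<close>

abbreviation adj :: "nat \<Rightarrow> nat \<Rightarrow> nat" where "adj i \<equiv> transpose i (Suc i)"

text \<open>Either the box \<open>t (Suc i)\<close> could have been added before \<open>t i\<close>,
  and then both are outer corners of the same diagram, or it became available only through
  \<open>t i\<close>, and then it is one of its two neighbours.\<close>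

lemma is_path_swap_cases:
  assumes t: "is_path n t" and i: "1 \<le> i" "i < n"
  shows "is_path n (t \<circ> adj i) \<and> \<bar>content (t (Suc i)) - content (t i)\<bar> \<ge> 2
    \<or> \<not> is_path n (t \<circ> adj i) \<and> t (Suc i) \<in> {right (t i), below (t i)}"
proof -
  define D where "D = t ` {1..<i}"
  have D: "young_diagram D" unfolding D_def using is_path_young'[OF t, of i] i by simp
  have D1: "t ` {1..<Suc i} = insert (t i) D"
    using i by (auto simp: D_def less_Suc_eq)
  have x: "t i \<in> outer_corners D" using is_path_corner[OF t, of i] i by (simp add: D_def)
  have y: "t (Suc i) \<in> outer_corners (insert (t i) D)"
    using is_path_corner[OF t, of "Suc i"] i D1 by simp
  have Di: "(t \<circ> adj i) ` {1..<i} = D"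
    unfolding D_def by (intro image_cong) (auto simp: transpose_def)
  have Dsi: "(t \<circ> adj i) ` {1..<Suc i} = insert (t (Suc i)) D"
    using i Di by (auto simp: atLeastLessThanSuc)
  have xy: "t i \<noteq> t (Suc i)" using is_path_neq[OF t, of i "Suc i"] i by simp
  have other: "(t \<circ> adj i) ` {1..<k} = t ` {1..<k}" "(t \<circ> adj i) k = t k"
    if "k \<noteq> i" "k \<noteq> Suc i" for k
  proof -
    have "adj i ` {1..<k} = {1..<k}"
    proof (cases "k < i")
      case True
      have "adj i ` {1..<k} = id ` {1..<k}"
        by (rule image_cong) (use True in \<open>auto simp: transpose_def\<close>)
      then show ?thesis by simp
    next
      case False
      with that i show ?thesis by (intro permutes_image permutes_swap_id) auto
    qed
    then show "(t \<circ> adj i) ` {1..<k} = t ` {1..<k}" by (simp only: image_comp[symmetric])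
    show "(t \<circ> adj i) k = t k" using that by (simp add: transpose_def)
  qed
  have swap: "is_path n (t \<circ> adj i) \<longleftrightarrow>
      t (Suc i) \<in> outer_corners D \<and> t i \<in> outer_corners (insert (t (Suc i)) D)"
  proof
    assume "is_path n (t \<circ> adj i)"
    from is_path_corner[OF this, of i] is_path_corner[OF this, of "Suc i"]
    show "t (Suc i) \<in> outer_corners D \<and> t i \<in> outer_corners (insert (t (Suc i)) D)"
      using i Di Dsi by auto
  next
    assume a: "t (Suc i) \<in> outer_corners D \<and> t i \<in> outer_corners (insert (t (Suc i)) D)"
    show "is_path n (t \<circ> adj i)"
      unfolding is_path_def
    proof
      fix k assume k: "k \<in> {1..n}"
      consider "k = i" | "k = Suc i" | "k \<noteq> i" "k \<noteq> Suc i" by blast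
      then show "(t \<circ> adj i) k \<in> outer_corners ((t \<circ> adj i) ` {1..<k})"
      proof cases
        case 1 then show ?thesis using a Di by simp
      next
        case 2 then show ?thesis using a Dsi by simp
      next
        case 3 then show ?thesis using other[of k] is_path_corner[OF t, of k] k by simp
      qed
    qed
  qed
  show ?thesis
  proof (cases "t (Suc i) \<in> outer_corners D")
    case True
    have "t i \<in> outer_corners (insert (t (Suc i)) D)"
      using outer_corners_insert[OF D True] x xy by blast
    with True swap outer_corners_content_diff[OF D True x] xy show ?thesis by auto
  next
    case False
    with swap y outer_corners_insert[OF D x] show ?thesis by blast
  qed
qed

lemma content_adjacent_neq:
  assumes "is_path n t" "1 \<le> i" "i < n"
  shows "content (t (Suc i)) \<noteq> content (t i)"
  using is_path_swap_cases[OF assms] by auto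

section \<open>Inversions and adjacent transpositions\<close>

definition inversions :: "nat \<Rightarrow> (nat \<Rightarrow> nat) \<Rightarrow> (nat \<times> nat) set" where
  "inversions n \<pi> = {(i, j). 1 \<le> i \<and> i < j \<and> j \<le> n \<and> \<pi> j < \<pi> i}"

abbreviation inv_num :: "nat \<Rightarrow> (nat \<Rightarrow> nat) \<Rightarrow> nat" where
  "inv_num n \<pi> \<equiv> card (inversions n \<pi>)"

lemma finite_inversions: "finite (inversions n \<pi>)"
  by (rule finite_subset[of _ "{1..n} \<times> {1..n}"]) (auto simp: inversions_def)

text \<open>Kept as a description of the set of inversions, not only of their number, because
  \<open>H\<close> is a product over inversions.\<close>

lemma inversions_adj:
  assumes i: "1 \<le> i" "i < n" and less: "\<pi> i < \<pi> (Suc i)"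
  shows "inversions n (\<pi> \<circ> adj i) = insert (i, Suc i) (map_prod (adj i) (adj i) ` inversions n \<pi>)"
    "(i, Suc i) \<notin> map_prod (adj i) (adj i) ` inversions n \<pi>"
    "inj_on (map_prod (adj i) (adj i)) (inversions n \<pi>)"
proof -
  show "inversions n (\<pi> \<circ> adj i) = insert (i, Suc i) (map_prod (adj i) (adj i) ` inversions n \<pi>)"
  proof (intro Set.set_eqI iffI)
    fix x assume "x \<in> inversions n (\<pi> \<circ> adj i)"
    then obtain a b where x: "x = (a, b)" "1 \<le> a" "a < b" "b \<le> n" "\<pi> (adj i b) < \<pi> (adj i a)"
      by (auto simp: inversions_def)
    show "x \<in> insert (i, Suc i) (map_prod (adj i) (adj i) ` inversions n \<pi>)"
    proof (cases "x = (i, Suc i)")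
      case False
      have "(adj i a, adj i b) \<in> inversions n \<pi>"
        using x False i by (auto simp: inversions_def transpose_def split: if_splits)
      then have "map_prod (adj i) (adj i) (adj i a, adj i b) \<in> map_prod (adj i) (adj i) ` inversions n \<pi>"
        by blast
      then show ?thesis using x by simp
    qed simp
  next
    fix x assume "x \<in> insert (i, Suc i) (map_prod (adj i) (adj i) ` inversions n \<pi>)"
    then consider "x = (i, Suc i)" | a b where "x = (adj i a, adj i b)" "(a, b) \<in> inversions n \<pi>"
      by auto
    then show "x \<in> inversions n (\<pi> \<circ> adj i)"
    proof cases
      case 1 then show ?thesis using i less by (simp add: inversions_def)
    next
      case 2
      then have "(a, b) \<noteq> (i, Suc i)" using less by (auto simp: inversions_def)
      with 2 show ?thesis using i by (auto simp: inversions_def transpose_def split: if_splits)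
    qed
  qed
  show "(i, Suc i) \<notin> map_prod (adj i) (adj i) ` inversions n \<pi>"
  proof
    assume "(i, Suc i) \<in> map_prod (adj i) (adj i) ` inversions n \<pi>"
    then obtain a b where "a < b" "adj i a = i" "adj i b = Suc i" by (auto simp: inversions_def)
    then show False by (auto simp: transpose_def split: if_splits)
  qed
  show "inj_on (map_prod (adj i) (adj i)) (inversions n \<pi>)"
    by (rule inj_on_subset[of _ UNIV]) (simp_all add: prod.inj_map)
qed

lemma inv_num_adj:
  assumes i: "1 \<le> i" "i < n" and less: "\<pi> i < \<pi> (Suc i)"
  shows "inv_num n (\<pi> \<circ> adj i) = Suc (inv_num n \<pi>)"
  using inversions_adj[OF assms] by (simp add: card_image finite_inversions)

lemma inv_num_adj':
  assumes i: "1 \<le> i" "i < n" and less: "\<pi> (Suc i) < \<pi> i"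
  shows "Suc (inv_num n (\<pi> \<circ> adj i)) = inv_num n \<pi>"
  using inv_num_adj[of i n "\<pi> \<circ> adj i"] assms by (simp add: comp_assoc)

text \<open>Without a descent the values increase, so \<open>i \<le> \<pi> i\<close> throughout;
  both sides have the same sum, which forces equality.\<close>

lemma permutes_descent:
  assumes \<pi>: "\<pi> permutes {1..n}" and "\<pi> \<noteq> id"
  obtains i where "1 \<le> i" "i < n" "\<pi> (Suc i) < \<pi> i"
proof -
  have "\<exists>i. 1 \<le> i \<and> i < n \<and> \<pi> (Suc i) < \<pi> i"
  proof (rule ccontr)
    assume "\<not> ?thesis"
    then have less: "\<pi> i < \<pi> (Suc i)" if "1 \<le> i" "i < n" for i
      using that permutes_inj[OF \<pi>] by (metis injD n_not_Suc_n linorder_neqE_nat)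
    have ge: "i \<le> \<pi> i" if "i \<in> {1..n}" for i
      using that
    proof (induction i)
      case (Suc i)
      show ?case
      proof (cases "i = 0")
        case True
        have "\<pi> (Suc i) \<in> {1..n}" using permutes_in_image[OF \<pi>] Suc.prems by blast
        then show ?thesis using True by simp
      next
        case False
        then show ?thesis using Suc less[of i] by auto
      qed
    qed simp
    have "(\<Sum>i\<in>{1..n}. \<pi> i) = \<Sum>{1..n}"
      using sum.permute[OF \<pi>, of id] by simp
    then have eq: "\<pi> i = i" if "i \<in> {1..n}" for i
      using that sum_mono_inv[of "\<lambda>i. i" "{1..n}" \<pi> i] ge by auto
    have "\<pi> = id"
      using eq permutes_not_in[OF \<pi>] by (metis eq_id_iff)
    with assms(2) show False by simp
  qed
  with that show ?thesis by blast
qed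

lemma adj_permutes: "1 \<le> i \<Longrightarrow> i < n \<Longrightarrow> adj i permutes {1..n}"
  by (rule permutes_swap_id) auto

text \<open>If the swap failed, \<open>t (\<pi> (Suc i))\<close> would be the right or lower
  neighbour of \<open>t (\<pi> i)\<close>, so \<open>t\<close> would have to add it later, although
  \<open>\<pi> (Suc i) < \<pi> i\<close>.\<close>

lemma is_path_descent_swap:
  assumes t: "is_path n t" and u: "is_path n (t \<circ> \<pi>)" and \<pi>: "\<pi> permutes {1..n}"
    and i: "1 \<le> i" "i < n" and less: "\<pi> (Suc i) < \<pi> i"
  shows "is_path n (t \<circ> \<pi> \<circ> adj i)"
proof (rule ccontr)
  assume "\<not> ?thesis"
  with is_path_swap_cases[OF u i] have nb: "t (\<pi> (Suc i)) \<in> {right (t (\<pi> i)), below (t (\<pi> i))}"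
    by auto
  define j where "j = \<pi> (Suc i)"
  have j: "1 \<le> j" "j \<le> n" and pi: "1 \<le> \<pi> i" "\<pi> i \<le> n"
    using permutes_in_image[OF \<pi>, of i] permutes_in_image[OF \<pi>, of "Suc i"] i by (auto simp: j_def)
  have tj: "t j \<in> outer_corners (t ` {1..<j})" by (rule is_path_corner[OF t j])
  obtain r c where rc: "t (\<pi> i) = (r, c)" by fastforce
  have "(r, c) \<in> insert (t j) (t ` {1..<j})"
    using nb young_diagram_down[OF young_diagram_insert[OF tj], of "fst (t j)" "snd (t j)" r c]
    by (auto simp: rc right_def below_def simp flip: j_def)
  then obtain k where "1 \<le> k" "k \<le> j" "t k = t (\<pi> i)" using j by (auto simp: rc)
  then show False using is_path_neq[OF t, of k "\<pi> i"] less pi by (auto simp: j_def)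
qed

lemma same_shape_permutes:
  assumes t: "is_path n t" and u: "is_path n u" and eq: "t ` {1..n} = u ` {1..n}"
  obtains \<pi> where "\<pi> permutes {1..n}" "\<And>k. k \<in> {1..n} \<Longrightarrow> u k = t (\<pi> k)"
proof -
  define \<pi> where "\<pi> k = (if k \<in> {1..n} then inv_into {1..n} t (u k) else k)" for k
  have bt: "bij_betw t {1..n} (u ` {1..n})" using is_path_inj[OF t] eq by (simp add: bij_betw_def)
  have bu: "bij_betw u {1..n} (u ` {1..n})" using is_path_inj[OF u] by (simp add: bij_betw_def)
  have "bij_betw (inv_into {1..n} t \<circ> u) {1..n} {1..n}"
    by (rule bij_betw_trans[OF bu bij_betw_inv_into[OF bt]])
  then have "bij_betw \<pi> {1..n} {1..n}"
    by (rule bij_betw_cong[THEN iffD1, rotated]) (simp add: \<pi>_def)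
  then have 1: "\<pi> permutes {1..n}" by (rule bij_imp_permutes) (auto simp: \<pi>_def)
  have 2: "u k = t (\<pi> k)" if "k \<in> {1..n}" for k
    using that eq by (simp add: \<pi>_def f_inv_into_f)
  show ?thesis using that 1 2 by blast
qed

text \<open>Write \<open>u\<close> as \<open>t \<circ> \<pi>\<close>. Undoing a descent of
  \<open>\<pi>\<close> stays within the paths and lowers the number of inversions, so adjacent swaps
  connect all paths of one shape.\<close>

lemma same_shape_induct:
  assumes t: "is_path n t" and u: "is_path n u" and eq: "t ` {1..n} = u ` {1..n}"
    and cong: "\<And>v w. (\<And>k. k \<in> {1..n} \<Longrightarrow> v k = w k) \<Longrightarrow> P v \<Longrightarrow> P w"
    and step: "\<And>v i. is_path n v \<Longrightarrow> 1 \<le> i \<Longrightarrow> i < n \<Longrightarrow> is_path n (v \<circ> adj i) \<Longrightarrow> P v \<Longrightarrow> P (v \<circ> adj i)"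
    and base: "P t"
  shows "P u"
proof -
  obtain \<pi> where \<pi>: "\<pi> permutes {1..n}" "\<And>k. k \<in> {1..n} \<Longrightarrow> u k = t (\<pi> k)"
    using same_shape_permutes[OF t u eq] by blast
  have "P (t \<circ> \<pi>)" if "\<pi> permutes {1..n}" "is_path n (t \<circ> \<pi>)" for \<pi>
    using that
  proof (induction "inv_num n \<pi>" arbitrary: \<pi> rule: less_induct)
    case less
    show ?case
    proof (cases "\<pi> = id")
      case False
      then obtain i where i: "1 \<le> i" "i < n" "\<pi> (Suc i) < \<pi> i"
        using permutes_descent[OF less.prems(1)] by blast
      have p: "is_path n (t \<circ> (\<pi> \<circ> adj i))"
        using is_path_descent_swap[OF t less.prems(2,1) i] by (simp add: comp_assoc)
      have "inv_num n (\<pi> \<circ> adj i) < inv_num n \<pi>"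
        using inv_num_adj'[OF i] by simp
      from less.hyps[OF this permutes_compose[OF adj_permutes[OF i(1,2)] less.prems(1)] p]
      have "P (t \<circ> (\<pi> \<circ> adj i))" .
      from step[OF p i(1,2) _ this] show ?thesis using less.prems(2) by (simp add: comp_assoc)
    qed (use base in simp)
  qed
  moreover have "is_path n (t \<circ> \<pi>)" using u is_path_cong[of n u "t \<circ> \<pi>"] \<pi>(2) by simp
  ultimately have "P (t \<circ> \<pi>)" using \<pi>(1) by blast
  then show ?thesis by (rule cong[rotated]) (simp add: \<pi>(2))
qed

section \<open>Removable boxes and paths that end with prescribed boxes\<close>

definition inner_corners :: "box set \<Rightarrow> box set" where
  "inner_corners D = {b \<in> D. right b \<notin> D \<and> below b \<notin> D}"

lemma young_diagram_remove:
  assumes D: "young_diagram D" and x: "x \<in> inner_corners D"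
  shows "young_diagram (D - {x})" "x \<in> outer_corners (D - {x})"
proof -
  obtain r c where rc: "x = (r, c)" by (cases x)
  have n: "(r', c') \<notin> D" if "r \<le> r'" "c \<le> c'" "(r', c') \<noteq> (r, c)" for r' c'
  proof
    assume a: "(r', c') \<in> D"
    have "(Suc r, c) \<in> D \<or> (r, Suc c) \<in> D"
      using young_diagram_down[OF D a, of "Suc r" c] young_diagram_down[OF D a, of r "Suc c"] that
      by (cases "r' = r") auto
    then show False using x rc by (auto simp: inner_corners_def right_def below_def)
  qed
  show 1: "young_diagram (D - {x})"
    using D n unfolding young_diagram_def rc by blast
  have "insert x (D - {x}) = D" using x by (auto simp: inner_corners_def)
  then show "x \<in> outer_corners (D - {x})" using D by (simp add: outer_corners_def)
qed

lemma inner_corner_iff_outer: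
  assumes D: "young_diagram D"
  shows "x \<in> inner_corners D \<longleftrightarrow> x \<in> D \<and> young_diagram (D - {x})"
proof
  assume "x \<in> inner_corners D"
  then show "x \<in> D \<and> young_diagram (D - {x})" 
    using young_diagram_remove[OF D] by (auto simp: inner_corners_def)
next
  assume a: "x \<in> D \<and> young_diagram (D - {x})"
  obtain r c where rc: "x = (r, c)" by (cases x)
  have "(r', c') \<notin> D" if "r \<le> r'" "c \<le> c'" "(r', c') \<noteq> (r, c)" for r' c'
    using a that young_diagram_down[of "D - {x}" r' c' r c] rc by auto
  then show "x \<in> inner_corners D" using a by (auto simp: inner_corners_def rc right_def below_def)
qed

text \<open>A box that maximizes row plus column has neither a right nor a lower neighbour.\<close>

lemma inner_corner_exists:
  assumes D: "young_diagram D" and ne: "D \<noteq> {}"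
  shows "inner_corners D \<noteq> {}"
proof -
  have fin: "finite ((\<lambda>b. fst b + snd b) ` D)" using young_diagram_finite[OF D] by simp
  obtain x where x: "x \<in> D" "\<And>y. y \<in> D \<Longrightarrow> fst y + snd y \<le> fst x + snd x"
    using Max_in[OF fin] Max_ge[OF fin] ne by (metis (no_types, lifting) imageE imageI image_is_empty)
  have "x \<in> inner_corners D"
    using x(1) x(2)[of "right x"] x(2)[of "below x"] by (auto simp: inner_corners_def right_def below_def)
  then show ?thesis by blast
qed

lemma image_upd_Suc [simp]: "(t(Suc n := b)) ` {1..n} = t ` {1..n}"
  by (intro image_cong) auto

lemma is_path_upd_Suc [simp]: "is_path n (t(Suc n := b)) = is_path n t"
  by (rule is_path_cong) auto

lemma path_exists:
  assumes "young_diagram D"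
  shows "\<exists>t. is_path (card D) t \<and> t ` {1..card D} = D"
  using assms
proof (induction "card D" arbitrary: D)
  case 0
  then have "D = {}" using young_diagram_finite by auto
  then show ?case by auto
next
  case (Suc n)
  then have "D \<noteq> {}" by auto
  with inner_corner_exists[OF Suc.prems] obtain x where x: "x \<in> inner_corners D" by blast
  note y = young_diagram_remove[OF Suc.prems x]
  have xD: "x \<in> D" using x by (simp add: inner_corners_def)
  have n: "card (D - {x}) = n" using Suc.hyps(2) xD young_diagram_finite[OF Suc.prems] by simp
  obtain t where t: "is_path n t" "t ` {1..n} = D - {x}" using Suc.hyps(1)[OF n[symmetric] y(1)] n by auto
  have "is_path (Suc n) (t(Suc n := x)) \<and> (t(Suc n := x)) ` {1..Suc n} = D"
    unfolding image_Suc_interval is_path_Suc using t y xD by auto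
  then show ?case using Suc.hyps(2) by metis
qed

text \<open>Let \<open>b\<close> be the last box. If its right neighbour cannot be added, the box
  above that neighbour is missing, so the box above \<open>b\<close> ends its row and can be removed
  once \<open>b\<close> is gone; it has the same content as the right neighbour. The lower neighbour
  is symmetric, with the box to the left of \<open>b\<close>. A path that adds this box just before
  \<open>b\<close> is the one wanted.\<close>

lemma path_through_neighbour:
  assumes U: "is_path (Suc m) U"
    and nb: "nb \<in> {right (U (Suc m)), below (U (Suc m))}"
    and bad: "nb \<notin> outer_corners (U ` {1..Suc m})"
  obtains V where "is_path (Suc m) V" "V ` {1..Suc m} = U ` {1..Suc m}" "V (Suc m) = U (Suc m)"
    "1 \<le> m" "content (V m) = content nb"
proof -
  define b where "b = U (Suc m)"
  define N where "N = U ` {1..m}"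
  have N: "young_diagram N" unfolding N_def using U by (intro is_path_young) (simp add: is_path_Suc)
  have bN: "b \<in> outer_corners N" using U by (simp add: is_path_Suc b_def N_def)
  have D: "U ` {1..Suc m} = insert b N" by (simp only: image_Suc_interval b_def N_def)
  have yD: "young_diagram (insert b N)" using bN by (rule young_diagram_insert)
  obtain r c where b: "b = (r, c)" by (cases b)
  have bnot: "b \<notin> N" using bN by (rule outer_corner_not_mem)
  have nbnot: "nb \<notin> insert b N"
    using nb bnot young_diagram_down[OF N, of r "Suc c" r c] young_diagram_down[OF N, of "Suc r" c r c]
    by (auto simp: b_def[symmetric] b right_def below_def)
  have "\<exists>x. x \<in> inner_corners N \<and> content x = content nb"
  proof (cases "nb = right b")
    case True
    have "r \<noteq> 0 \<and> (r - 1, Suc c) \<notin> insert b N"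
      using bad nbnot True outer_corners_iff[OF yD, of r "Suc c"] unfolding D by (auto simp: right_def b)
    moreover from this have "(r - 1, c) \<in> N" using bN outer_corners_iff[OF N, of r c] b by auto
    ultimately have "(r - 1, c) \<in> inner_corners N \<and> content (r - 1, c) = content nb"
      using bnot True by (auto simp: inner_corners_def right_def below_def b content_def)
    then show ?thesis by blast
  next
    case False
    then have nb': "nb = below b" using nb b_def by auto
    have "c \<noteq> 0 \<and> (Suc r, c - 1) \<notin> insert b N"
      using bad nbnot nb' outer_corners_iff[OF yD, of "Suc r" c] unfolding D by (auto simp: below_def b)
    moreover from this have "(r, c - 1) \<in> N" using bN outer_corners_iff[OF N, of r c] b by auto
    ultimately have "(r, c - 1) \<in> inner_corners N \<and> content (r, c - 1) = content nb"
      using bnot nb' by (auto simp: inner_corners_def right_def below_def b content_def)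
    then show ?thesis by blast
  qed
  then obtain x where x: "x \<in> inner_corners N" "content x = content nb" by blast
  note y = young_diagram_remove[OF N x(1)]
  have xN: "x \<in> N" using x by (simp add: inner_corners_def)
  have cN: "card N = m" unfolding N_def
    using is_path_inj[of m U] U by (simp add: is_path_Suc card_image)
  have m: "1 \<le> m" using cN xN young_diagram_finite[OF N] by (metis One_nat_def Suc_leI card_gt_0_iff empty_iff)
  then obtain k where k: "m = Suc k" by (cases m) auto
  have "card (N - {x}) = k" using cN xN young_diagram_finite[OF N] k by simp
  with path_exists[OF y(1)] obtain t where t: "is_path k t" "t ` {1..k} = N - {x}" by auto
  define V where "V = (t(Suc k := x))(Suc m := b)"
  have "is_path (Suc k) (t(Suc k := x))" "(t(Suc k := x)) ` {1..Suc k} = N"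
    unfolding is_path_Suc image_Suc_interval is_path_upd_Suc image_upd_Suc using t y xN by auto
  then have V1: "is_path m V \<and> V ` {1..m} = N"
    unfolding V_def is_path_upd_Suc image_upd_Suc by (simp only: k)
  have V2: "V (Suc m) = b" "V m = x" by (auto simp: V_def k)
  show ?thesis
  proof (rule that[of V])
    show "is_path (Suc m) V" unfolding is_path_Suc using V1 V2 bN by simp
    show "V ` {1..Suc m} = U ` {1..Suc m}" using V1 V2 image_Suc_interval[of V m] D by simp
  qed (use V2 m x in \<open>auto simp: b_def\<close>)
qed

section \<open>Weights of Jucys-Murphy elements\<close>

text \<open>Horner evaluation at an element of a possibly noncommutative algebra. The coefficients
  are real and hence central.\<close>

definition ev :: "real poly \<Rightarrow> 'a::real_algebra_1 \<Rightarrow> 'a" where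
  "ev p x = fold_coeffs (\<lambda>a f. of_real a + x * f) p 0"

lemma ev_0 [simp]: "ev 0 x = 0"
  by (simp add: ev_def)

lemma ev_pCons [simp]: "ev (pCons a p) x = of_real a + x * ev p x"
  by (cases "p = 0 \<and> a = 0") (auto simp: ev_def)

lemma ev_1 [simp]: "ev 1 x = 1"
  by (simp add: one_pCons)

lemma ev_add: "ev (p + q) x = ev p x + ev q x"
  by (induction p q rule: poly_induct2) (simp_all add: algebra_simps)

lemma ev_smult: "ev (Polynomial.smult a p) x = a *\<^sub>R ev p x"
  by (induction p) (simp_all add: algebra_simps of_real_def)

lemma ev_mult: "ev (p * q) x = ev p x * ev q x"
  by (induction p) (simp_all add: algebra_simps ev_add ev_smult, simp add: of_real_def)

lemma ev_sum: "ev (\<Sum>i\<in>A. p i) x = (\<Sum>i\<in>A. ev (p i) x)"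
  by (induction A rule: infinite_finite_induct) (simp_all add: ev_add)

lemma ev_intertwine: "y * z = z * x \<Longrightarrow> ev p y * z = z * ev p x"
proof (induction p)
  case (pCons a p)
  have "y * ev p y * z = y * (z * ev p x)" using pCons by (simp add: mult.assoc)
  also have "\<dots> = z * x * ev p x" using pCons.prems by (simp add: mult.assoc[symmetric])
  finally show ?case by (simp add: algebra_simps of_real_def)
qed simp

lemma ev_commute: "x * z = z * x \<Longrightarrow> z * ev p x = ev p x * z"
  by (metis ev_intertwine)

lemma ev_eigen: "x * u = a *\<^sub>R u \<Longrightarrow> ev p x * u = poly p a *\<^sub>R u"
proof (induction p)
  case (pCons b p)
  have "x * ev p x * u = x * (poly p a *\<^sub>R u)" using pCons by (simp add: mult.assoc)
  then show ?case using pCons.prems by (simp add: algebra_simps of_real_def)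
qed simp

section \<open>Lagrange interpolation at the contents of the outer corners\<close>

definition cnt :: "box \<Rightarrow> real" where "cnt b = of_int (content b)"

text \<open>The factor of p_T for the step that adds \<open>b\<close> to \<open>D\<close>, with real
  instead of complex coefficients.\<close>

definition lagrange_poly :: "box set \<Rightarrow> box \<Rightarrow> real poly" where
  "lagrange_poly D b = (\<Prod>b'\<in>outer_corners D - {b}. Polynomial.smult (1 / (cnt b - cnt b')) [:- cnt b', 1:])"

text \<open>It will annihilate the next Jucys-Murphy element on a path of shape \<open>D\<close>,
  see \<open>eigen_and_corner_poly\<close>.\<close>

definition corner_poly :: "box set \<Rightarrow> real poly" where
  "corner_poly D = (\<Prod>b\<in>outer_corners D. [:- cnt b, 1:])"

lemma cnt_inj: "young_diagram D \<Longrightarrow> inj_on cnt (outer_corners D)"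
  by (rule inj_onI) (simp add: cnt_def outer_corners_content_eq)

lemma poly_lagrange_poly:
  assumes D: "young_diagram D" and b: "b \<in> outer_corners D" "b' \<in> outer_corners D"
  shows "poly (lagrange_poly D b) (cnt b') = (if b = b' then 1 else 0)"
proof (cases "b = b'")
  case True
  have "cnt b \<noteq> cnt x" if "x \<in> outer_corners D - {b}" for x
    using inj_onD[OF cnt_inj[OF D]] b that by blast
  then have "poly (Polynomial.smult (1 / (cnt b - cnt x)) [:- cnt x, 1:]) (cnt b) = 1"
    if "x \<in> outer_corners D - {b}" for x
    using that by (simp add: diff_divide_distrib[symmetric])
  then have "poly (lagrange_poly D b) (cnt b) = 1"
    unfolding lagrange_poly_def poly_prod by (intro prod.neutral) blast
  then show ?thesis using True by simp
next
  case False
  then show ?thesis using b finite_outer_corners[OF D] by (auto simp: lagrange_poly_def poly_prod)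
qed

lemma degree_lagrange_poly:
  assumes D: "young_diagram D" and b: "b \<in> outer_corners D"
  shows "degree (lagrange_poly D b) < card (outer_corners D)"
proof -
  have "degree (lagrange_poly D b) \<le> (\<Sum>b'\<in>outer_corners D - {b}. degree (Polynomial.smult (1 / (cnt b - cnt b')) [:- cnt b', 1:]))"
    unfolding lagrange_poly_def using finite_outer_corners[OF D] by (intro degree_prod_sum_le[THEN order_trans]) auto
  also have "\<dots> \<le> (\<Sum>b'\<in>outer_corners D - {b}. 1)" by (intro sum_mono) simp
  also have "\<dots> = card (outer_corners D - {b})" by simp
  also have "\<dots> < card (outer_corners D)"
    using b finite_outer_corners[OF D] by (intro psubset_card_mono) auto
  finally show ?thesis .
qed

text \<open>Both sides have degree below the number of corners and agree at all their contents. The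
  projectors sum to 1 for this reason.\<close>

lemma sum_lagrange_poly:
  assumes D: "young_diagram D"
  shows "(\<Sum>b\<in>outer_corners D. lagrange_poly D b) = 1"
proof (rule poly_eqI_degree)
  fix x assume "x \<in> cnt ` outer_corners D"
  then obtain b where b: "b \<in> outer_corners D" "x = cnt b" by auto
  have "poly (\<Sum>b\<in>outer_corners D. lagrange_poly D b) x = (\<Sum>b'\<in>outer_corners D. if b' = b then 1 else 0)"
    unfolding poly_sum b(2) by (intro sum.cong refl poly_lagrange_poly[OF D _ b(1)])
  then show "poly (\<Sum>b\<in>outer_corners D. lagrange_poly D b) x = poly 1 x"
    using b finite_outer_corners[OF D] by (simp add: sum.delta)
next
  have c: "card (cnt ` outer_corners D) = card (outer_corners D)"
    by (rule card_image[OF cnt_inj[OF D]])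
  have pos: "0 < card (outer_corners D)"
    using outer_corners_nonempty[OF D] finite_outer_corners[OF D] by (simp add: card_gt_0_iff)
  show "degree (\<Sum>b\<in>outer_corners D. lagrange_poly D b) < card (cnt ` outer_corners D)"
    unfolding c using degree_lagrange_poly[OF D] pos by (intro degree_sum_less) auto
  show "degree (1 :: real poly) < card (cnt ` outer_corners D)" using c pos by simp
qed

lemma lagrange_poly_corner_poly:
  assumes D: "young_diagram D" and b: "b \<in> outer_corners D"
  obtains k where "[:- cnt b, 1:] * lagrange_poly D b = Polynomial.smult k (corner_poly D)"
proof
  let ?k = "\<Prod>b'\<in>outer_corners D - {b}. 1 / (cnt b - cnt b')"
  have "lagrange_poly D b = Polynomial.smult ?k (\<Prod>b'\<in>outer_corners D - {b}. [:- cnt b', 1:])"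
    unfolding lagrange_poly_def by (rule prod_smult)
  moreover have "corner_poly D = [:- cnt b, 1:] * (\<Prod>b'\<in>outer_corners D - {b}. [:- cnt b', 1:])"
    unfolding corner_poly_def using b finite_outer_corners[OF D] by (simp add: prod.remove)
  ultimately show "[:- cnt b, 1:] * lagrange_poly D b = Polynomial.smult ?k (corner_poly D)" by (simp only: mult_smult_right)
qed

definition rest :: "nat \<Rightarrow> (nat \<Rightarrow> box) \<Rightarrow> nat \<Rightarrow> box" where
  "rest n t k = (if k \<in> {1..n} then t k else (0, 0))"

lemma rest_eq [simp]: "k \<in> {1..n} \<Longrightarrow> rest n t k = t k"
  by (simp add: rest_def)

lemma is_path_rest: "is_path n (rest n t) = is_path n t"
  by (rule is_path_cong) simp

lemma paths_is_path: "t \<in> paths n \<Longrightarrow> is_path n t"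
  by (simp add: paths_def)

lemma paths_young: "t \<in> paths n \<Longrightarrow> young_diagram (t ` {1..n})"
  by (intro is_path_young paths_is_path)

lemma rest_in_paths: "is_path n t \<Longrightarrow> rest n t \<in> paths n"
  using is_path_rest[of n t] by (auto simp: paths_def rest_def)

text \<open>These are relations of the degenerate affine Hecke algebra together with
  \<open>X 1 = 0\<close>. The index is unbounded, so that an induction on \<open>n\<close> can pass
  to the next Jucys-Murphy element inside the same algebra.\<close>

locale jm_algebra =
  fixes s X :: "nat \<Rightarrow> 'a::real_algebra_1"
  assumes s_sq: "1 \<le> i \<Longrightarrow> s i * s i = 1"
    and braid: "1 \<le> i \<Longrightarrow> s i * s (Suc i) * s i = s (Suc i) * s i * s (Suc i)"
    and X_1: "X (Suc 0) = 0"
    and X_Suc: "1 \<le> i \<Longrightarrow> X (Suc i) = s i * X i * s i + s i"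
    and X_comm: "1 \<le> i \<Longrightarrow> 1 \<le> j \<Longrightarrow> X i * X j = X j * X i"
    and s_X: "1 \<le> i \<Longrightarrow> 1 \<le> j \<Longrightarrow> j \<noteq> i \<Longrightarrow> j \<noteq> Suc i \<Longrightarrow> s i * X j = X j * s i"
begin

lemma s_s: "1 \<le> i \<Longrightarrow> s i * (s i * x) = x"
  by (simp add: mult.assoc[symmetric] s_sq)

lemma X_Suc_s: "1 \<le> i \<Longrightarrow> X (Suc i) * s i = s i * X i + 1"
  by (simp add: X_Suc distrib_right mult.assoc s_sq)

lemma s_X_Suc: "1 \<le> i \<Longrightarrow> s i * X (Suc i) = X i * s i + 1"
  by (simp add: X_Suc distrib_left mult.assoc s_sq s_s)

fun proj :: "nat \<Rightarrow> (nat \<Rightarrow> box) \<Rightarrow> 'a" where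
  "proj 0 t = 1"
| "proj (Suc n) t = proj n t * ev (lagrange_poly (t ` {1..n}) (t (Suc n))) (X (Suc n))"

lemma proj_cong: "(\<And>k. k \<in> {1..n} \<Longrightarrow> t k = u k) \<Longrightarrow> proj n t = proj n u"
proof (induction n)
  case (Suc n)
  have "t ` {1..n} = u ` {1..n}" using Suc.prems by (intro image_cong) auto
  moreover have "proj n t = proj n u" using Suc by auto
  moreover have "t (Suc n) = u (Suc n)" using Suc.prems by auto
  ultimately show ?case by (simp only: proj.simps)
qed simp

lemma proj_rest: "proj n (rest n t) = proj n t"
  by (rule proj_cong) simp

lemma X_proj_comm: "1 \<le> j \<Longrightarrow> X j * proj n t = proj n t * X j"
proof (induction n)
  case (Suc n)
  have "X j * ev p (X (Suc n)) = ev p (X (Suc n)) * X j" for p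
    using Suc.prems by (intro ev_commute X_comm) auto
  then show ?case using Suc unfolding proj.simps by (metis mult.assoc)
qed simp

lemma s_proj_comm: "n < i \<Longrightarrow> s i * proj n t = proj n t * s i"
proof (induction n)
  case (Suc n)
  have "s i * ev p (X (Suc n)) = ev p (X (Suc n)) * s i" for p
    using Suc.prems by (intro ev_commute s_X[symmetric]) auto
  then show ?case using Suc unfolding proj.simps by (metis Suc_lessD mult.assoc)
qed simp

lemma sum_paths_Suc:
  "(\<Sum>t\<in>paths (Suc n). f t) = (\<Sum>t\<in>paths n. \<Sum>b\<in>outer_corners (t ` {1..n}). f (t(Suc n := b)))"
proof -
  have "(\<Sum>t\<in>paths (Suc n). f t) =
      (\<Sum>x\<in>(SIGMA t:paths n. outer_corners (t ` {1..n})). f ((\<lambda>(t, b). t(Suc n := b)) x))"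
    by (rule sum.reindex_bij_betw[OF paths_Suc, symmetric])
  also have "\<dots> = (\<Sum>t\<in>paths n. \<Sum>b\<in>outer_corners (t ` {1..n}). f (t(Suc n := b)))"
    using finite_outer_corners[OF paths_young] by (subst sum.Sigma) (auto simp: finite_paths split_def)
  finally show ?thesis .
qed

lemma sum_proj: "(\<Sum>t\<in>paths n. proj n t) = 1"
proof (induction n)
  case (Suc n)
  have "(\<Sum>b\<in>outer_corners (t ` {1..n}). proj (Suc n) (t(Suc n := b))) = proj n t"
    if "t \<in> paths n" for t
  proof -
    have y: "young_diagram (t ` {1..n})" using that by (rule paths_young)
    have "proj n (t(Suc n := b)) = proj n t" for b by (rule proj_cong) auto
    then have "(\<Sum>b\<in>outer_corners (t ` {1..n}). proj (Suc n) (t(Suc n := b))) =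
        (\<Sum>b\<in>outer_corners (t ` {1..n}). proj n t * ev (lagrange_poly (t ` {1..n}) b) (X (Suc n)))"
      unfolding proj.simps image_upd_Suc by simp
    also have "\<dots> = proj n t * ev (\<Sum>b\<in>outer_corners (t ` {1..n}). lagrange_poly (t ` {1..n}) b) (X (Suc n))"
      by (simp only: ev_sum sum_distrib_left)
    finally show ?thesis by (simp only: sum_lagrange_poly[OF y] ev_1 mult_1_right)
  qed
  then show ?case using Suc by (simp only: sum_paths_Suc) simp
qed (simp add: paths_0)

text \<open>A named predicate, because the facts about projectors that follow from it are used
  inside the induction that proves it.\<close>

definition eigen :: "nat \<Rightarrow> bool" where
  "eigen n \<longleftrightarrow> (\<forall>t. is_path n t \<longrightarrow> (\<forall>j\<in>{1..n}. X j * proj n t = cnt (t j) *\<^sub>R proj n t))"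

lemma eigenD: "eigen n \<Longrightarrow> is_path n t \<Longrightarrow> 1 \<le> j \<Longrightarrow> j \<le> n \<Longrightarrow> X j * proj n t = cnt (t j) *\<^sub>R proj n t"
  by (simp add: eigen_def)

lemma proj_weight_zero:
  assumes E: "eigen n" and t: "is_path n t" and j: "1 \<le> j" "j \<le> n"
    and x: "X j * x = a *\<^sub>R x" and neq: "a \<noteq> cnt (t j)"
  shows "proj n t * x = 0"
proof -
  have "a *\<^sub>R (proj n t * x) = proj n t * X j * x" using x by (simp add: mult.assoc)
  also have "\<dots> = X j * proj n t * x" using X_proj_comm[OF j(1)] by simp
  also have "\<dots> = cnt (t j) *\<^sub>R (proj n t * x)" using eigenD[OF E t j] by simp
  finally show ?thesis using neq by simp
qed

text \<open>Every projector kills such a vector, and the projectors sum to 1. Vectors are here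
  elements of the algebra, on which it acts from the left.\<close>

lemma weight_no_path_zero:
  assumes E: "eigen n"
    and x: "\<And>j. 1 \<le> j \<Longrightarrow> j \<le> n \<Longrightarrow> X j * x = a j *\<^sub>R x"
    and no: "\<And>t. is_path n t \<Longrightarrow> \<exists>j\<in>{1..n}. a j \<noteq> cnt (t j)"
  shows "x = 0"
proof -
  have "x = (\<Sum>t\<in>paths n. proj n t) * x" by (simp add: sum_proj)
  also have "\<dots> = (\<Sum>t\<in>paths n. proj n t * x)" by (rule sum_distrib_right)
  also have "\<dots> = 0"
  proof (rule sum.neutral, rule ballI)
    fix t assume "t \<in> paths n"
    then have t: "is_path n t" by (simp add: paths_def)
    from no[OF this] obtain j where "1 \<le> j" "j \<le> n" "a j \<noteq> cnt (t j)" by auto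
    with proj_weight_zero[OF E t] x show "proj n t * x = 0" by blast
  qed
  finally show ?thesis .
qed

lemma proj_weight:
  assumes E: "eigen n" and t: "is_path n t"
    and x: "\<And>j. 1 \<le> j \<Longrightarrow> j \<le> n \<Longrightarrow> X j * x = cnt (t j) *\<^sub>R x"
  shows "proj n t * x = x"
proof -
  have "proj n u * x = (if u = rest n t then proj n t * x else 0)" if u: "u \<in> paths n" for u
  proof (cases "u = rest n t")
    case False
    then obtain j where "j \<in> {1..n}" "content (u j) \<noteq> content (rest n t j)"
      using paths_eqI[OF u rest_in_paths[OF t]] by blast
    then have "proj n u * x = 0"
      using u by (intro proj_weight_zero[OF E, of u j x "cnt (t j)"] x) (auto simp: paths_def cnt_def)
    then show ?thesis using False by simp
  qed (simp add: proj_rest)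
  then have "(\<Sum>u\<in>paths n. proj n u * x) = proj n t * x"
    using rest_in_paths[OF t] by (simp add: finite_paths sum.delta)
  moreover have "(\<Sum>u\<in>paths n. proj n u * x) = x"
    by (simp only: sum_distrib_right[symmetric] sum_proj mult_1_left)
  ultimately show ?thesis by simp
qed

lemma proj_idem:
  assumes "eigen n" "is_path n t"
  shows "proj n t * proj n t = proj n t"
  using assms eigenD[OF assms] by (intro proj_weight) auto

lemma proj_orth:
  assumes E: "eigen n" and t: "is_path n t" and u: "is_path n u"
    and k: "k \<in> {1..n}" "t k \<noteq> u k"
  shows "proj n t * proj n u = 0"
proof -
  obtain j where j: "j \<in> {1..n}" "content (t j) \<noteq> content (u j)"
    using is_path_eqI[OF t u _ k(1)] k(2) by blast
  then show ?thesis
    using eigenD[OF E u] by (intro proj_weight_zero[OF E t, of j _ "cnt (u j)"]) (auto simp: cnt_def)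
qed

text \<open>On the span of \<open>x\<close> and \<open>s i * x\<close> the two Jucys-Murphy elements
  are triangular with diagonal entries \<open>a\<close> and \<open>b\<close> in opposite orders;
  since \<open>a \<noteq> b\<close>, subtracting the right multiple of \<open>x\<close> produces the
  second joint eigenvector.\<close>

lemma intertwiner_weights:
  assumes i: "1 \<le> i" and a: "X i * x = a *\<^sub>R x" and b: "X (Suc i) * x = b *\<^sub>R x" and ab: "a \<noteq> b"
  defines "y \<equiv> s i * x - (1 / (b - a)) *\<^sub>R x"
  shows "X i * y = b *\<^sub>R y" "X (Suc i) * y = a *\<^sub>R y"
    and "1 \<le> j \<Longrightarrow> j \<noteq> i \<Longrightarrow> j \<noteq> Suc i \<Longrightarrow> X j * x = c *\<^sub>R x \<Longrightarrow> X j * y = c *\<^sub>R y"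
proof -
  have "X i * (s i * x) = (X i * s i) * x" by (simp add: mult.assoc)
  also have "\<dots> = (s i * X (Suc i) - 1) * x" using s_X_Suc[OF i] by simp
  also have "\<dots> = s i * (X (Suc i) * x) - x" by (simp add: left_diff_distrib mult.assoc)
  finally have 1: "X i * (s i * x) = b *\<^sub>R (s i * x) - x" using b by simp
  have "a * (1 / (b - a)) + 1 = b * (1 / (b - a))" using ab by (simp add: field_simps)
  then have "(a * (1 / (b - a))) *\<^sub>R x + x = (b * (1 / (b - a))) *\<^sub>R x"
    by (metis scaleR_add_left scaleR_one)
  then show "X i * y = b *\<^sub>R y"
    unfolding y_def by (simp add: right_diff_distrib 1 a scaleR_right_diff_distrib) (simp add: algebra_simps)
  have "X (Suc i) * (s i * x) = (X (Suc i) * s i) * x" by (simp add: mult.assoc)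
  also have "\<dots> = s i * (X i * x) + x" using X_Suc_s[OF i] by (simp add: distrib_right mult.assoc)
  finally have 2: "X (Suc i) * (s i * x) = a *\<^sub>R (s i * x) + x" using a by simp
  have "b * (1 / (b - a)) - 1 = a * (1 / (b - a))" using ab by (simp add: field_simps)
  then have "(b * (1 / (b - a))) *\<^sub>R x - x = (a * (1 / (b - a))) *\<^sub>R x"
    by (metis scaleR_diff_left scaleR_one)
  then show "X (Suc i) * y = a *\<^sub>R y"
    unfolding y_def by (simp add: right_diff_distrib 2 b scaleR_right_diff_distrib) (simp add: algebra_simps)
  assume j: "1 \<le> j" "j \<noteq> i" "j \<noteq> Suc i" "X j * x = c *\<^sub>R x"
  have "X j * (s i * x) = s i * (X j * x)" using s_X[OF i j(1-3)] by (simp add: mult.assoc[symmetric])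
  then show "X j * y = c *\<^sub>R y"
    unfolding y_def by (simp add: right_diff_distrib j(4) scaleR_right_diff_distrib mult.commute)
qed

text \<open>The inverse axial distance, which is the diagonal entry of \<open>s i\<close> in Young's
  seminormal form.\<close>

definition axial :: "(nat \<Rightarrow> box) \<Rightarrow> nat \<Rightarrow> real" where
  "axial t i = 1 / (cnt (t (Suc i)) - cnt (t i))"

lemma cnt_adjacent_neq: "is_path n t \<Longrightarrow> 1 \<le> i \<Longrightarrow> i < n \<Longrightarrow> cnt (t i) \<noteq> cnt (t (Suc i))"
  using content_adjacent_neq[of n t i] by (auto simp: cnt_def)

lemma intertwiner_proj_weights:
  assumes E: "eigen n" and t: "is_path n t" and i: "1 \<le> i" "i < n" and j: "1 \<le> j" "j \<le> n"
    and x: "proj n t * x = x"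
  shows "X j * (s i * x - axial t i *\<^sub>R x) = cnt ((t \<circ> adj i) j) *\<^sub>R (s i * x - axial t i *\<^sub>R x)"
proof -
  have w: "X k * x = cnt (t k) *\<^sub>R x" if "1 \<le> k" "k \<le> n" for k
    using eigenD[OF E t that] x by (metis mult.assoc mult_scaleR_left)
  have i': "i \<le> n" "1 \<le> Suc i" "Suc i \<le> n" using i by auto
  note iw = intertwiner_weights[OF i(1) w[OF i(1) i'(1)] w[OF i'(2,3)] cnt_adjacent_neq[OF t i], folded axial_def]
  consider "j = i" | "j = Suc i" | "j \<noteq> i" "j \<noteq> Suc i" by blast
  then show ?thesis
  proof cases
    case 3
    then have "(t \<circ> adj i) j = t j" by (simp add: transpose_def)
    then show ?thesis using iw(3)[OF j(1) 3 w[OF j]] i by simp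
  qed (use iw i in auto)
qed

lemma s_proj_swap:
  assumes E: "eigen n" and t: "is_path n t" and i: "1 \<le> i" "i < n" and t': "is_path n (t \<circ> adj i)"
    and x: "proj n t * x = x"
  shows "proj n (t \<circ> adj i) * (s i * x - axial t i *\<^sub>R x) = s i * x - axial t i *\<^sub>R x"
  using assms by (intro proj_weight[OF E t'] intertwiner_proj_weights) auto

text \<open>The difference of the two sides has as its weights the contents of \<open>t\<close> with
  positions \<open>i\<close> and \<open>Suc i\<close> exchanged. No path has these contents, so the
  difference vanishes.\<close>

lemma s_proj_noswap:
  assumes E: "eigen n" and t: "is_path n t" and i: "1 \<le> i" "i < n" and t': "\<not> is_path n (t \<circ> adj i)"
    and x: "proj n t * x = x"
  shows "s i * x = axial t i *\<^sub>R x"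
proof -
  have "s i * x - axial t i *\<^sub>R x = 0"
  proof (rule weight_no_path_zero[OF E])
    fix j assume "1 \<le> j" "j \<le> n"
    then show "X j * (s i * x - axial t i *\<^sub>R x) = cnt ((t \<circ> adj i) j) *\<^sub>R (s i * x - axial t i *\<^sub>R x)"
      using intertwiner_proj_weights[OF E t i _ _ x] by blast
  next
    fix u assume u: "is_path n u"
    show "\<exists>j\<in>{1..n}. cnt ((t \<circ> adj i) j) \<noteq> cnt (u j)"
    proof (rule ccontr)
      assume "\<not> ?thesis"
      then have c: "content ((t \<circ> adj i) j) = content (u j)" if "j \<in> {1..n}" for j
        using that by (auto simp: cnt_def)
      have "content (t k) = content (u k)" if "1 \<le> k" "k < i" for k
        using c[of k] that i by (simp add: transpose_def)
      then have eq: "t k = u k" if "1 \<le> k" "k < i" for k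
        using that i by (intro is_path_eqI[of "i - 1" t u k] is_path_mono[OF t] is_path_mono[OF u]) auto
      have D: "t ` {1..<i} = u ` {1..<i}" using eq by (intro image_cong) auto
      have ui: "u i \<in> outer_corners (t ` {1..<i})"
        using is_path_corner[OF u, of i] i D by simp
      have ti: "t i \<in> outer_corners (t ` {1..<i})"
        using is_path_corner[OF t, of i] i by simp
      have y: "young_diagram (t ` {1..<i})" using is_path_young'[OF t, of i] i by simp
      have c1: "content (t (Suc i)) = content (u i)" using c[of i] i by simp
      have nb: "t (Suc i) \<in> {right (t i), below (t i)}" using is_path_swap_cases[OF t i] t' by blast
      \<comment> \<open>Such a path would add at step \<open>i\<close> an outer corner whose content
        differs by exactly 1 from that of the corner \<open>t i\<close> of the same diagram.\<close>
      have "u i = t i \<or> \<bar>content (u i) - content (t i)\<bar> \<ge> 2"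
        using outer_corners_content_diff[OF y ui ti] by blast
      then show False using nb c1 by auto
    qed
  qed
  then show ?thesis by simp
qed

end

section \<open>The intertwiner of two consecutive Jucys-Murphy elements\<close>

lemma intertwiner_commute:
  fixes x y \<sigma> :: "'a::ring_1"
  assumes ysx: "y * \<sigma> = \<sigma> * x + 1" and xy: "x * y = y * x"
  shows "y * (\<sigma> * x - x * \<sigma>) = (\<sigma> * x - x * \<sigma>) * x"
proof -
  have "y * (\<sigma> * x - x * \<sigma>) = (y * \<sigma>) * x - x * (y * \<sigma>)"
    by (simp add: right_diff_distrib mult.assoc[symmetric] xy)
  also have "\<dots> = (\<sigma> * x - x * \<sigma>) * x" unfolding ysx by (simp add: algebra_simps)
  finally show ?thesis .
qed

text \<open>With \<open>a = y - x\<close> the commutator is \<open>a * \<sigma> - 1\<close> and also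
  \<open>1 - \<sigma> * a\<close>; multiplying the two forms gives the square. The right-hand side
  is the origin of the values \<open>c + 1\<close> and \<open>c - 1\<close> for the neighbours of
  the last box.\<close>

lemma intertwiner_square:
  fixes x y \<sigma> :: "'a::ring_1"
  assumes ysx: "y * \<sigma> = \<sigma> * x + 1" and syx: "\<sigma> * y = x * \<sigma> + 1" and ss: "\<sigma> * \<sigma> = 1"
  shows "(\<sigma> * x - x * \<sigma>) * (\<sigma> * x - x * \<sigma>) = 1 - (x - y) * (x - y)"
proof -
  define \<phi> where "\<phi> = \<sigma> * x - x * \<sigma>"
  define a where "a = y - x"
  have phi1: "a * \<sigma> = \<phi> + 1" and phi2: "\<sigma> * a = 1 - \<phi>"
    unfolding \<phi>_def a_def by (simp_all add: left_diff_distrib right_diff_distrib ysx syx)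
  have "\<phi> * \<phi> = (a * \<sigma> - 1) * (1 - \<sigma> * a)" by (simp only: phi1 phi2) simp
  also have "\<dots> = a * \<sigma> + \<sigma> * a - a * (\<sigma> * \<sigma>) * a - 1"
    by (simp add: left_diff_distrib right_diff_distrib mult.assoc)
  also have "\<dots> = 1 - a * a" unfolding ss phi1 phi2 by simp
  finally show ?thesis unfolding \<phi>_def[symmetric] by (simp add: a_def algebra_simps)
qed

context jm_algebra
begin

lemma s_mult: "1 \<le> i \<Longrightarrow> s i * x = r *\<^sub>R x \<Longrightarrow> r\<^sup>2 \<noteq> 1 \<Longrightarrow> x = 0"
proof -
  assume a: "1 \<le> i" "s i * x = r *\<^sub>R x" "r\<^sup>2 \<noteq> 1"
  have "x = s i * (s i * x)" using a(1) by (simp add: s_s)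
  also have "\<dots> = r\<^sup>2 *\<^sub>R x" using a(2) by (simp add: power2_eq_square)
  finally show "x = 0" using a(3) by (metis scaleR_cancel_right scaleR_one)
qed

lemma axial_square_neq:
  assumes t: "is_path n t" and i: "1 \<le> i" "i < n" and t': "is_path n (t \<circ> adj i)"
  shows "(axial t i)\<^sup>2 < 1" "axial t i \<noteq> 0" "axial t i < 1" "-1 < axial t i"
proof -
  define d where "d = cnt (t (Suc i)) - cnt (t i)"
  have "\<bar>content (t (Suc i)) - content (t i)\<bar> \<ge> 2" using is_path_swap_cases[OF t i] t' by blast
  then have d: "\<bar>d\<bar> \<ge> 2" unfolding d_def cnt_def by linarith
  then have a: "\<bar>axial t i\<bar> < 1" unfolding axial_def d_def[symmetric] by (simp add: field_simps)
  then show "(axial t i)\<^sup>2 < 1" by (simp add: abs_square_less_1)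
  show "axial t i \<noteq> 0" using d unfolding axial_def d_def[symmetric] by auto
  show "axial t i < 1" "-1 < axial t i" using a by auto
qed

text \<open>The simple transpositions below \<open>n\<close> commute with \<open>X (Suc n)\<close>.
  They carry an eigenvector over one path to one over the swapped path, and the image
  \<open>s i * x - r *\<^sub>R x\<close> is 0 only for \<open>x = 0\<close>, as
  \<open>r\<^sup>2 \<noteq> 1\<close>. So it is enough to exclude the eigenvalue on one path of the
  shape.\<close>

lemma eigen_shape_invariant:
  assumes E: "eigen n" and t: "is_path n t" and u: "is_path n u" and eq: "t ` {1..n} = u ` {1..n}"
    and z: "\<And>x. proj n t * x = x \<Longrightarrow> X (Suc n) * x = a *\<^sub>R x \<Longrightarrow> x = 0"
    and x: "proj n u * x = x" "X (Suc n) * x = a *\<^sub>R x"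
  shows "x = 0"
proof -
  have "\<forall>x. proj n u * x = x \<longrightarrow> X (Suc n) * x = a *\<^sub>R x \<longrightarrow> x = 0"
  proof (rule same_shape_induct[OF t u eq])
    fix v w :: "nat \<Rightarrow> box" assume "\<And>k. k \<in> {1..n} \<Longrightarrow> v k = w k"
    then have "proj n v = proj n w" by (rule proj_cong)
    moreover assume "\<forall>x. proj n v * x = x \<longrightarrow> X (Suc n) * x = a *\<^sub>R x \<longrightarrow> x = 0"
    ultimately show "\<forall>x. proj n w * x = x \<longrightarrow> X (Suc n) * x = a *\<^sub>R x \<longrightarrow> x = 0" by simp
  next
    fix v i
    assume v: "is_path n v" and i: "1 \<le> i" "i < n" and w: "is_path n (v \<circ> adj i)"
      and IH: "\<forall>x. proj n v * x = x \<longrightarrow> X (Suc n) * x = a *\<^sub>R x \<longrightarrow> x = 0"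
    show "\<forall>x. proj n (v \<circ> adj i) * x = x \<longrightarrow> X (Suc n) * x = a *\<^sub>R x \<longrightarrow> x = 0"
    proof (intro allI impI)
      fix x assume x: "proj n (v \<circ> adj i) * x = x" "X (Suc n) * x = a *\<^sub>R x"
      define r where "r = axial (v \<circ> adj i) i"
      have v': "is_path n (v \<circ> adj i \<circ> adj i)" using v by (simp add: comp_assoc)
      have 1: "proj n v * (s i * x - r *\<^sub>R x) = s i * x - r *\<^sub>R x"
        using s_proj_swap[OF E w i v' x(1)] by (simp add: comp_assoc r_def)
      have "X (Suc n) * (s i * x) = s i * (X (Suc n) * x)"
        using s_X[of i "Suc n"] i by (simp add: mult.assoc[symmetric])
      then have 2: "X (Suc n) * (s i * x - r *\<^sub>R x) = a *\<^sub>R (s i * x - r *\<^sub>R x)"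
        using x(2) by (simp add: right_diff_distrib scaleR_right_diff_distrib mult.commute)
      from IH 1 2 have "s i * x = r *\<^sub>R x" by auto
      with s_mult[OF i(1), of x r] axial_square_neq(1)[OF w i v'] show "x = 0" by (simp add: r_def)
    qed
  qed (use z in blast)
  with x show ?thesis by blast
qed

text \<open>
  If the neighbour of the last box could be added although it is not an outer corner, then some
  vector would have the weights \<open>c \<plusminus> 1, c, c \<plusminus> 1\<close> at three consecutive positions, which
  contradicts the braid relation.
\<close>

lemma no_weight_at_noncorner:
  assumes E: "eigen (Suc m)" and t: "is_path (Suc m) t"
    and nb: "nb \<in> {right (t (Suc m)), below (t (Suc m))}"
    and bad: "nb \<notin> outer_corners (t ` {1..Suc m})"
    and x: "proj (Suc m) t * x = x" "X (Suc (Suc m)) * x = cnt nb *\<^sub>R x"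
  shows "x = 0"
proof -
  let ?n = "Suc m"
  define e where "e = cnt nb - cnt (t ?n)"
  have e: "e = 1 \<or> e = -1" using nb by (auto simp: e_def cnt_def)
  then have ee: "e * e = 1" and e0: "e \<noteq> 0" by auto
  obtain v where v: "is_path ?n v" "v ` {1..?n} = t ` {1..?n}" "v ?n = t ?n" "1 \<le> m"
    "content (v m) = content nb"
    using path_through_neighbour[OF t nb bad] by metis
  show ?thesis
  proof (rule eigen_shape_invariant[OF E v(1) t v(2) _ x])
    fix y assume y: "proj ?n v * y = y" "X (Suc ?n) * y = cnt nb *\<^sub>R y"
    have w: "X j * y = cnt (v j) *\<^sub>R y" if "1 \<le> j" "j \<le> ?n" for j
      using eigenD[OF E v(1) that] y(1) by (metis mult.assoc mult_scaleR_left)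
    have cm: "cnt (v m) = cnt (t ?n) + e" using v(5) by (simp add: e_def cnt_def)
    \<comment> \<open>The contents at positions \<open>m\<close> and \<open>Suc m\<close> of
      \<open>v\<close> differ by 1, so these two steps cannot be exchanged.\<close>
    have sm: "s m * y = (- e) *\<^sub>R y"
    proof -
      have "content (v (Suc m)) - content (v m) = 1 \<or> content (v (Suc m)) - content (v m) = -1"
        using nb v(3,5) by auto
      then have "\<not> is_path ?n (v \<circ> adj m)"
        using is_path_swap_cases[OF v(1) v(4)] by auto
      from s_proj_noswap[OF E v(1) v(4) _ this y(1)] have "s m * y = axial v m *\<^sub>R y" by simp
      moreover have "axial v m = - e" using e cm v(3) by (auto simp: axial_def)
      ultimately show ?thesis by simp
    qed
    have sn: "s ?n * y = e *\<^sub>R y"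
    proof -
      define z where "z = s ?n * y - (1 / (cnt nb - cnt (v ?n))) *\<^sub>R y"
      have ne: "cnt (v ?n) \<noteq> cnt nb" using e v(3) by (auto simp: e_def)
      note iw = intertwiner_weights[OF _ w[of ?n] y(2) ne, folded z_def]
      \<comment> \<open>Otherwise \<open>z\<close> would have the content of \<open>nb\<close> at
        both positions \<open>m\<close> and \<open>Suc m\<close>, which no path has.\<close>
      have "z = 0"
      proof (rule weight_no_path_zero[OF E])
        fix j assume j: "1 \<le> j" "j \<le> ?n"
        show "X j * z = (if j = ?n then cnt nb else cnt (v j)) *\<^sub>R z"
          using iw(1) iw(3)[of j] w[OF j] j by auto
      next
        fix u assume u: "is_path ?n u"
        have "cnt (u m) \<noteq> cnt (u ?n)" using cnt_adjacent_neq[OF u v(4)] by simp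
        then have "cnt nb \<noteq> cnt (u ?n) \<or> cnt (v m) \<noteq> cnt (u m)" using v(5) by (auto simp: cnt_def)
        then show "\<exists>j\<in>{1..?n}. (if j = ?n then cnt nb else cnt (v j)) \<noteq> cnt (u j)"
          using v(4) by (metis atLeastAtMost_iff le_Suc_eq n_not_Suc_n order_refl)
      qed
      then have "s ?n * y = (1 / e) *\<^sub>R y" using v(3) by (simp add: z_def e_def)
      then show ?thesis using e by auto
    qed
    \<comment> \<open>On \<open>y\<close> the left side is \<open>e *\<^sub>R y\<close> and the
      right side \<open>(- e) *\<^sub>R y\<close>, because \<open>e * e = 1\<close>.\<close>
    have "s m * (s ?n * (s m * y)) = s ?n * (s m * (s ?n * y))"
      using braid[OF v(4)] by (metis mult.assoc)
    then have "e *\<^sub>R y = (- e) *\<^sub>R y" using sm sn ee by simp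
    then have "(e + e) *\<^sub>R y = 0" unfolding scaleR_left_distrib by (metis add.right_inverse scaleR_minus_left)
    then show "y = 0" using e0 by simp
  qed
qed

text \<open>Write the corner polynomial of the smaller diagram as \<open>K\<close> times the linear
  factor with root \<open>c\<close>. It kills \<open>x = X (Suc m)\<close> on
  \<open>proj m t\<close>; the intertwiner transports this to \<open>y = X (Suc (Suc m))\<close> at
  the price of its square \<open>1 - (x - y)\<^sup>2\<close>. On \<open>proj (Suc m) t\<close>,
  where \<open>x\<close> acts by \<open>c\<close>, the square is minus the product of
  \<open>y - (c + 1)\<close> and \<open>y - (c - 1)\<close>. This leaves one factor
  \<open>y - c\<close> too many, and the rest of the proof removes it.\<close>

lemma corner_poly_next_factor:
  assumes E: "eigen (Suc m)" and t: "is_path (Suc m) t"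
    and key: "ev (corner_poly (t ` {1..m})) (X (Suc m)) * proj m t = 0"
  defines "c \<equiv> cnt (t (Suc m))" and "K \<equiv> \<Prod>b\<in>outer_corners (t ` {1..m}) - {t (Suc m)}. [:- cnt b, 1:]"
  shows "ev ([:- (c + 1), 1:] * [:- (c - 1), 1:] * K) (X (Suc (Suc m))) * proj (Suc m) t = 0"
proof -
  define D where "D = t ` {1..m}"
  have D: "young_diagram D" unfolding D_def using t by (intro is_path_young) (simp add: is_path_Suc)
  have b: "t (Suc m) \<in> outer_corners D" using t by (simp add: is_path_Suc D_def)
  define x where "x = X (Suc m)" define y where "y = X (Suc (Suc m))" define \<sigma> where "\<sigma> = s (Suc m)"
  define f where "f = corner_poly D"
  define q where "q = proj m t" define p where "p = proj (Suc m) t"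
  have K: "K = (\<Prod>b\<in>outer_corners D - {t (Suc m)}. [:- cnt b, 1:])" by (simp only: K_def D_def)
  have f: "f = [:- c, 1:] * K" unfolding f_def corner_poly_def K
    using b finite_outer_corners[OF D] by (simp add: prod.remove c_def)
  have Kc: "poly K c \<noteq> 0"
    using cnt_inj[OF D] b finite_outer_corners[OF D]
    by (auto simp: K c_def poly_prod prod_zero_iff dest: inj_onD)
  have p: "p = q * ev (lagrange_poly D (t (Suc m))) x" by (simp only: p_def proj.simps q_def D_def x_def)
  define L where "L = ev (lagrange_poly D (t (Suc m))) x"
  have key': "ev f x * q = 0" using key by (simp only: f_def D_def x_def q_def)
  have ysx: "y * \<sigma> = \<sigma> * x + 1" and syx: "\<sigma> * y = x * \<sigma> + 1"
    unfolding x_def y_def \<sigma>_def by (simp_all add: X_Suc_s s_X_Suc)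
  have ss: "\<sigma> * \<sigma> = 1" by (simp add: \<sigma>_def s_sq)
  have xy: "x * y = y * x" unfolding x_def y_def by (simp add: X_comm)
  have qx: "x * q = q * x" and qy: "y * q = q * y" and qs: "\<sigma> * q = q * \<sigma>"
    unfolding x_def y_def q_def \<sigma>_def by (simp_all add: X_proj_comm s_proj_comm)
  have xp: "x * p = c *\<^sub>R p" using eigenD[OF E t] by (simp add: x_def p_def c_def)
  define \<phi> where "\<phi> = \<sigma> * x - x * \<sigma>"
  note yphi = intertwiner_commute[OF ysx xy, folded \<phi>_def]
  note phisq = intertwiner_square[OF ysx syx ss, folded \<phi>_def]
  define A where "A = [:- (c + 1), 1:] * [:- (c - 1), 1:]"
  have lin: "ev [:- a, 1:] z * w = z * w - a *\<^sub>R w" for a :: real and z w :: 'a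
    by (simp add: of_real_def left_diff_distrib)
  have "\<sigma> * x * q = q * (\<sigma> * x)" "x * \<sigma> * q = q * (x * \<sigma>)"
    by (simp_all only: mult.assoc qx qs) (simp_all only: mult.assoc[symmetric] qx qs)
  then have phiq: "\<phi> * q = q * \<phi>" unfolding \<phi>_def by (simp add: left_diff_distrib right_diff_distrib)
  have h: "ev f y * \<phi> = \<phi> * ev f x" by (rule ev_intertwine[OF yphi])
  have "ev f y * (\<phi> * \<phi>) * q = (ev f y * \<phi>) * (\<phi> * q)" by (simp only: mult.assoc)
  also have "\<dots> = \<phi> * (ev f x * q) * \<phi>" by (simp only: h phiq) (simp only: mult.assoc)
  finally have 1: "ev f y * (1 - (x - y) * (x - y)) * q = 0" by (simp add: key' phisq)
  have "(x - y) * p = c *\<^sub>R p - y * p" using xp by (simp add: left_diff_distrib)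
  moreover have "x * (y * p) = c *\<^sub>R (y * p)"
    unfolding mult.assoc[symmetric] xy unfolding mult.assoc xp by simp
  ultimately have "(1 - (x - y) * (x - y)) * p = p - c *\<^sub>R c *\<^sub>R p + c *\<^sub>R (y * p) + c *\<^sub>R (y * p) - y * (y * p)"
    by (simp add: left_diff_distrib mult.assoc xp right_diff_distrib scaleR_right_diff_distrib)
  also have "\<dots> = - (ev A y * p)"
    unfolding A_def ev_mult unfolding mult.assoc unfolding lin
    by (simp add: right_diff_distrib scaleR_left_distrib scaleR_right_diff_distrib scaleR_left_diff_distrib scaleR_add_right distrib_right)
  finally have ycx: "(1 - (x - y) * (x - y)) * p = - (ev A y * p)" .
  have "ev f y * ((1 - (x - y) * (x - y)) * p) = ev f y * (1 - (x - y) * (x - y)) * q * L"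
    unfolding p L_def by (simp only: mult.assoc)
  then have "ev f y * (ev A y * p) = 0" unfolding ycx 1 by simp
  moreover have "[:- c, 1:] * (A * K) = f * A" unfolding f by (simp only: ac_simps)
  ultimately have 2: "ev ([:- c, 1:] * (A * K)) y * p = 0" by (simp only: ev_mult mult.assoc)
  define u where "u = ev (A * K) y * p"
  have yu: "y * u = c *\<^sub>R u" using 2 unfolding ev_mult[of "[:- c, 1:]"] unfolding mult.assoc u_def[symmetric] unfolding lin by simp
  have "x * ev (A * K) y = ev (A * K) y * x" by (rule ev_commute) (simp add: xy)
  then have "x * u = ev (A * K) y * (x * p)" unfolding u_def by (simp only: mult.assoc[symmetric])
  then have xu: "x * u = c *\<^sub>R u" unfolding u_def xp by simp
  \<comment> \<open>Both \<open>x\<close> and \<open>y\<close> act on \<open>u\<close> by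
    \<open>c\<close>, so \<open>\<sigma> * u\<close> would generate a Jordan block of
    \<open>x\<close> for \<open>c\<close>; but \<open>c\<close> is only a simple root of
    \<open>f\<close>, which annihilates \<open>x\<close> there. Hence \<open>u = 0\<close>.\<close>
  have "x * \<sigma> = \<sigma> * y - 1" by (simp add: syx)
  then have "x * (\<sigma> * u) = (\<sigma> * y - 1) * u" by (simp only: mult.assoc[symmetric])
  then have "x * (\<sigma> * u) = c *\<^sub>R (\<sigma> * u) - u" using yu by (simp add: left_diff_distrib mult.assoc)
  then have "ev [:- c, 1:] x * (\<sigma> * u) = - u" unfolding lin by simp
  moreover have "ev f x * (\<sigma> * u) = ev K x * (ev [:- c, 1:] x * (\<sigma> * u))"
    unfolding f mult.commute[of _ K] by (simp only: mult.assoc ev_mult)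
  ultimately have "ev f x * (\<sigma> * u) = - (poly K c *\<^sub>R u)" by (simp add: ev_eigen[OF xu])
  moreover have "ev f x * (\<sigma> * u) = 0"
  proof -
    have yq: "ev (A * K) y * q = q * ev (A * K) y" by (rule ev_commute[symmetric]) (rule qy)
    have "\<sigma> * u = \<sigma> * (ev (A * K) y * q) * L" unfolding u_def p L_def by (simp only: mult.assoc)
    also have "\<dots> = (\<sigma> * q) * (ev (A * K) y * L)" unfolding yq by (simp only: mult.assoc)
    finally have "ev f x * (\<sigma> * u) = (ev f x * q) * (\<sigma> * (ev (A * K) y * L))"
      unfolding qs by (simp only: mult.assoc)
    then show ?thesis by (simp add: key')
  qed
  ultimately have "u = 0" using Kc by simp
  then show ?thesis by (simp only: u_def y_def p_def A_def)
qed

lemma corner_poly_next: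
  assumes E: "eigen (Suc m)" and t: "is_path (Suc m) t"
    and key: "ev (corner_poly (t ` {1..m})) (X (Suc m)) * proj m t = 0"
  shows "ev (corner_poly (t ` {1..Suc m})) (X (Suc (Suc m))) * proj (Suc m) t = 0"
proof -
  define D where "D = t ` {1..m}"
  define b where "b = t (Suc m)"
  have D: "young_diagram D" unfolding D_def using t by (intro is_path_young) (simp add: is_path_Suc)
  have bD: "b \<in> outer_corners D" using t by (simp add: is_path_Suc D_def b_def)
  have I: "t ` {1..Suc m} = insert b D" by (simp only: image_Suc_interval D_def b_def)
  define K where "K = (\<Prod>b'\<in>outer_corners D - {b}. [:- cnt b', 1:])"
  define p where "p = proj (Suc m) t" define y where "y = X (Suc (Suc m))"
  have fin: "finite (outer_corners D)" "finite (outer_corners (insert b D))"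
    using finite_outer_corners D young_diagram_insert[OF bD] by auto
  have disj: "right b \<notin> outer_corners D" "below b \<notin> outer_corners D"
    using outer_corners_content_diff[OF D bD, of "right b"] outer_corners_content_diff[OF D bD, of "below b"] by auto
  have G: "corner_poly (insert b D) = K * (\<Prod>b'\<in>outer_corners (insert b D) \<inter> {right b, below b}. [:- cnt b', 1:])"
    unfolding corner_poly_def K_def using disj fin
    by (subst outer_corners_insert[OF D bD], subst prod.union_disjoint) auto
  have comm: "proj (Suc m) t * (ev P y * p) = ev P y * p" for P
  proof -
    have "p * ev P y = ev P y * p" unfolding p_def y_def by (intro ev_commute X_proj_comm) simp
    then show ?thesis using proj_idem[OF E t] by (metis p_def mult.assoc)
  qed
  have c: "cnt (right x) = cnt x + 1" "cnt (below x) = cnt x - 1" for x by (simp_all add: cnt_def)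
  have main: "ev ([:- cnt (right b), 1:] * ([:- cnt (below b), 1:] * K)) y * p = 0"
    using corner_poly_next_factor[OF E t key] by (simp only: c K_def D_def b_def y_def p_def mult.assoc)
  have main': "ev ([:- cnt (below b), 1:] * ([:- cnt (right b), 1:] * K)) y * p = 0"
    using main by (simp only: mult.left_commute)
  have eigv: "y * (ev P y * p) = a *\<^sub>R (ev P y * p)" if "ev ([:- a, 1:] * P) y * p = 0" for P a
    using that unfolding ev_mult by (simp add: mult.assoc left_diff_distrib of_real_def algebra_simps)
  have R: "ev ([:- cnt (below b), 1:] * K) y * p = 0" if "right b \<notin> outer_corners (insert b D)"
    by (rule no_weight_at_noncorner[OF E t, of "right b"])
      (use that main comm eigv in \<open>auto simp: b_def[symmetric] I[unfolded One_nat_def] y_def[symmetric] simp del: ev_pCons mult_pCons_left\<close>)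
  have B: "ev ([:- cnt (right b), 1:] * K) y * p = 0" if "below b \<notin> outer_corners (insert b D)"
    by (rule no_weight_at_noncorner[OF E t, of "below b"])
      (use that main' comm eigv in \<open>auto simp: b_def[symmetric] I[unfolded One_nat_def] y_def[symmetric] simp del: ev_pCons mult_pCons_left\<close>)
  have "ev (corner_poly (insert b D)) y * p = 0"
  proof (cases "right b \<in> outer_corners (insert b D)"; cases "below b \<in> outer_corners (insert b D)")
    assume "right b \<in> outer_corners (insert b D)" "below b \<in> outer_corners (insert b D)"
    then have "outer_corners (insert b D) \<inter> {right b, below b} = {right b, below b}" by blast
    then show ?thesis using main unfolding G by (simp add: ac_simps del: ev_pCons mult_pCons_left mult_pCons_right)
  next
    assume a: "right b \<in> outer_corners (insert b D)" "below b \<notin> outer_corners (insert b D)"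
    then have "outer_corners (insert b D) \<inter> {right b, below b} = {right b}" by blast
    then show ?thesis using B[OF a(2)] unfolding G by (simp add: ac_simps del: ev_pCons mult_pCons_left mult_pCons_right)
  next
    assume a: "right b \<notin> outer_corners (insert b D)" "below b \<in> outer_corners (insert b D)"
    then have "outer_corners (insert b D) \<inter> {right b, below b} = {below b}" by blast
    then show ?thesis using R[OF a(1)] unfolding G by (simp add: ac_simps del: ev_pCons mult_pCons_left mult_pCons_right)
  next
    assume a: "right b \<notin> outer_corners (insert b D)" "below b \<notin> outer_corners (insert b D)"
    then have e: "outer_corners (insert b D) \<inter> {right b, below b} = {}" by blast
    \<comment> \<open>With neither neighbour a corner, each factor has been dropped only in the
      presence of the other. The difference of the two linear factors is the constant 2, so
      \<open>K\<close> alone already annihilates.\<close>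
    have "[:- cnt (below b), 1:] * K - [:- cnt (right b), 1:] * K = Polynomial.smult 2 K"
      unfolding left_diff_distrib[symmetric] by (simp add: c)
    then have "Polynomial.smult 2 K = [:- cnt (below b), 1:] * K + Polynomial.smult (- 1) ([:- cnt (right b), 1:] * K)"
      by (simp add: algebra_simps)
    then have "2 *\<^sub>R (ev K y * p) = 0"
      using R[OF a(1)] B[OF a(2)] by (metis (no_types) add.right_neutral ev_add ev_smult distrib_right mult_scaleR_left scaleR_zero_right)
    then show ?thesis unfolding G e by simp
  qed
  then show ?thesis by (simp only: I y_def p_def)
qed

lemma eigen_Suc:
  assumes E: "eigen n" and key: "\<And>t. is_path n t \<Longrightarrow> ev (corner_poly (t ` {1..n})) (X (Suc n)) * proj n t = 0"
  shows "eigen (Suc n)"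
  unfolding eigen_def
proof (intro allI impI ballI)
  fix t j assume t: "is_path (Suc n) t" and j: "j \<in> {1..Suc n}"
  have tn: "is_path n t" using t by (simp add: is_path_Suc)
  show "X j * proj (Suc n) t = cnt (t j) *\<^sub>R proj (Suc n) t"
  proof (cases "j = Suc n")
    case False
    then have "X j * proj n t = cnt (t j) *\<^sub>R proj n t" using j eigenD[OF E tn] by auto
    then show ?thesis by (simp add: mult.assoc[symmetric])
  next
    case True
    define D where "D = t ` {1..n}"
    have D: "young_diagram D" unfolding D_def using tn by (rule is_path_young)
    have b: "t (Suc n) \<in> outer_corners D" using t by (simp add: is_path_Suc D_def)
    obtain k where k: "[:- cnt (t (Suc n)), 1:] * lagrange_poly D (t (Suc n)) = Polynomial.smult k (corner_poly D)"
      using lagrange_poly_corner_poly[OF D b] by blast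
    have p: "proj (Suc n) t = ev (lagrange_poly D (t (Suc n))) (X (Suc n)) * proj n t"
      unfolding proj.simps D_def by (intro ev_commute X_proj_comm) simp
    have "ev [:- cnt (t (Suc n)), 1:] (X (Suc n)) * proj (Suc n) t = k *\<^sub>R (ev (corner_poly D) (X (Suc n)) * proj n t)"
      unfolding p mult.assoc[symmetric] ev_mult[symmetric] k by (simp add: ev_smult)
    also have "\<dots> = 0" using key[OF tn] by (simp only: D_def scaleR_zero_right)
    finally show ?thesis using True by (simp add: left_diff_distrib of_real_def del: proj.simps)
  qed
qed

text \<open>The annihilating polynomial for \<open>n\<close> makes the next Lagrange factor produce
  eigenvectors, and the eigenvalues for \<open>Suc n\<close> are what
  \<open>corner_poly_next\<close> needs. The induction starts with the single corner of content 0
  and \<open>X 1 = 0\<close>.\<close>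

lemma eigen_and_corner_poly: "eigen n \<and> (\<forall>t. is_path n t \<longrightarrow> ev (corner_poly (t ` {1..n})) (X (Suc n)) * proj n t = 0)"
proof (induction n)
  case 0
  show ?case by (simp add: eigen_def corner_poly_def X_1 cnt_def content_def)
next
  case (Suc n)
  then have E: "eigen (Suc n)" by (intro eigen_Suc) auto
  with Suc show ?case using corner_poly_next[OF E] by (auto simp: is_path_Suc simp del: proj.simps)
qed

lemma eigen: "eigen n"
  using eigen_and_corner_poly by blast

end

section \<open>Products of projectors and simple transpositions\<close>

lemma paths_comp:
  assumes t: "t \<in> paths n" and \<pi>: "\<pi> permutes {1..n}" and p: "is_path n (t \<circ> \<pi>)"
  shows "t \<circ> \<pi> \<in> paths n"
  using t p permutes_not_in[OF \<pi>] by (auto simp: paths_def)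

lemma paths_adj: "t \<in> paths n \<Longrightarrow> 1 \<le> i \<Longrightarrow> i < n \<Longrightarrow> is_path n (t \<circ> adj i) \<Longrightarrow> t \<circ> adj i \<in> paths n"
  by (rule paths_comp[OF _ adj_permutes])

lemma paths_comp_inj:
  assumes t: "t \<in> paths n" and \<pi>: "\<pi> permutes {1..n}" and \<rho>: "\<rho> permutes {1..n}"
    and eq: "t \<circ> \<pi> = t \<circ> \<rho>"
  shows "\<pi> = \<rho>"
proof
  fix x
  show "\<pi> x = \<rho> x"
  proof (cases "x \<in> {1..n}")
    case True
    have "t (\<pi> x) = t (\<rho> x)" using eq by (metis comp_apply)
    then show ?thesis
      using inj_onD[OF is_path_inj[OF paths_is_path[OF t]]] True permutes_in_image[OF \<pi>] permutes_in_image[OF \<rho>]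
      by blast
  qed (use permutes_not_in[OF \<pi>] permutes_not_in[OF \<rho>] in simp)
qed

lemma paths_comp_neq:
  assumes t: "t \<in> paths n" and \<pi>: "\<pi> permutes {1..n}" and "\<pi> \<noteq> id"
  shows "t \<circ> \<pi> \<noteq> t"
  using paths_comp_inj[OF t \<pi> permutes_id] assms(3) by auto

lemma adj_neq_id: "adj i \<noteq> id"
  by (metis id_apply n_not_Suc_n transpose_apply_first)

lemma paths_adj_neq: "t \<in> paths n \<Longrightarrow> 1 \<le> i \<Longrightarrow> i < n \<Longrightarrow> t \<circ> adj i \<noteq> t"
  by (rule paths_comp_neq[OF _ adj_permutes adj_neq_id])

abbreviation pinv :: "(nat \<Rightarrow> nat) \<Rightarrow> nat \<Rightarrow> nat" where "pinv \<equiv> inv_into UNIV"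

context jm_algebra
begin

lemma proj_orth':
  assumes t: "t \<in> paths n" and u: "u \<in> paths n" and "t \<noteq> u"
  shows "proj n t * proj n u = 0"
proof -
  obtain k where k: "t k \<noteq> u k" using assms(3) by blast
  have "k \<in> {1..n}"
  proof (rule ccontr)
    assume "k \<notin> {1..n}"
    then have "t k = (0, 0)" "u k = (0, 0)" using t u by (simp_all add: paths_def)
    with k show False by simp
  qed
  then show ?thesis by (rule proj_orth[OF eigen paths_is_path[OF t] paths_is_path[OF u]]) (rule k)
qed

lemma proj_idem': "t \<in> paths n \<Longrightarrow> proj n t * proj n t = proj n t"
  by (rule proj_idem[OF eigen paths_is_path])

lemma proj_mult: "t \<in> paths n \<Longrightarrow> u \<in> paths n \<Longrightarrow> proj n t * proj n u = (if t = u then proj n t else 0)"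
  by (simp add: proj_orth' proj_idem')

lemma proj_adj_orth:
  assumes "t \<in> paths n" "1 \<le> i" "i < n" "t \<circ> adj i \<in> paths n"
  shows "proj n (t \<circ> adj i) * proj n t = 0" "proj n t * proj n (t \<circ> adj i) = 0"
  using paths_adj_neq[OF assms(1-3)] proj_orth'[OF assms(4,1)] proj_orth'[OF assms(1,4)] by auto

text \<open>The seminormal form of \<open>s i\<close>, written with projectors instead of basis
  vectors.\<close>

lemma s_proj:
  assumes t: "t \<in> paths n" and i: "1 \<le> i" "i < n"
  shows "s i * proj n t = axial t i *\<^sub>R proj n t +
    (if t \<circ> adj i \<in> paths n then proj n (t \<circ> adj i) * s i * proj n t else 0)"
proof (cases "t \<circ> adj i \<in> paths n")
  case True
  have "proj n (t \<circ> adj i) * (s i * proj n t - axial t i *\<^sub>R proj n t) = s i * proj n t - axial t i *\<^sub>R proj n t"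
    using True t i by (intro s_proj_swap[OF eigen] proj_idem') (auto intro: paths_is_path)
  then show ?thesis using True proj_adj_orth(1)[OF t i True] by (simp add: right_diff_distrib mult.assoc)
next
  case False
  then have "\<not> is_path n (t \<circ> adj i)" using paths_adj[OF t i] by blast
  then show ?thesis
    using False s_proj_noswap[OF eigen paths_is_path[OF t] i _ proj_idem'[OF t]] by simp
qed

lemma proj_s_proj:
  assumes t: "t \<in> paths n" and u: "u \<in> paths n" and i: "1 \<le> i" "i < n"
  shows "t = u \<Longrightarrow> proj n t * s i * proj n u = axial t i *\<^sub>R proj n t"
    and "t \<noteq> u \<Longrightarrow> t \<noteq> u \<circ> adj i \<Longrightarrow> proj n t * s i * proj n u = 0"
proof -
  define z where "z = (if u \<circ> adj i \<in> paths n then s i * proj n u else 0)"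
  have "s i * proj n u = axial u i *\<^sub>R proj n u + (if u \<circ> adj i \<in> paths n then proj n (u \<circ> adj i) * z else 0)"
    by (subst s_proj[OF u i]) (simp add: z_def mult.assoc)
  then have "proj n t * s i * proj n u =
      proj n t * (axial u i *\<^sub>R proj n u + (if u \<circ> adj i \<in> paths n then proj n (u \<circ> adj i) * z else 0))"
    by (simp only: mult.assoc)
  also have "\<dots> = axial u i *\<^sub>R (proj n t * proj n u) +
      (if u \<circ> adj i \<in> paths n then (proj n t * proj n (u \<circ> adj i)) * z else 0)"
    by (simp add: distrib_left mult.assoc)
  finally have eq: "proj n t * s i * proj n u = \<dots>" .
  show "proj n t * s i * proj n u = axial t i *\<^sub>R proj n t" if "t = u"
    unfolding eq using that t proj_adj_orth(2)[OF u i] by (simp add: proj_idem')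
  show "proj n t * s i * proj n u = 0" if "t \<noteq> u" "t \<noteq> u \<circ> adj i"
    unfolding eq using that t u by (simp add: proj_orth')
qed

text \<open>The mirror image of \<open>s_proj\<close>, obtained by inserting the sum of all
  projectors on the right.\<close>

lemma proj_s:
  assumes t: "t \<in> paths n" and i: "1 \<le> i" "i < n"
  shows "proj n t * s i = axial t i *\<^sub>R proj n t +
    (if t \<circ> adj i \<in> paths n then proj n t * s i * proj n (t \<circ> adj i) else 0)"
proof -
  have neq: "t \<circ> adj i \<noteq> t" by (rule paths_adj_neq[OF t i])
  have "proj n t * s i = (\<Sum>u\<in>paths n. proj n t * s i * proj n u)"
    by (simp only: sum_distrib_left[symmetric] sum_proj mult_1_right)
  also have "\<dots> = (\<Sum>u\<in>paths n. (if u = t then axial t i *\<^sub>R proj n t else 0) +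
      (if u = t \<circ> adj i then proj n t * s i * proj n (t \<circ> adj i) else 0))"
  proof (rule sum.cong[OF refl])
    fix u assume u: "u \<in> paths n"
    consider "u = t" | "u = t \<circ> adj i" "u \<noteq> t" | "u \<noteq> t" "u \<noteq> t \<circ> adj i" by blast
    then show "proj n t * s i * proj n u = (if u = t then axial t i *\<^sub>R proj n t else 0) +
      (if u = t \<circ> adj i then proj n t * s i * proj n (t \<circ> adj i) else 0)"
    proof cases
      case 1
      then show ?thesis using proj_s_proj(1)[OF t u i] neq by auto
    next
      case 3
      then have "t \<noteq> u \<circ> adj i" by (auto simp: comp_assoc)
      then show ?thesis using 3 proj_s_proj(2)[OF t u i] by auto
    qed simp
  qed
  also have "\<dots> = axial t i *\<^sub>R proj n t +
    (if t \<circ> adj i \<in> paths n then proj n t * s i * proj n (t \<circ> adj i) else 0)"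
    using t by (simp add: sum.distrib finite_paths)
  finally show ?thesis .
qed

end

section \<open>Weight vectors\<close>

text \<open>\<open>g\<close> is multiplicative on all maps of \<open>nat\<close>, so no product law
  carries a side condition on the support of a permutation.\<close>

locale sym_algebra = jm_algebra s X for s X :: "nat \<Rightarrow> 'a::real_algebra_1" +
  fixes g :: "(nat \<Rightarrow> nat) \<Rightarrow> 'a"
  assumes g_id: "g id = 1"
    and g_comp: "g (\<sigma> \<circ> \<tau>) = g \<sigma> * g \<tau>"
    and g_adj: "1 \<le> i \<Longrightarrow> g (adj i) = s i"
begin

text \<open>This is v_{T,T'} for the tableaux T' with path \<open>t\<close> and T with path
  \<open>t \<circ> \<tau>\<close>. The box added at step \<open>j\<close> of the latter holds
  \<open>j\<close> in T and \<open>\<tau> j\<close> in T', so the permutation attached to the pair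
  is the inverse of \<open>\<tau>\<close>.\<close>

definition wvec :: "nat \<Rightarrow> (nat \<Rightarrow> box) \<Rightarrow> (nat \<Rightarrow> nat) \<Rightarrow> 'a" where
  "wvec n t \<tau> = proj n (t \<circ> \<tau>) * g (pinv \<tau>) * proj n t"

lemma inv_comp_adj: "\<tau> permutes {1..n} \<Longrightarrow> pinv (\<tau> \<circ> adj i) = adj i \<circ> pinv \<tau>"
  by (simp add: o_inv_distrib permutes_bij)

text \<open>Every simple transposition changes the number of inversions by one.\<close>

lemma proj_g_proj_zero:
  assumes t: "t \<in> paths n" and \<tau>: "\<tau> permutes {1..n}"
    and "\<rho> permutes {1..n}" and "t \<circ> \<rho> \<in> paths n" and "inv_num n \<tau> < inv_num n \<rho>"
  shows "proj n (t \<circ> \<rho>) * g (pinv \<tau>) * proj n t = 0"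
  using assms(2-)
proof (induction "inv_num n \<tau>" arbitrary: \<tau> \<rho> rule: less_induct)
  case less
  note \<tau> = less.prems(1) and \<rho> = less.prems(2) and p = less.prems(3)
  show ?case
  proof (cases "\<tau> = id")
    case True
    then have "\<rho> \<noteq> id" using less.prems(4) by auto
    then show ?thesis using paths_comp_neq[OF t \<rho>] proj_orth'[OF p t] True by (simp add: g_id)
  next
    case False
    then obtain i where i: "1 \<le> i" "i < n" "\<tau> (Suc i) < \<tau> i" using permutes_descent[OF \<tau>] by blast
    define \<tau>1 where "\<tau>1 = \<tau> \<circ> adj i"
    have \<tau>1: "\<tau>1 permutes {1..n}" unfolding \<tau>1_def by (rule permutes_compose[OF adj_permutes[OF i(1,2)] \<tau>])
    have n1: "Suc (inv_num n \<tau>1) = inv_num n \<tau>" unfolding \<tau>1_def by (rule inv_num_adj'[OF i])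
    have "\<tau> = \<tau>1 \<circ> adj i" by (simp add: \<tau>1_def comp_assoc)
    then have gi: "g (pinv \<tau>) = s i * g (pinv \<tau>1)" using inv_comp_adj[OF \<tau>1] i by (simp add: g_comp g_adj)
    have 1: "proj n (t \<circ> \<rho>) * g (pinv \<tau>1) * proj n t = 0"
      using less.hyps[OF _ \<tau>1 \<rho> p] n1 less.prems(4) by simp
    have 2: "proj n (t \<circ> \<rho> \<circ> adj i) * g (pinv \<tau>1) * proj n t = 0" if "t \<circ> \<rho> \<circ> adj i \<in> paths n"
    proof -
      have \<rho>1: "\<rho> \<circ> adj i permutes {1..n}" by (rule permutes_compose[OF adj_permutes[OF i(1,2)] \<rho>])
      have "\<rho> i \<noteq> \<rho> (Suc i)" using permutes_inj[OF \<rho>] by (metis injD n_not_Suc_n)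
      then have "inv_num n \<rho> \<le> Suc (inv_num n (\<rho> \<circ> adj i))"
        using inv_num_adj[OF i(1,2), of \<rho>] inv_num_adj'[OF i(1,2), of \<rho>] by linarith
      then show ?thesis
        using less.hyps[OF _ \<tau>1 \<rho>1] n1 less.prems(4) that by (simp add: comp_assoc)
    qed
    have "proj n (t \<circ> \<rho>) * g (pinv \<tau>) * proj n t = (proj n (t \<circ> \<rho>) * s i) * g (pinv \<tau>1) * proj n t"
      by (simp add: gi mult.assoc)
    also have "\<dots> = axial (t \<circ> \<rho>) i *\<^sub>R (proj n (t \<circ> \<rho>) * g (pinv \<tau>1) * proj n t) +
      (if t \<circ> \<rho> \<circ> adj i \<in> paths n then proj n (t \<circ> \<rho>) * s i * (proj n (t \<circ> \<rho> \<circ> adj i) * g (pinv \<tau>1) * proj n t) else 0)"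
      by (subst proj_s[OF p i(1,2)]) (simp add: distrib_right mult.assoc)
    also have "\<dots> = 0" using 1 2 by simp
    finally show ?thesis .
  qed
qed

lemma wvec_id [simp]: "t \<in> paths n \<Longrightarrow> wvec n t id = proj n t"
  by (simp add: wvec_def g_id proj_idem')

lemma proj_wvec:
  assumes "t \<in> paths n" "u \<in> paths n" "t \<circ> \<tau> \<in> paths n"
  shows "proj n u * wvec n t \<tau> = (if u = t \<circ> \<tau> then wvec n t \<tau> else 0)"
  using assms by (simp add: wvec_def mult.assoc[symmetric] proj_mult)

lemma wvec_proj: "t \<in> paths n \<Longrightarrow> wvec n t \<tau> * proj n t = wvec n t \<tau>"
  by (simp add: wvec_def mult.assoc proj_idem')

text \<open>Expand the projector times \<open>s i\<close> by \<open>proj_s\<close>. The diagonal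
  term has \<open>g (pinv \<tau>)\<close> between projectors whose paths differ by a permutation
  with more inversions than \<open>\<tau>\<close>, and is 0 by \<open>proj_g_proj_zero\<close>.
  Going up, the coefficient of the new weight vector is therefore exactly 1.\<close>

lemma wvec_adj:
  assumes t: "t \<in> paths n" and \<tau>: "\<tau> permutes {1..n}" and p: "t \<circ> \<tau> \<in> paths n"
    and i: "1 \<le> i" "i < n" "\<tau> i < \<tau> (Suc i)" and p': "t \<circ> \<tau> \<circ> adj i \<in> paths n"
  shows "wvec n t (\<tau> \<circ> adj i) = proj n (t \<circ> \<tau> \<circ> adj i) * s i * wvec n t \<tau>"
    and "s i * wvec n t \<tau> = axial (t \<circ> \<tau>) i *\<^sub>R wvec n t \<tau> + wvec n t (\<tau> \<circ> adj i)"
proof -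
  define P where "P = proj n (t \<circ> \<tau> \<circ> adj i)"
  have \<tau>1: "\<tau> \<circ> adj i permutes {1..n}" by (rule permutes_compose[OF adj_permutes[OF i(1,2)] \<tau>])
  have z: "P * g (pinv \<tau>) * proj n t = 0"
    unfolding P_def comp_assoc using proj_g_proj_zero[OF t \<tau> \<tau>1] p' inv_num_adj[OF i] by (simp add: comp_assoc)
  have "wvec n t (\<tau> \<circ> adj i) = P * s i * g (pinv \<tau>) * proj n t"
    unfolding wvec_def inv_comp_adj[OF \<tau>] using i by (simp add: P_def comp_assoc[symmetric] g_comp g_adj mult.assoc)
  also have "P * s i = axial (t \<circ> \<tau> \<circ> adj i) i *\<^sub>R P + P * s i * proj n (t \<circ> \<tau>)"
    unfolding P_def using proj_s[OF p' i(1,2)] p by (simp add: comp_assoc)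
  finally have 1: "wvec n t (\<tau> \<circ> adj i) = axial (t \<circ> \<tau> \<circ> adj i) i *\<^sub>R (P * g (pinv \<tau>) * proj n t) + P * s i * wvec n t \<tau>"
    unfolding wvec_def[of n t \<tau>] distrib_right mult_scaleR_left mult.assoc .
  then show 2: "wvec n t (\<tau> \<circ> adj i) = P * s i * wvec n t \<tau>" by (simp add: z)
  have "s i * wvec n t \<tau> = (s i * proj n (t \<circ> \<tau>)) * wvec n t \<tau>"
    using proj_wvec[OF t p p] by (simp add: mult.assoc)
  also have "\<dots> = axial (t \<circ> \<tau>) i *\<^sub>R (proj n (t \<circ> \<tau>) * wvec n t \<tau>) +
      P * s i * (proj n (t \<circ> \<tau>) * wvec n t \<tau>)"
    using p' by (subst s_proj[OF p i(1,2)]) (simp add: P_def distrib_right mult.assoc)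
  also have "\<dots> = axial (t \<circ> \<tau>) i *\<^sub>R wvec n t \<tau> + P * s i * wvec n t \<tau>"
    using proj_wvec[OF t p p] by simp
  finally show "s i * wvec n t \<tau> = axial (t \<circ> \<tau>) i *\<^sub>R wvec n t \<tau> + wvec n t (\<tau> \<circ> adj i)" using 2 by simp
qed

lemma axial_adj: "axial (t \<circ> adj i) i = - axial t i"
  by (simp add: axial_def) (metis minus_diff_eq minus_divide_right)

lemma paths_descent:
  assumes t: "t \<in> paths n" and \<tau>: "\<tau> permutes {1..n}" and p: "t \<circ> \<tau> \<in> paths n"
    and i: "1 \<le> i" "i < n" "\<tau> (Suc i) < \<tau> i"
  shows "t \<circ> \<tau> \<circ> adj i \<in> paths n"
  using is_path_descent_swap[OF paths_is_path[OF t] paths_is_path[OF p] \<tau> i] paths_adj[OF p i(1,2)] by blast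

text \<open>Going down the coefficient is \<open>1 - r\<^sup>2\<close> for the inverse axial
  distance \<open>r\<close>, because \<open>s i\<close> is an involution and the coefficient going
  up is 1.\<close>

lemma wvec_adj_down:
  assumes t: "t \<in> paths n" and \<tau>: "\<tau> permutes {1..n}" and p: "t \<circ> \<tau> \<in> paths n"
    and i: "1 \<le> i" "i < n" "\<tau> (Suc i) < \<tau> i"
  shows "s i * wvec n t \<tau> = axial (t \<circ> \<tau>) i *\<^sub>R wvec n t \<tau> + (1 - (axial (t \<circ> \<tau>) i)\<^sup>2) *\<^sub>R wvec n t (\<tau> \<circ> adj i)"
    and "wvec n t \<tau> = s i * wvec n t (\<tau> \<circ> adj i) + axial (t \<circ> \<tau>) i *\<^sub>R wvec n t (\<tau> \<circ> adj i)"
    and "wvec n t \<tau> = proj n (t \<circ> \<tau>) * s i * wvec n t (\<tau> \<circ> adj i)"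
proof -
  define \<tau>1 where "\<tau>1 = \<tau> \<circ> adj i"
  have \<tau>1: "\<tau>1 permutes {1..n}" unfolding \<tau>1_def by (rule permutes_compose[OF adj_permutes[OF i(1,2)] \<tau>])
  have p1: "t \<circ> \<tau>1 \<in> paths n" using paths_descent[OF assms] by (simp add: \<tau>1_def comp_assoc)
  have e: "\<tau>1 \<circ> adj i = \<tau>" "t \<circ> \<tau>1 \<circ> adj i = t \<circ> \<tau>" by (simp_all add: \<tau>1_def comp_assoc)
  have l: "\<tau>1 i < \<tau>1 (Suc i)" using i by (simp add: \<tau>1_def)
  have r: "axial (t \<circ> \<tau>1) i = - axial (t \<circ> \<tau>) i" unfolding \<tau>1_def comp_assoc[symmetric] by (rule axial_adj)
  note a = wvec_adj[OF t \<tau>1 p1 i(1,2) l, unfolded e r, OF p]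
  show 2: "wvec n t \<tau> = s i * wvec n t (\<tau> \<circ> adj i) + axial (t \<circ> \<tau>) i *\<^sub>R wvec n t (\<tau> \<circ> adj i)"
    using a(2) unfolding \<tau>1_def by (simp only: scaleR_minus_left) (simp only: diff_conv_add_uminus[symmetric] add.commute add_diff_eq diff_add_cancel minus_add_cancel algebra_simps)
  show "wvec n t \<tau> = proj n (t \<circ> \<tau>) * s i * wvec n t (\<tau> \<circ> adj i)"
    using a(1) unfolding \<tau>1_def .
  have "s i * wvec n t \<tau> = wvec n t \<tau>1 + axial (t \<circ> \<tau>) i *\<^sub>R (s i * wvec n t \<tau>1)"
    by (subst 2) (simp add: \<tau>1_def[symmetric] distrib_left s_s i(1)[unfolded One_nat_def] i)
  also have "\<dots> = axial (t \<circ> \<tau>) i *\<^sub>R wvec n t \<tau> + (1 - (axial (t \<circ> \<tau>) i)\<^sup>2) *\<^sub>R wvec n t \<tau>1"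
    unfolding a(2) by (simp add: scaleR_add_right scaleR_left_diff_distrib scaleR_right_diff_distrib power2_eq_square)
  finally show "s i * wvec n t \<tau> = axial (t \<circ> \<tau>) i *\<^sub>R wvec n t \<tau> + (1 - (axial (t \<circ> \<tau>) i)\<^sup>2) *\<^sub>R wvec n t (\<tau> \<circ> adj i)"
    by (simp add: \<tau>1_def)
qed

lemma wvec_noswap:
  assumes t: "t \<in> paths n" and p: "t \<circ> \<tau> \<in> paths n"
    and i: "1 \<le> i" "i < n" and no: "t \<circ> \<tau> \<circ> adj i \<notin> paths n"
  shows "s i * wvec n t \<tau> = axial (t \<circ> \<tau>) i *\<^sub>R wvec n t \<tau>"
proof -
  have "s i * wvec n t \<tau> = (s i * proj n (t \<circ> \<tau>)) * wvec n t \<tau>"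
    using proj_wvec[OF t p p] by (simp add: mult.assoc)
  also have "\<dots> = axial (t \<circ> \<tau>) i *\<^sub>R wvec n t \<tau>"
    using no proj_wvec[OF t p p] by (subst s_proj[OF p i(1,2)]) simp
  finally show ?thesis .
qed

definition vecs :: "nat \<Rightarrow> (nat \<Rightarrow> box) \<Rightarrow> 'a set" where
  "vecs n t = wvec n t ` {\<tau>. \<tau> permutes {1..n} \<and> t \<circ> \<tau> \<in> paths n}"

lemma s_span_wvecs:
  assumes t: "t \<in> paths n" and i: "1 \<le> i" "i < n" and x: "x \<in> span (vecs n t)"
  shows "s i * x \<in> span (vecs n t)"
  using x
proof (induction rule: span_induct_alt)
  case (step c y z)
  obtain \<tau> where \<tau>: "\<tau> permutes {1..n}" "t \<circ> \<tau> \<in> paths n" and y: "y = wvec n t \<tau>"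
    using step by (auto simp: vecs_def)
  have 0: "wvec n t \<tau> \<in> span (vecs n t)" using \<tau> by (intro span_base) (auto simp: vecs_def)
  have 1: "wvec n t (\<tau> \<circ> adj i) \<in> span (vecs n t)" if "t \<circ> \<tau> \<circ> adj i \<in> paths n"
    using permutes_compose[OF adj_permutes[OF i] \<tau>(1)] that
    by (intro span_base) (auto simp: vecs_def comp_assoc)
  have neq: "\<tau> i \<noteq> \<tau> (Suc i)" using permutes_inj[OF \<tau>(1)] by (metis injD n_not_Suc_n)
  have "s i * y \<in> span (vecs n t)"
  proof (cases "t \<circ> \<tau> \<circ> adj i \<in> paths n")
    case True
    then show ?thesis
      using neq wvec_adj(2)[OF t \<tau> i _ True] wvec_adj_down(1)[OF t \<tau> i] 0 1
      by (cases "\<tau> i < \<tau> (Suc i)") (auto simp: y intro!: span_add span_scale)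
  next
    case False
    then show ?thesis using wvec_noswap[OF t \<tau>(2) i] 0 by (auto simp: y intro!: span_scale)
  qed
  then show ?case using step by (simp add: distrib_left span_add span_scale)
qed (simp add: span_zero)

text \<open>The span is stable under simple transpositions and contains the projector. Independence
  of the weight vectors comes later, from a count of dimensions.\<close>

lemma g_proj_span:
  assumes t: "t \<in> paths n" and \<tau>: "\<tau> permutes {1..n}"
  shows "g (pinv \<tau>) * proj n t \<in> span (vecs n t)"
  using \<tau>
proof (induction "inv_num n \<tau>" arbitrary: \<tau> rule: less_induct)
  case less
  show ?case
  proof (cases "\<tau> = id")
    case True
    have "wvec n t id \<in> span (vecs n t)"
      unfolding vecs_def by (intro span_base imageI CollectI conjI permutes_id) (use t in \<open>simp only: comp_id\<close>)
    then show ?thesis using True t by (simp add: g_id)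
  next
    case False
    then obtain i where i: "1 \<le> i" "i < n" "\<tau> (Suc i) < \<tau> i" using permutes_descent[OF less.prems] by blast
    have \<tau>1: "\<tau> \<circ> adj i permutes {1..n}" by (rule permutes_compose[OF adj_permutes[OF i(1,2)] less.prems])
    have "\<tau> = (\<tau> \<circ> adj i) \<circ> adj i" by (simp add: comp_assoc)
    then have gi: "g (pinv \<tau>) = s i * g (pinv (\<tau> \<circ> adj i))" using inv_comp_adj[OF \<tau>1] i by (metis g_adj g_comp)
    have "g (pinv (\<tau> \<circ> adj i)) * proj n t \<in> span (vecs n t)"
      using less.hyps[OF _ \<tau>1] inv_num_adj'[OF i] by simp
    then show ?thesis unfolding gi mult.assoc by (rule s_span_wvecs[OF t i(1,2)])
  qed
qed

end

section \<open>Permutations of an interval, weights of paths, and symmetrizers\<close>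

lemma permutes_interval_mono:
  "\<tau> permutes {a..b} \<Longrightarrow> 1 \<le> a \<Longrightarrow> b \<le> n \<Longrightarrow> \<tau> permutes {1..n::nat}"
  by (erule permutes_subset) auto

lemma adj_permutes_interval: "a \<le> i \<Longrightarrow> i < b \<Longrightarrow> adj i permutes {a..b}"
  by (rule permutes_swap_id) auto

lemma permutes_interval_descent:
  assumes \<tau>: "\<tau> permutes {a..b}" and "\<tau> \<noteq> id" and a: "1 \<le> a"
  obtains i where "a \<le> i" "i < b" "\<tau> (Suc i) < \<tau> i"
proof -
  obtain i where i: "1 \<le> i" "i < b" "\<tau> (Suc i) < \<tau> i"
    using permutes_descent[OF permutes_interval_mono[OF \<tau> a order_refl] assms(2)] by blast
  have "a \<le> i"
  proof (rule ccontr)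
    assume "\<not> a \<le> i"
    then have "\<tau> i = i" using permutes_not_in[OF \<tau>, of i] by simp
    moreover have "Suc i \<le> \<tau> (Suc i)"
      using permutes_not_in[OF \<tau>, of "Suc i"] permutes_in_image[OF \<tau>, of "Suc i"] \<open>\<not> a \<le> i\<close>
      by (cases "Suc i \<in> {a..b}") auto
    ultimately show False using i by simp
  qed
  then show ?thesis using i that by blast
qed

text \<open>Swapping positions \<open>i\<close> and \<open>Suc i\<close> changes it by a product of
  two differences, see \<open>weight_adj\<close>, so a suitable \<open>f\<close> makes swaps neutral
  at some positions and monotone at others.\<close>

definition weight :: "(nat \<Rightarrow> nat) \<Rightarrow> nat \<Rightarrow> (nat \<Rightarrow> box) \<Rightarrow> int" where
  "weight f n t = (\<Sum>i\<in>{1..n}. int (f i) * content (t i))"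

lemma weight_adj:
  assumes i: "1 \<le> i" "i < n"
  shows "weight f n (t \<circ> adj i) =
    weight f n t + (int (f (Suc i)) - int (f i)) * (content (t i) - content (t (Suc i)))"
proof -
  have split: "(\<Sum>j\<in>{1..n}. h j) = h i + h (Suc i) + (\<Sum>j\<in>{1..n} - {i, Suc i}. h j)" for h :: "nat \<Rightarrow> int"
  proof -
    have "{1..n} - {i, Suc i} = {1..n} - {i} - {Suc i}" by auto
    then show ?thesis
      using i sum.remove[of "{1..n}" i h] sum.remove[of "{1..n} - {i}" "Suc i" h] by simp
  qed
  have rest: "(\<Sum>j\<in>{1..n} - {i, Suc i}. int (f j) * content ((t \<circ> adj i) j)) =
      (\<Sum>j\<in>{1..n} - {i, Suc i}. int (f j) * content (t j))"
    by (intro sum.cong refl) (simp add: transpose_def)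
  show ?thesis
    unfolding weight_def split[of "\<lambda>j. int (f j) * content ((t \<circ> adj i) j)"] split[of "\<lambda>j. int (f j) * content (t j)"] rest
    by (simp add: algebra_simps)
qed

context sym_algebra
begin

definition sym_sum :: "nat \<Rightarrow> nat \<Rightarrow> 'a" where
  "sym_sum a b = (\<Sum>w | w permutes {a..b}. g w)"

lemma s_sym_sum:
  assumes i: "1 \<le> a" "a \<le> i" "i < b"
  shows "s i * sym_sum a b = sym_sum a b" "sym_sum a b * s i = sym_sum a b"
proof -
  have p: "adj i permutes {a..b}" by (rule adj_permutes_interval[OF i(2,3)])
  have si: "s i = g (adj i)" using i by (simp add: g_adj)
  have "s i * sym_sum a b = (\<Sum>w | w permutes {a..b}. g (adj i \<circ> w))"
    unfolding sym_sum_def si by (simp add: sum_distrib_left g_comp)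
  also have "\<dots> = sym_sum a b" unfolding sym_sum_def
    by (rule setum_permutations_compose_left[OF p, symmetric])
  finally show "s i * sym_sum a b = sym_sum a b" .
  have "sym_sum a b * s i = (\<Sum>w | w permutes {a..b}. g (w \<circ> adj i))"
    unfolding sym_sum_def si by (simp add: sum_distrib_right g_comp)
  also have "\<dots> = sym_sum a b" unfolding sym_sum_def
    by (rule sum_permutations_compose_right[OF p, symmetric])
  finally show "sym_sum a b * s i = sym_sum a b" .
qed

lemma g_fixed:
  assumes a: "1 \<le> a" and fx: "\<And>i. a \<le> i \<Longrightarrow> i < b \<Longrightarrow> s i * x = x" and w: "w permutes {a..b}"
  shows "g w * x = x"
  using w
proof (induction "inv_num b w" arbitrary: w rule: less_induct)
  case less
  show ?case
  proof (cases "w = id")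
    case False
    then obtain i where i: "a \<le> i" "i < b" "w (Suc i) < w i"
      using permutes_interval_descent[OF less.prems _ a] by blast
    have w1: "w \<circ> adj i permutes {a..b}"
      by (rule permutes_compose[OF adj_permutes_interval[OF i(1,2)] less.prems])
    have "w = w \<circ> adj i \<circ> adj i" by (simp add: comp_assoc)
    then have "g w = g (w \<circ> adj i) * g (adj i)" by (metis g_comp)
    then have "g w = g (w \<circ> adj i) * s i" using g_adj[of i] i a by simp
    then have "g w * x = g (w \<circ> adj i) * x" using fx[OF i(1,2)] by (simp add: mult.assoc)
    also have "\<dots> = x" using less.hyps[OF _ w1] inv_num_adj'[of i b w] i a by simp
    finally show ?thesis .
  qed (simp add: g_id)
qed

lemma sym_sum_fixed:
  assumes "1 \<le> a" and "\<And>i. a \<le> i \<Longrightarrow> i < b \<Longrightarrow> s i * x = x"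
  shows "sym_sum a b * x = real (card {w. w permutes {a..b}}) *\<^sub>R x"
proof -
  have "sym_sum a b * x = (\<Sum>w | w permutes {a..b}. g w * x)"
    unfolding sym_sum_def by (rule sum_distrib_right)
  also have "\<dots> = (\<Sum>w | w permutes {a..b}. x)"
    using g_fixed[OF assms] by (intro sum.cong) auto
  finally show ?thesis by (simp add: scaleR_conv_of_real sum_constant)
qed

end

section \<open>Symmetrization over an interval of increasing contents\<close>

text \<open>With increasing contents on \<open>{a..b}\<close> the path \<open>t\<close> is the
  minimum of its orbit under permutations of the interval: descents of \<open>\<tau>\<close> are
  descents of content of \<open>t \<circ> \<tau>\<close>, so undoing them stays among the paths and
  ends at \<open>t\<close>.\<close>

locale increasing_block = sym_algebra s X g for s X :: "nat \<Rightarrow> 'a::real_algebra_1" and g +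
  fixes n a b :: nat and t :: "nat \<Rightarrow> box"
  assumes t: "t \<in> paths n" and ab: "1 \<le> a" "b \<le> n"
    and inc: "\<And>i. a \<le> i \<Longrightarrow> i < b \<Longrightarrow> content (t i) < content (t (Suc i))"
begin

definition C :: "(nat \<Rightarrow> nat) set" where
  "C = {\<tau>. \<tau> permutes {a..b} \<and> t \<circ> \<tau> \<in> paths n}"

lemma C_permutes: "\<tau> \<in> C \<Longrightarrow> \<tau> permutes {a..b}" "\<tau> \<in> C \<Longrightarrow> \<tau> permutes {1..n}"
  "\<tau> \<in> C \<Longrightarrow> t \<circ> \<tau> \<in> paths n"
  using permutes_interval_mono[OF _ ab] by (auto simp: C_def)

lemma finite_C: "finite C"
  by (rule finite_subset[OF _ finite_permutations[of "{a..b}"]]) (auto simp: C_def)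

lemma id_in_C: "id \<in> C"
  unfolding C_def by (intro CollectI conjI permutes_id) (use t in \<open>simp only: comp_id\<close>)

lemma C_adj: "\<tau> \<in> C \<Longrightarrow> a \<le> i \<Longrightarrow> i < b \<Longrightarrow> \<tau> \<circ> adj i \<in> C \<longleftrightarrow> t \<circ> \<tau> \<circ> adj i \<in> paths n"
  unfolding C_def using permutes_compose[OF adj_permutes_interval] by (auto simp: comp_assoc)

lemma inc_less:
  assumes "a \<le> i" "i < j" "j \<le> b"
  shows "content (t i) < content (t j)"
  using assms(2,3)
proof (induction j)
  case (Suc j)
  then show ?case using inc[of j] assms(1) by (cases "i = j") auto
qed simp

lemma C_interval: "\<tau> \<in> C \<Longrightarrow> a \<le> i \<Longrightarrow> i \<le> b \<Longrightarrow> a \<le> \<tau> i \<and> \<tau> i \<le> b"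
  using permutes_in_image[OF C_permutes(1), of \<tau> i] by simp

lemma C_descent_iff:
  assumes \<tau>: "\<tau> \<in> C" and i: "a \<le> i" "i < b"
  shows "content (t (\<tau> (Suc i))) < content (t (\<tau> i)) \<longleftrightarrow> \<tau> (Suc i) < \<tau> i"
    and "content (t (\<tau> i)) < content (t (\<tau> (Suc i))) \<longleftrightarrow> \<tau> i < \<tau> (Suc i)"
proof -
  have "\<tau> i \<noteq> \<tau> (Suc i)" using permutes_inj[OF C_permutes(1)[OF \<tau>]] by (metis injD n_not_Suc_n)
  then consider "\<tau> i < \<tau> (Suc i)" | "\<tau> (Suc i) < \<tau> i" by linarith
  then have "(content (t (\<tau> (Suc i))) < content (t (\<tau> i)) \<longleftrightarrow> \<tau> (Suc i) < \<tau> i) \<and>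
    (content (t (\<tau> i)) < content (t (\<tau> (Suc i))) \<longleftrightarrow> \<tau> i < \<tau> (Suc i))"
    using inc_less[of "\<tau> i" "\<tau> (Suc i)"] inc_less[of "\<tau> (Suc i)" "\<tau> i"]
      C_interval[OF \<tau>, of i] C_interval[OF \<tau>, of "Suc i"] i by cases auto
  then show "content (t (\<tau> (Suc i))) < content (t (\<tau> i)) \<longleftrightarrow> \<tau> (Suc i) < \<tau> i"
    and "content (t (\<tau> i)) < content (t (\<tau> (Suc i))) \<longleftrightarrow> \<tau> i < \<tau> (Suc i)" by blast+
qed

lemma C_induct [consumes 1, case_names id step]:
  assumes "\<tau> \<in> C" and "P id"
    and "\<And>\<tau> i. \<tau> \<in> C \<Longrightarrow> a \<le> i \<Longrightarrow> i < b \<Longrightarrow> \<tau> (Suc i) < \<tau> i \<Longrightarrow> \<tau> \<circ> adj i \<in> C \<Longrightarrow> P (\<tau> \<circ> adj i) \<Longrightarrow> P \<tau>"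
  shows "P \<tau>"
  using assms(1)
proof (induction "inv_num n \<tau>" arbitrary: \<tau> rule: less_induct)
  case less
  show ?case
  proof (cases "\<tau> = id")
    case False
    then obtain i where i: "a \<le> i" "i < b" "\<tau> (Suc i) < \<tau> i"
      using permutes_interval_descent[OF C_permutes(1)[OF less.prems] _ ab(1)] by blast
    have i': "1 \<le> i" "i < n" using i ab by auto
    have "\<tau> \<circ> adj i \<in> C"
      using C_adj[OF less.prems i(1,2)] paths_descent[OF t C_permutes(2)[OF less.prems] C_permutes(3)[OF less.prems] i' i(3)] by blast
    then show ?thesis using assms(3)[OF less.prems i] less.hyps[of "\<tau> \<circ> adj i"] inv_num_adj'[OF i' i(3)] by simp
  qed (use assms(2) in simp)
qed

text \<open>In the last case the two boxes are neighbours. The step is not a descent, so the later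
  box is to the right, at axial distance 1; the value 1 means that \<open>s i\<close> fixes the
  weight vector.\<close>

lemma axial_C:
  assumes \<tau>: "\<tau> \<in> C" and i: "a \<le> i" "i < b"
  shows "\<tau> i < \<tau> (Suc i) \<Longrightarrow> 0 < axial (t \<circ> \<tau>) i"
    "\<tau> \<circ> adj i \<in> C \<Longrightarrow> \<bar>axial (t \<circ> \<tau>) i\<bar> < 1"
    "\<tau> \<circ> adj i \<notin> C \<Longrightarrow> axial (t \<circ> \<tau>) i = 1"
proof -
  have p: "is_path n (t \<circ> \<tau>)" by (intro paths_is_path C_permutes \<tau>)
  have i': "1 \<le> i" "i < n" using i ab by auto
  show "0 < axial (t \<circ> \<tau>) i" if "\<tau> i < \<tau> (Suc i)"
    using C_descent_iff(2)[OF \<tau> i] that by (simp add: axial_def cnt_def)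
  show "\<bar>axial (t \<circ> \<tau>) i\<bar> < 1" if "\<tau> \<circ> adj i \<in> C"
  proof -
    have "is_path n (t \<circ> \<tau> \<circ> adj i)" using C_adj[OF \<tau> i] that paths_is_path by blast
    then show ?thesis using axial_square_neq(3,4)[OF p i'] by (simp add: abs_less_iff)
  qed
  show "axial (t \<circ> \<tau>) i = 1" if "\<tau> \<circ> adj i \<notin> C"
  proof -
    have no: "t \<circ> \<tau> \<circ> adj i \<notin> paths n" using C_adj[OF \<tau> i] that by blast
    then have "\<not> is_path n (t \<circ> \<tau> \<circ> adj i)" using paths_adj[OF C_permutes(3)[OF \<tau>] i'] by blast
    then have nb: "t (\<tau> (Suc i)) \<in> {right (t (\<tau> i)), below (t (\<tau> i))}"
      using is_path_swap_cases[OF p i'] by auto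
    have "\<not> \<tau> (Suc i) < \<tau> i"
      using no paths_descent[OF t C_permutes(2)[OF \<tau>] C_permutes(3)[OF \<tau>] i'] by blast
    then have "\<not> content (t (\<tau> (Suc i))) < content (t (\<tau> i))" using C_descent_iff(1)[OF \<tau> i] by blast
    then have "t (\<tau> (Suc i)) = right (t (\<tau> i))" using nb by auto
    then show ?thesis by (simp add: axial_def cnt_def)
  qed
qed

text \<open>The idempotent of the whole orbit. It commutes with the interval subgroup, which
  confines \<open>sym_sum\<close> to the orbit in \<open>proj_sym_sum\<close>.\<close>

definition Q :: 'a where "Q = (\<Sum>\<tau>\<in>C. proj n (t \<circ> \<tau>))"

lemma Q_proj:
  assumes \<tau>: "\<tau> \<in> C"
  shows "Q * proj n (t \<circ> \<tau>) = proj n (t \<circ> \<tau>)" "proj n (t \<circ> \<tau>) * Q = proj n (t \<circ> \<tau>)"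
proof -
  have eq: "t \<circ> \<rho> = t \<circ> \<tau> \<longleftrightarrow> \<rho> = \<tau>" if "\<rho> \<in> C" for \<rho>
    using paths_comp_inj[OF t C_permutes(2)[OF that] C_permutes(2)[OF \<tau>]] by blast
  have 1: "proj n (t \<circ> \<rho>) * proj n (t \<circ> \<tau>) = (if \<rho> = \<tau> then proj n (t \<circ> \<tau>) else 0)"
    "proj n (t \<circ> \<tau>) * proj n (t \<circ> \<rho>) = (if \<rho> = \<tau> then proj n (t \<circ> \<tau>) else 0)" if \<rho>: "\<rho> \<in> C" for \<rho>
    using proj_mult[OF C_permutes(3)[OF \<rho>] C_permutes(3)[OF \<tau>]] proj_mult[OF C_permutes(3)[OF \<tau>] C_permutes(3)[OF \<rho>]]
      eq[OF \<rho>] by (cases "\<rho> = \<tau>"; simp)+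
  show "Q * proj n (t \<circ> \<tau>) = proj n (t \<circ> \<tau>)"
    unfolding Q_def sum_distrib_right using 1(1) \<tau> finite_C by (simp cong: sum.cong)
  show "proj n (t \<circ> \<tau>) * Q = proj n (t \<circ> \<tau>)"
    unfolding Q_def sum_distrib_left using 1(2) \<tau> finite_C by (simp cong: sum.cong)
qed

text \<open>A swap inside the interval leads from one path of the orbit to another or to no path, so
  \<open>Q\<close> is absorbed on either side: \<open>Q * s i * Q\<close> equals both
  products.\<close>

lemma s_Q:
  assumes i: "a \<le> i" "i < b"
  shows "s i * Q = Q * s i"
proof -
  have i': "1 \<le> i" "i < n" using i ab by auto
  have 1: "Q * (s i * proj n (t \<circ> \<tau>)) = s i * proj n (t \<circ> \<tau>)" if \<tau>: "\<tau> \<in> C" for \<tau>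
  proof -
    define z where "z = s i * proj n (t \<circ> \<tau>)"
    have z: "z = axial (t \<circ> \<tau>) i *\<^sub>R proj n (t \<circ> \<tau>) + (if \<tau> \<circ> adj i \<in> C then proj n (t \<circ> (\<tau> \<circ> adj i)) * z else 0)"
      unfolding z_def by (subst s_proj[OF C_permutes(3)[OF \<tau>] i']) (simp add: C_adj[OF \<tau> i] mult.assoc comp_assoc)
    have "Q * z = axial (t \<circ> \<tau>) i *\<^sub>R (Q * proj n (t \<circ> \<tau>)) + (if \<tau> \<circ> adj i \<in> C then (Q * proj n (t \<circ> (\<tau> \<circ> adj i))) * z else 0)"
      by (subst z) (simp add: distrib_left mult.assoc)
    also have "\<dots> = axial (t \<circ> \<tau>) i *\<^sub>R proj n (t \<circ> \<tau>) + (if \<tau> \<circ> adj i \<in> C then proj n (t \<circ> (\<tau> \<circ> adj i)) * z else 0)"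
      using Q_proj(1)[OF \<tau>] Q_proj(1)[of "\<tau> \<circ> adj i"] by (cases "\<tau> \<circ> adj i \<in> C") simp_all
    also note z[symmetric]
    finally show ?thesis by (simp add: z_def)
  qed
  have 2: "proj n (t \<circ> \<tau>) * s i * Q = proj n (t \<circ> \<tau>) * s i" if \<tau>: "\<tau> \<in> C" for \<tau>
  proof -
    define z where "z = proj n (t \<circ> \<tau>) * s i"
    have z: "z = axial (t \<circ> \<tau>) i *\<^sub>R proj n (t \<circ> \<tau>) + (if \<tau> \<circ> adj i \<in> C then z * proj n (t \<circ> (\<tau> \<circ> adj i)) else 0)"
      unfolding z_def by (subst proj_s[OF C_permutes(3)[OF \<tau>] i']) (simp add: C_adj[OF \<tau> i] mult.assoc comp_assoc)
    have "z * Q = axial (t \<circ> \<tau>) i *\<^sub>R (proj n (t \<circ> \<tau>) * Q) + (if \<tau> \<circ> adj i \<in> C then z * (proj n (t \<circ> (\<tau> \<circ> adj i)) * Q) else 0)"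
      by (subst z) (simp add: distrib_right mult.assoc)
    also have "\<dots> = axial (t \<circ> \<tau>) i *\<^sub>R proj n (t \<circ> \<tau>) + (if \<tau> \<circ> adj i \<in> C then z * proj n (t \<circ> (\<tau> \<circ> adj i)) else 0)"
      using Q_proj(2)[OF \<tau>] Q_proj(2)[of "\<tau> \<circ> adj i"] by (cases "\<tau> \<circ> adj i \<in> C") simp_all
    also note z[symmetric]
    finally show ?thesis by (simp add: z_def)
  qed
  have "Q * (s i * Q) = (\<Sum>\<tau>\<in>C. Q * (s i * proj n (t \<circ> \<tau>)))"
    by (subst (2) Q_def) (simp only: sum_distrib_left)
  also have "\<dots> = (\<Sum>\<tau>\<in>C. s i * proj n (t \<circ> \<tau>))" using 1 by (rule sum.cong[OF refl])
  also have "\<dots> = s i * Q" by (simp only: Q_def sum_distrib_left)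
  finally have 3: "Q * (s i * Q) = s i * Q" .
  have "Q * s i * Q = (\<Sum>\<tau>\<in>C. proj n (t \<circ> \<tau>) * s i * Q)"
    by (subst (1) Q_def) (simp only: sum_distrib_right)
  also have "\<dots> = (\<Sum>\<tau>\<in>C. proj n (t \<circ> \<tau>) * s i)" using 2 by (rule sum.cong[OF refl])
  also have "\<dots> = Q * s i" by (simp only: Q_def sum_distrib_right)
  finally show ?thesis using 3 by (simp only: mult.assoc)
qed

end

context increasing_block
begin

lemma block_rule: "a \<le> i \<Longrightarrow> i < b \<Longrightarrow> 1 \<le> i \<and> i < n"
  using ab by auto

lemma g_Q: "w permutes {a..b} \<Longrightarrow> g w * Q = Q * g w"
proof (induction "inv_num b w" arbitrary: w rule: less_induct)
  case less
  show ?case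
  proof (cases "w = id")
    case False
    then obtain i where i: "a \<le> i" "i < b" "w (Suc i) < w i"
      using permutes_interval_descent[OF less.prems _ ab(1)] by blast
    have w1: "w \<circ> adj i permutes {a..b}"
      by (rule permutes_compose[OF adj_permutes_interval[OF i(1,2)] less.prems])
    have "w = w \<circ> adj i \<circ> adj i" by (simp add: comp_assoc)
    then have "g w = g (w \<circ> adj i) * g (adj i)" by (metis g_comp)
    then have gw: "g w = g (w \<circ> adj i) * s i" using g_adj[of i] i ab by simp
    have IH: "g (w \<circ> adj i) * Q = Q * g (w \<circ> adj i)"
      using less.hyps[OF _ w1] inv_num_adj'[of i b w] i ab by simp
    have "g w * Q = g (w \<circ> adj i) * Q * s i"
      unfolding gw mult.assoc s_Q[OF i(1,2)] ..
    then show ?thesis unfolding IH gw mult.assoc .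
  qed (simp add: g_id)
qed

lemma sym_sum_Q: "sym_sum a b * Q = Q * sym_sum a b"
  unfolding sym_sum_def sum_distrib_left sum_distrib_right by (intro sum.cong refl g_Q) simp

lemma proj_sym_sum: "proj n t * sym_sum a b = (\<Sum>\<tau>\<in>C. proj n t * sym_sum a b * proj n (t \<circ> \<tau>))"
proof -
  have "proj n t * sym_sum a b = proj n t * Q * sym_sum a b"
    using Q_proj(2)[OF id_in_C] unfolding comp_id by simp
  also have "\<dots> = proj n t * sym_sum a b * Q" using sym_sum_Q by (simp only: mult.assoc)
  also have "\<dots> = (\<Sum>\<tau>\<in>C. proj n t * sym_sum a b * proj n (t \<circ> \<tau>))" unfolding Q_def sum_distrib_left ..
  finally show ?thesis .
qed

text \<open>By \<open>wvec_adj_down\<close> a weight vector is \<open>s i + r\<close> times a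
  shorter one, and the symmetrizer absorbs \<open>s i\<close>. Each step multiplies by
  \<open>1 + r\<close>, which is positive since \<open>\<bar>r\<bar> < 1\<close>.\<close>

lemma sym_sum_wvec:
  assumes "\<tau> \<in> C"
  shows "\<exists>h>0. sym_sum a b * wvec n t \<tau> = h *\<^sub>R (sym_sum a b * proj n t)"
  using assms
proof (induction rule: C_induct)
  case id
  then show ?case using wvec_id[OF t] by (intro exI[of _ 1]) (simp only: scaleR_one zero_less_one simp_thms)
next
  case (step \<tau> i)
  then obtain h where h: "h > 0" "sym_sum a b * wvec n t (\<tau> \<circ> adj i) = h *\<^sub>R (sym_sum a b * proj n t)" by blast
  note i = block_rule[OF step(2,3)]
  have "sym_sum a b * wvec n t \<tau> = (sym_sum a b * s i) * wvec n t (\<tau> \<circ> adj i)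
      + axial (t \<circ> \<tau>) i *\<^sub>R (sym_sum a b * wvec n t (\<tau> \<circ> adj i))"
    by (subst wvec_adj_down(2)[OF t C_permutes(2)[OF step(1)] C_permutes(3)[OF step(1)] i[THEN conjunct1] i[THEN conjunct2] step(4)])
      (simp add: distrib_left mult.assoc)
  also have "\<dots> = ((1 + axial (t \<circ> \<tau>) i) * h) *\<^sub>R (sym_sum a b * proj n t)"
    unfolding s_sym_sum(2)[OF ab(1) step(2,3)] h(2) by (simp add: scaleR_left_distrib distrib_right)
  finally show ?case using h(1) axial_C(2)[OF step(1-3,5)] by (intro exI[of _ "(1 + axial (t \<circ> \<tau>) i) * h"]) auto
qed

text \<open>Invariance under \<open>s i\<close> forces the coefficient to be divided by
  \<open>1 + r\<close> when a swap at \<open>i\<close> makes \<open>\<tau>\<close> longer. The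
  product over all inversions solves this recursion without the choice of a reduced word.\<close>

definition H :: "(nat \<Rightarrow> nat) \<Rightarrow> real" where
  "H \<tau> = (\<Prod>(i, j)\<in>inversions n \<tau>. 1 / (1 + 1 / \<bar>cnt (t (\<tau> i)) - cnt (t (\<tau> j))\<bar>))"

lemma H_pos: "H \<tau> > 0"
  unfolding H_def by (intro prod_pos) (auto intro!: add_pos_nonneg)

lemma H_id: "H id = 1"
proof -
  have "inversions n id = {}" by (auto simp: inversions_def)
  then show ?thesis by (simp add: H_def)
qed

lemma H_adj:
  assumes \<tau>: "\<tau> \<in> C" and i: "a \<le> i" "i < b" and less: "\<tau> i < \<tau> (Suc i)"
  shows "H (\<tau> \<circ> adj i) = H \<tau> / (1 + axial (t \<circ> \<tau>) i)"
proof -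
  note i' = block_rule[OF i]
  note inv = inversions_adj[OF i'[THEN conjunct1] i'[THEN conjunct2], of \<tau>, OF less]
  let ?f = "\<lambda>\<tau> (i, j). 1 / (1 + 1 / \<bar>cnt (t (\<tau> i)) - cnt (t (\<tau> j))\<bar>) :: real"
  have "H (\<tau> \<circ> adj i) = ?f (\<tau> \<circ> adj i) (i, Suc i) *
      (\<Prod>x\<in>map_prod (adj i) (adj i) ` inversions n \<tau>. ?f (\<tau> \<circ> adj i) x)"
    unfolding H_def inv(1) by (subst prod.insert) (use inv(2) finite_inversions in auto)
  also have "(\<Prod>x\<in>map_prod (adj i) (adj i) ` inversions n \<tau>. ?f (\<tau> \<circ> adj i) x) = H \<tau>"
    unfolding H_def by (subst prod.reindex[OF inv(3)]) (intro prod.cong refl, auto simp: split_def)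
  also have "?f (\<tau> \<circ> adj i) (i, Suc i) = 1 / (1 + axial (t \<circ> \<tau>) i)"
    using axial_C(1)[OF \<tau> i less] by (simp add: axial_def)
  finally show ?thesis unfolding times_divide_eq_left mult_1_left .
qed

text \<open>A vector in the left ideal of \<open>proj n t\<close> that the interval subgroup fixes,
  normalized so that its component at \<open>t\<close> is the projector.\<close>

definition invariant :: 'a where "invariant = (\<Sum>\<tau>\<in>C. H \<tau> *\<^sub>R wvec n t \<tau>)"

lemma s_invariant:
  assumes i: "a \<le> i" "i < b"
  shows "s i * invariant = invariant"
proof -
  note i' = block_rule[OF i]
  define r where "r \<tau> = axial (t \<circ> \<tau>) i" for \<tau>
  \<comment> \<open>The coefficient of \<open>wvec n t (\<tau> \<circ> adj i)\<close> in
    \<open>s i * wvec n t \<tau>\<close>: 1 upwards and \<open>1 - (r \<tau>)\<^sup>2\<close>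
    downwards.\<close>
  define \<alpha> where "\<alpha> \<tau> = (if \<tau> i < \<tau> (Suc i) then 1 else 1 - (r \<tau>)\<^sup>2)" for \<tau> :: "nat \<Rightarrow> nat"
  define C' where "C' = {\<tau>\<in>C. \<tau> \<circ> adj i \<in> C}"
  have s: "s i * wvec n t \<tau> = r \<tau> *\<^sub>R wvec n t \<tau> + (if \<tau> \<in> C' then \<alpha> \<tau> *\<^sub>R wvec n t (\<tau> \<circ> adj i) else 0)"
    if \<tau>: "\<tau> \<in> C" for \<tau>
  proof (cases "\<tau> \<in> C'")
    case True
    have neq: "\<tau> i \<noteq> \<tau> (Suc i)" using permutes_inj[OF C_permutes(2)[OF \<tau>]] by (metis injD n_not_Suc_n)
    have p: "t \<circ> \<tau> \<circ> adj i \<in> paths n" using True C_adj[OF \<tau> i] by (simp add: C'_def)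
    show ?thesis
    proof (cases "\<tau> i < \<tau> (Suc i)")
      case l: True
      then show ?thesis
        using wvec_adj(2)[OF t C_permutes(2,3)[OF \<tau>] _ _ l p] True i' by (simp add: \<alpha>_def r_def)
    next
      case False
      then show ?thesis
        using wvec_adj_down(1)[OF t C_permutes(2,3)[OF \<tau>] _ _, of i] neq True i' by (simp add: \<alpha>_def r_def)
    qed
  next
    case False
    then have "t \<circ> \<tau> \<circ> adj i \<notin> paths n" using C_adj[OF \<tau> i] \<tau> by (simp add: C'_def)
    then show ?thesis using wvec_noswap[OF t C_permutes(3)[OF \<tau>]] i' False by (simp add: r_def)
  qed
  have bij: "bij_betw (\<lambda>\<tau>. \<tau> \<circ> adj i) C' C'"
    by (rule bij_betwI[where g = "\<lambda>\<tau>. \<tau> \<circ> adj i"]) (auto simp: C'_def comp_assoc)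
  \<comment> \<open>After applying \<open>s i\<close>, the coefficient of
    \<open>wvec n t \<tau>\<close> is collected from \<open>\<tau>\<close> itself and from
    \<open>\<tau> \<circ> adj i\<close>.\<close>
  have coef: "H \<tau> * r \<tau> + (if \<tau> \<in> C' then H (\<tau> \<circ> adj i) * \<alpha> (\<tau> \<circ> adj i) else 0) = H \<tau>"
    if \<tau>: "\<tau> \<in> C" for \<tau>
  proof (cases "\<tau> \<in> C'")
    case True
    then have \<tau>': "\<tau> \<circ> adj i \<in> C" by (simp add: C'_def)
    have r': "r (\<tau> \<circ> adj i) = - r \<tau>" unfolding r_def comp_assoc[symmetric] by (rule axial_adj)
    have r1: "\<bar>r \<tau>\<bar> < 1" using axial_C(2)[OF \<tau> i \<tau>'] by (simp add: r_def)
    have neq: "\<tau> i \<noteq> \<tau> (Suc i)" using permutes_inj[OF C_permutes(2)[OF \<tau>]] by (metis injD n_not_Suc_n)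
    show ?thesis
    proof (cases "\<tau> i < \<tau> (Suc i)")
      case l: True
      have "H (\<tau> \<circ> adj i) = H \<tau> / (1 + r \<tau>)" using H_adj[OF \<tau> i l] by (simp add: r_def)
      moreover have "\<alpha> (\<tau> \<circ> adj i) = 1 - (r \<tau>)\<^sup>2" using l r' by (simp add: \<alpha>_def)
      moreover have "1 - (r \<tau>)\<^sup>2 = (1 + r \<tau>) * (1 - r \<tau>)" by (simp add: power2_eq_square algebra_simps)
      ultimately have "H (\<tau> \<circ> adj i) * \<alpha> (\<tau> \<circ> adj i) = H \<tau> * (1 - r \<tau>)" using r1 by simp
      then show ?thesis using True by (simp add: algebra_simps)
    next
      case False
      then have l: "(\<tau> \<circ> adj i) i < (\<tau> \<circ> adj i) (Suc i)" using neq by simp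
      have "H \<tau> = H (\<tau> \<circ> adj i) / (1 - r \<tau>)"
        using H_adj[OF \<tau>' i l] r' unfolding r_def comp_assoc transpose_comp_involutory comp_id by (simp only: diff_conv_add_uminus)
      then have "H (\<tau> \<circ> adj i) = H \<tau> * (1 - r \<tau>)" using r1 by (simp add: field_simps)
      moreover have "\<alpha> (\<tau> \<circ> adj i) = 1" using l by (simp add: \<alpha>_def)
      ultimately show ?thesis using True by (simp add: algebra_simps)
    qed
  next
    case False
    then have "\<tau> \<circ> adj i \<notin> C" using \<tau> by (simp add: C'_def)
    then show ?thesis using axial_C(3)[OF \<tau> i] False by (simp add: r_def)
  qed
  have sub: "C \<inter> C' = C'" by (auto simp: C'_def)
  have "s i * invariant = (\<Sum>\<tau>\<in>C. H \<tau> *\<^sub>R (s i * wvec n t \<tau>))"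
    unfolding invariant_def by (simp add: sum_distrib_left)
  also have "\<dots> = (\<Sum>\<tau>\<in>C. (H \<tau> * r \<tau>) *\<^sub>R wvec n t \<tau> + (if \<tau> \<in> C' then (H \<tau> * \<alpha> \<tau>) *\<^sub>R wvec n t (\<tau> \<circ> adj i) else 0))"
    by (intro sum.cong refl) (simp add: s scaleR_right_distrib)
  also have "\<dots> = (\<Sum>\<tau>\<in>C. (H \<tau> * r \<tau>) *\<^sub>R wvec n t \<tau>) + (\<Sum>\<tau>\<in>C'. (H \<tau> * \<alpha> \<tau>) *\<^sub>R wvec n t (\<tau> \<circ> adj i))"
    using finite_C by (simp add: sum.distrib sum.If_cases sub)
  also have "(\<Sum>\<tau>\<in>C'. (H \<tau> * \<alpha> \<tau>) *\<^sub>R wvec n t (\<tau> \<circ> adj i)) =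
      (\<Sum>\<tau>\<in>C'. (H (\<tau> \<circ> adj i) * \<alpha> (\<tau> \<circ> adj i)) *\<^sub>R wvec n t (\<tau> \<circ> adj i \<circ> adj i))"
    by (rule sum.reindex_bij_betw[OF bij, symmetric])
  also have "\<dots> = (\<Sum>\<tau>\<in>C. (if \<tau> \<in> C' then (H (\<tau> \<circ> adj i) * \<alpha> (\<tau> \<circ> adj i)) *\<^sub>R wvec n t \<tau> else 0))"
    using finite_C by (simp add: sum.If_cases sub comp_assoc)
  also have "(\<Sum>\<tau>\<in>C. (H \<tau> * r \<tau>) *\<^sub>R wvec n t \<tau>) + \<dots> =
      (\<Sum>\<tau>\<in>C. (H \<tau> * r \<tau> + (if \<tau> \<in> C' then H (\<tau> \<circ> adj i) * \<alpha> (\<tau> \<circ> adj i) else 0)) *\<^sub>R wvec n t \<tau>)"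
    unfolding sum.distrib[symmetric] by (intro sum.cong refl) (simp add: scaleR_left_distrib)
  also have "\<dots> = invariant" unfolding invariant_def by (intro sum.cong refl) (simp only: coef)
  finally show ?thesis .
qed

lemma proj_invariant: "proj n t * invariant = proj n t"
proof -
  have "proj n t * invariant = (\<Sum>\<tau>\<in>C. H \<tau> *\<^sub>R (proj n t * wvec n t \<tau>))"
    unfolding invariant_def by (simp add: sum_distrib_left)
  also have "\<dots> = (\<Sum>\<tau>\<in>C. if \<tau> = id then proj n t else 0)"
  proof (intro sum.cong refl)
    fix \<tau> assume \<tau>: "\<tau> \<in> C"
    have "t = t \<circ> \<tau> \<longleftrightarrow> \<tau> = id"
      using paths_comp_neq[OF t C_permutes(2)[OF \<tau>]] by (metis comp_id)
    then show "H \<tau> *\<^sub>R (proj n t * wvec n t \<tau>) = (if \<tau> = id then proj n t else 0)"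
      using proj_wvec[OF t t C_permutes(3)[OF \<tau>]] t by (auto simp: H_id)
  qed
  finally show ?thesis using id_in_C finite_C by simp
qed

text \<open>Apply the symmetrizer to \<open>invariant\<close> in two ways. It multiplies a fixed
  vector by the order of the group; summed over weight vectors it gives a positive multiple of
  \<open>sym_sum a b * proj n t\<close>. Multiplying by \<open>proj n t\<close> from the left
  compares the two.\<close>

lemma proj_sym_sum_proj: "\<exists>\<kappa>>0. proj n t * sym_sum a b * proj n t = \<kappa> *\<^sub>R proj n t"
proof -
  obtain h where h: "\<And>\<tau>. \<tau> \<in> C \<Longrightarrow> h \<tau> > 0"
    "\<And>\<tau>. \<tau> \<in> C \<Longrightarrow> sym_sum a b * wvec n t \<tau> = h \<tau> *\<^sub>R (sym_sum a b * proj n t)"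
    using sym_sum_wvec by metis
  define k where "k = (\<Sum>\<tau>\<in>C. H \<tau> * h \<tau>)"
  define F where "F = real (card {w. w permutes {a..b}})"
  have k: "k > 0" unfolding k_def using h(1) H_pos id_in_C finite_C by (intro sum_pos) auto
  have "id \<in> {w. w permutes {a..b}}" by (intro CollectI permutes_id)
  then have F: "F > 0" unfolding F_def using finite_permutations[of "{a..b}"]
    by (metis card_gt_0_iff emptyE finite_atLeastAtMost of_nat_0_less_iff)
  have "F *\<^sub>R invariant = sym_sum a b * invariant"
    unfolding F_def by (rule sym_sum_fixed[symmetric]) (use ab s_invariant in auto)
  also have "\<dots> = (\<Sum>\<tau>\<in>C. (H \<tau> * h \<tau>) *\<^sub>R (sym_sum a b * proj n t))"
    unfolding invariant_def sum_distrib_left by (intro sum.cong refl) (simp add: h(2))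
  also have "\<dots> = k *\<^sub>R (sym_sum a b * proj n t)" by (simp add: k_def scaleR_left.sum)
  finally have "F *\<^sub>R (proj n t * invariant) = k *\<^sub>R (proj n t * sym_sum a b * proj n t)"
    by (simp add: mult.assoc flip: mult_scaleR_right)
  then have "F *\<^sub>R proj n t = k *\<^sub>R (proj n t * sym_sum a b * proj n t)" by (simp add: proj_invariant)
  then have "(1 / k) *\<^sub>R F *\<^sub>R proj n t = (1 / k) *\<^sub>R k *\<^sub>R (proj n t * sym_sum a b * proj n t)"
    by (rule arg_cong)
  then have "proj n t * sym_sum a b * proj n t = (F / k) *\<^sub>R proj n t" using k by simp
  then show ?thesis using k F by (intro exI[of _ "F / k"]) simp
qed

end

section \<open>Left ideals attached to a descent set\<close>

text \<open>
  The left ideal \<open>N\<close> stands for the elements that send the monomial with exponents \<open>\<beta>\<close> into a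
  given submodule; \<open>S\<close> is the set of ascents of \<open>\<beta>\<close>.  Among the paths whose projector is not
  in \<open>N\<close>, one with the least value of \<open>\<Sum>\<^sub>i \<beta> i * content (t i)\<close> and, among these, the greatest value of
  \<open>\<Sum>\<^sub>i i * content (t i)\<close> would have descent set \<open>S\<close>.
\<close>

locale descent_ideal = sym_algebra s X g for s X :: "nat \<Rightarrow> 'a::real_algebra_1" and g +
  fixes n :: nat and S :: "nat set" and \<beta> :: "nat \<Rightarrow> nat" and A N :: "'a set"
  assumes A: "1 \<in> A" "\<And>x y. x \<in> A \<Longrightarrow> y \<in> A \<Longrightarrow> x + y \<in> A" "\<And>x y. x \<in> A \<Longrightarrow> y \<in> A \<Longrightarrow> x * y \<in> A"
      "\<And>x r. x \<in> A \<Longrightarrow> r *\<^sub>R x \<in> A" "\<And>i. 1 \<le> i \<Longrightarrow> i < n \<Longrightarrow> s i \<in> A"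
    and N: "0 \<in> N" "\<And>x y. x \<in> N \<Longrightarrow> y \<in> N \<Longrightarrow> x + y \<in> N" "\<And>x r. x \<in> N \<Longrightarrow> r *\<^sub>R x \<in> N"
      "\<And>x y. x \<in> A \<Longrightarrow> y \<in> N \<Longrightarrow> x * y \<in> N"
    and \<beta>: "\<And>i. 1 \<le> i \<Longrightarrow> i < n \<Longrightarrow> \<beta> (Suc i) = (if i \<in> S then Suc (\<beta> i) else \<beta> i)"
    and N_s: "\<And>i. 1 \<le> i \<Longrightarrow> i < n \<Longrightarrow> i \<notin> S \<Longrightarrow> s i - 1 \<in> N"
    and N_proj: "\<And>t. t \<in> paths n \<Longrightarrow>
      (\<And>i. 1 \<le> i \<Longrightarrow> i < n \<Longrightarrow> i \<in> S \<longleftrightarrow> content (t (Suc i)) < content (t i)) \<Longrightarrow> proj n t \<in> N"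
    and N_sym: "\<And>k. k \<in> S \<Longrightarrow> 1 \<le> k \<Longrightarrow> k < n \<Longrightarrow>
      \<exists>a b. 1 \<le> a \<and> a \<le> k \<and> k < b \<and> b \<le> n \<and> (\<forall>i. a \<le> i \<and> i < b \<and> i \<noteq> k \<longrightarrow> i \<notin> S) \<and> sym_sum a b \<in> N"
begin

lemma A_X: "1 \<le> j \<Longrightarrow> j \<le> n \<Longrightarrow> X j \<in> A"
proof (induction j)
  case (Suc j)
  show ?case
  proof (cases "j = 0")
    case True
    then show ?thesis using A(4)[OF A(1), of 0] by (simp add: X_1)
  next
    case False
    then show ?thesis using Suc A by (simp add: X_Suc)
  qed
qed simp

lemma A_ev: "x \<in> A \<Longrightarrow> ev p x \<in> A"
proof (induction p)
  case 0
  show ?case using A(4)[OF A(1), of 0] by simp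
next
  case (pCons a p)
  then show ?case using A(4)[OF A(1), of a] A(2,3) by (simp add: of_real_def)
qed

lemma A_proj: "m \<le> n \<Longrightarrow> proj m t \<in> A"
proof (induction m)
  case (Suc m)
  then show ?case using A(3) A_ev[OF A_X[of "Suc m"]] by simp
qed (simp add: A)

lemma A_sum: "(\<And>i. i \<in> I \<Longrightarrow> f i \<in> A) \<Longrightarrow> (\<Sum>i\<in>I. f i) \<in> A"
proof (induction I rule: infinite_finite_induct)
  case (insert x F)
  then show ?case using A(2) by simp
qed (use A(4)[OF A(1), of 0] in simp_all)

lemma N_sum: "(\<And>i. i \<in> I \<Longrightarrow> f i \<in> N) \<Longrightarrow> (\<Sum>i\<in>I. f i) \<in> N"
proof (induction I rule: infinite_finite_induct)
  case (insert x F)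
  then show ?case using N(2) by simp
qed (use N in simp_all)

lemma N_diff: "x \<in> N \<Longrightarrow> y \<in> N \<Longrightarrow> x - y \<in> N"
  using N(2)[of x "-1 *\<^sub>R y"] N(3)[of y "-1"] by simp

lemma N_scale_cancel: "r *\<^sub>R x \<in> N \<Longrightarrow> r \<noteq> 0 \<Longrightarrow> x \<in> N"
  using N(3)[of "r *\<^sub>R x" "1 / r"] by simp

lemma A_g: "w permutes {1..n} \<Longrightarrow> g w \<in> A"
proof (induction "inv_num n w" arbitrary: w rule: less_induct)
  case less
  show ?case
  proof (cases "w = id")
    case False
    then obtain i where i: "1 \<le> i" "i < n" "w (Suc i) < w i" using permutes_descent[OF less.prems] by blast
    have w1: "w \<circ> adj i permutes {1..n}" by (rule permutes_compose[OF adj_permutes[OF i(1,2)] less.prems])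
    have "w = w \<circ> adj i \<circ> adj i" by (simp add: comp_assoc)
    then have "g w = g (w \<circ> adj i) * s i" using g_adj[OF i(1)] by (metis g_comp)
    then show ?thesis using less.hyps[OF _ w1] inv_num_adj'[OF i] A(3) A(5)[OF i(1,2)] by simp
  qed (simp add: g_id A)
qed

lemma A_sym_sum: "1 \<le> a \<Longrightarrow> b \<le> n \<Longrightarrow> sym_sum a b \<in> A"
  unfolding sym_sum_def by (rule A_sum) (blast intro: A_g permutes_interval_mono)

abbreviation "M \<equiv> weight \<beta> n"
abbreviation "M' \<equiv> weight (\<lambda>i. i) n"

text \<open>A descent of \<open>t\<close> outside \<open>S\<close> can be removed by a swap.\<close>

lemma proj_extra_descent:
  assumes t: "t \<in> paths n" and i: "1 \<le> i" "i < n" "i \<notin> S" and d: "content (t (Suc i)) < content (t i)"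
    and IH: "\<And>u. u \<in> paths n \<Longrightarrow> M u = M t \<Longrightarrow> M' t < M' u \<Longrightarrow> proj n u \<in> N"
  shows "proj n t \<in> N"
proof -
  have 1: "proj n t * (s i - 1) \<in> N" using N(4)[OF A_proj[OF order_refl] N_s[OF i]] .
  have r: "axial t i < 0" using d by (simp add: axial_def cnt_def)
  \<comment> \<open>The product \<open>proj n t * (s i - 1)\<close> lies in \<open>N\<close>. It
    consists of \<open>axial t i - 1\<close> times the projector and a term through the swapped
    path, which lies in \<open>N\<close> by the hypothesis on larger \<open>M'\<close>.\<close>
  have "(axial t i - 1) *\<^sub>R proj n t \<in> N"
  proof (cases "t \<circ> adj i \<in> paths n")
    case True
    have "proj n (t \<circ> adj i) \<in> N"
      using d \<beta>[OF i(1,2)] i by (intro IH True) (auto simp: weight_adj)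
    then have "proj n t * s i * proj n (t \<circ> adj i) \<in> N"
      using N(4) A(3) A_proj[OF order_refl] A(5)[OF i(1,2)] by blast
    from N_diff[OF 1 this] show ?thesis
      unfolding right_diff_distrib mult_1_right by (subst (asm) (1) proj_s[OF t i(1,2)]) (simp add: True scaleR_left_diff_distrib)
  next
    case False
    then show ?thesis using 1 proj_s[OF t i(1,2)] by (simp add: right_diff_distrib scaleR_left_diff_distrib)
  qed
  then show ?thesis by (rule N_scale_cancel) (use r in simp)
qed

text \<open>On the interval given by \<open>N_sym\<close> the path has increasing contents. Modulo
  \<open>N\<close> each projector of its orbit is a nonnegative multiple of the corresponding weight
  vector, so \<open>proj n t * sym_sum a b\<close>, which lies in \<open>N\<close>, becomes a sum of
  nonnegative multiples of \<open>proj n t\<close> in which the term of the identity is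
  positive.\<close>

lemma proj_missing_descent:
  assumes t: "t \<in> paths n" and k: "k \<in> S" "1 \<le> k" "k < n"
    and d: "\<And>i. 1 \<le> i \<Longrightarrow> i < n \<Longrightarrow> i \<notin> S \<or> i = k \<Longrightarrow> content (t i) < content (t (Suc i))"
    and IH: "\<And>u. u \<in> paths n \<Longrightarrow> M u < M t \<Longrightarrow> proj n u \<in> N"
  shows "proj n t \<in> N"
proof -
  obtain a b where ab: "1 \<le> a" "a \<le> k" "k < b" "b \<le> n" and S: "\<And>i. a \<le> i \<Longrightarrow> i < b \<Longrightarrow> i \<noteq> k \<Longrightarrow> i \<notin> S"
    and Y: "sym_sum a b \<in> N"
    using N_sym[OF k] by blast
  interpret B: increasing_block s X g n a b t
  proof unfold_locales
    show "content (t i) < content (t (Suc i))" if "a \<le> i" "i < b" for i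
      using d[of i] S[OF that] that ab by auto
  qed (use t ab in auto)
  have pA: "proj n u \<in> A" for u by (rule A_proj) simp
  have red: "M (t \<circ> \<tau>) \<le> M t \<and> (\<exists>h\<ge>0. (\<tau> = id \<longrightarrow> h = 1) \<and> proj n (t \<circ> \<tau>) - h *\<^sub>R wvec n t \<tau> \<in> N)"
    if "\<tau> \<in> B.C" for \<tau>
    using that
  proof (induction rule: B.C_induct)
    case id
    show ?case unfolding comp_id wvec_id[OF t] using N(1) by (intro conjI exI[of _ 1]) auto
  next
    case (step \<tau> i)
    note i = B.block_rule[OF step(2,3)]
    have i1: "1 \<le> i" "i < n" using i by auto
    have p: "t \<circ> \<tau> \<in> paths n" and p1: "t \<circ> (\<tau> \<circ> adj i) \<in> paths n"
      using B.C_permutes(3) step(1,5) by blast+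
    have c: "content (t (\<tau> (Suc i))) < content (t (\<tau> i))" using B.C_descent_iff(1)[OF step(1-3)] step(4) by blast
    have M1: "M (t \<circ> (\<tau> \<circ> adj i)) = M (t \<circ> \<tau>) + (int (\<beta> (Suc i)) - int (\<beta> i)) * (content (t (\<tau> i)) - content (t (\<tau> (Suc i))))"
      using weight_adj[OF i1, of \<beta> "t \<circ> \<tau>"] by (simp add: comp_assoc)
    have nid: "\<tau> \<noteq> id" using step(4) by auto
    show ?case
    proof (cases "i = k")
      case True
      \<comment> \<open>A descent at \<open>k\<close> strictly lowers \<open>M\<close>, so the
        projector itself is in \<open>N\<close> and the multiple is 0.\<close>
      then have "M (t \<circ> \<tau>) < M (t \<circ> (\<tau> \<circ> adj i))" using M1 c \<beta>[OF i1] k by simp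
      then have lt: "M (t \<circ> \<tau>) < M t" using step(6) by linarith
      then have "proj n (t \<circ> \<tau>) - 0 *\<^sub>R wvec n t \<tau> \<in> N"
        unfolding scaleR_zero_left diff_zero by (rule IH[OF p])
      then show ?thesis
        by (intro conjI exI[of _ "0::real"] impI order_refl less_imp_le[OF lt]) (use nid in blast)
    next
      case False
      then have iS: "i \<notin> S" using S step(2,3) by blast
      then have M2: "M (t \<circ> (\<tau> \<circ> adj i)) = M (t \<circ> \<tau>)" using M1 \<beta>[OF i1] by simp
      obtain h where h: "h \<ge> 0" "proj n (t \<circ> (\<tau> \<circ> adj i)) - h *\<^sub>R wvec n t (\<tau> \<circ> adj i) \<in> N"
        using step(6) by blast
      define P where "P = proj n (t \<circ> \<tau>)"
      define r where "r = axial (t \<circ> \<tau>) i"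
      have r: "r < 0" using c by (simp add: r_def axial_def cnt_def)
      have "P * s i \<in> A" using A(3)[OF pA A(5)[OF i1]] by (simp add: P_def)
      from N(4)[OF this h(2)] have 1: "P * s i * proj n (t \<circ> (\<tau> \<circ> adj i)) - h *\<^sub>R (P * s i * wvec n t (\<tau> \<circ> adj i)) \<in> N"
        by (simp only: right_diff_distrib mult_scaleR_right)
      have w: "P * s i * wvec n t (\<tau> \<circ> adj i) = wvec n t \<tau>"
        unfolding P_def by (rule wvec_adj_down(3)[OF t B.C_permutes(2)[OF step(1)] p i1 step(4), symmetric])
      have 2: "P * (s i - 1) \<in> N" unfolding P_def by (rule N(4)[OF pA N_s[OF i1 iS]])
      define W where "W = P * s i * proj n (t \<circ> (\<tau> \<circ> adj i))"
      have e: "P * s i = r *\<^sub>R P + W"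
        unfolding P_def r_def W_def using p1 by (subst proj_s[OF p i1]) (simp add: comp_assoc)
      \<comment> \<open>Modulo \<open>N\<close>, multiplying \<open>P\<close> by \<open>s i\<close>
        on the right leaves it unchanged, and the induction hypothesis replaces the shorter
        projector by \<open>h\<close> times its weight vector. Solving for \<open>P\<close> gives
        the factor \<open>h / (1 - r)\<close>, which is nonnegative because
        \<open>r < 0\<close>.\<close>
      have e2: "P * (s i - 1) - (W - h *\<^sub>R wvec n t \<tau>) = (r - 1) *\<^sub>R P + h *\<^sub>R wvec n t \<tau>"
        unfolding right_diff_distrib e by (simp add: scaleR_left_diff_distrib)
      have "(r - 1) *\<^sub>R P + h *\<^sub>R wvec n t \<tau> \<in> N"
        using N_diff[OF 2 1[unfolded w, folded W_def]] unfolding e2 .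
      from N(3)[OF this, of "1 / (r - 1)"] have "P + (h / (r - 1)) *\<^sub>R wvec n t \<tau> \<in> N"
        using r by (simp add: scaleR_right_distrib)
      moreover have "h / (r - 1) = - (h / (1 - r))" by (metis minus_diff_eq minus_divide_right)
      ultimately have 3: "P - (h / (1 - r)) *\<^sub>R wvec n t \<tau> \<in> N" by simp
      have 4: "M (t \<circ> \<tau>) \<le> M t" using M2 step(6) by linarith
      have 5: "0 \<le> h / (1 - r)" using h(1) r by simp
      show ?thesis
        by (intro conjI exI[of _ "h / (1 - r)"] impI 4 5 3[unfolded P_def]) (use nid in blast)
    qed
  qed
  obtain h where h: "\<And>\<tau>. \<tau> \<in> B.C \<Longrightarrow> h \<tau> \<ge> 0" "h id = 1"
    "\<And>\<tau>. \<tau> \<in> B.C \<Longrightarrow> proj n (t \<circ> \<tau>) - h \<tau> *\<^sub>R wvec n t \<tau> \<in> N"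
  proof -
    have "\<forall>\<tau>\<in>B.C. \<exists>h\<ge>0. (\<tau> = id \<longrightarrow> h = 1) \<and> proj n (t \<circ> \<tau>) - h *\<^sub>R wvec n t \<tau> \<in> N" using red by blast
    then obtain h where "\<forall>\<tau>\<in>B.C. h \<tau> \<ge> 0 \<and> (\<tau> = id \<longrightarrow> h \<tau> = 1) \<and> proj n (t \<circ> \<tau>) - h \<tau> *\<^sub>R wvec n t \<tau> \<in> N"
      by metis
    then show ?thesis using that B.id_in_C by blast
  qed
  obtain h' where h': "\<And>\<tau>. \<tau> \<in> B.C \<Longrightarrow> h' \<tau> > 0"
    "\<And>\<tau>. \<tau> \<in> B.C \<Longrightarrow> sym_sum a b * wvec n t \<tau> = h' \<tau> *\<^sub>R (sym_sum a b * proj n t)"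
    using B.sym_sum_wvec by metis
  obtain \<kappa> where \<kappa>: "\<kappa> > 0" "proj n t * sym_sum a b * proj n t = \<kappa> *\<^sub>R proj n t"
    using B.proj_sym_sum_proj by blast
  define Z where "Z = proj n t * sym_sum a b"
  have ZA: "Z \<in> A" unfolding Z_def using ab by (intro A(3) pA A_sym_sum)
  have Zw: "Z * wvec n t \<tau> = (h' \<tau> * \<kappa>) *\<^sub>R proj n t" if "\<tau> \<in> B.C" for \<tau>
    unfolding Z_def mult.assoc h'(2)[OF that] using \<kappa>(2) by (simp add: mult.assoc)
  have "Z \<in> N" unfolding Z_def by (rule N(4)[OF pA Y])
  moreover have "Z = (\<Sum>\<tau>\<in>B.C. Z * proj n (t \<circ> \<tau>))" unfolding Z_def by (rule B.proj_sym_sum)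
  moreover have "(\<Sum>\<tau>\<in>B.C. Z * (proj n (t \<circ> \<tau>) - h \<tau> *\<^sub>R wvec n t \<tau>)) \<in> N"
    by (rule N_sum) (rule N(4)[OF ZA h(3)])
  moreover have "(\<Sum>\<tau>\<in>B.C. Z * (proj n (t \<circ> \<tau>) - h \<tau> *\<^sub>R wvec n t \<tau>)) =
      (\<Sum>\<tau>\<in>B.C. Z * proj n (t \<circ> \<tau>)) - (\<Sum>\<tau>\<in>B.C. (h \<tau> * (h' \<tau> * \<kappa>)) *\<^sub>R proj n t)"
    unfolding sum_subtractf[symmetric] by (intro sum.cong refl) (simp add: right_diff_distrib Zw)
  ultimately have "(\<Sum>\<tau>\<in>B.C. (h \<tau> * (h' \<tau> * \<kappa>)) *\<^sub>R proj n t) \<in> N"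
    using N_diff[of Z "\<Sum>\<tau>\<in>B.C. Z * (proj n (t \<circ> \<tau>) - h \<tau> *\<^sub>R wvec n t \<tau>)"] by simp
  then have 1: "(\<Sum>\<tau>\<in>B.C. h \<tau> * (h' \<tau> * \<kappa>)) *\<^sub>R proj n t \<in> N" by (simp add: scaleR_left.sum)
  \<comment> \<open>The identity contributes \<open>h' id * \<kappa>\<close>, as
    \<open>h id = 1\<close>; the signs ensure that the other terms cannot cancel it.\<close>
  have "(\<Sum>\<tau>\<in>B.C. h \<tau> * (h' \<tau> * \<kappa>)) > 0"
    using B.finite_C B.id_in_C
  proof (rule sum_pos2)
    show "0 < h id * (h' id * \<kappa>)" using h(2) h'(1)[OF B.id_in_C] \<kappa>(1) by simp
    show "0 \<le> h \<tau> * (h' \<tau> * \<kappa>)" if "\<tau> \<in> B.C" for \<tau>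
      using h(1)[OF that] h'(1)[OF that] \<kappa>(1) by (intro mult_nonneg_nonneg) auto
  qed
  with N_scale_cancel[OF 1] show ?thesis by simp
qed

lemma proj_in_N:
  assumes "t \<in> paths n"
  shows "proj n t \<in> N"
proof (rule ccontr)
  assume no: "proj n t \<notin> N"
  define Z where "Z = {t \<in> paths n. proj n t \<notin> N}"
  have fin: "finite Z" "Z \<noteq> {}" using assms no by (auto simp: Z_def finite_paths)
  define Z' where "Z' = {t \<in> Z. M t = Min (M ` Z)}"
  have "Min (M ` Z) \<in> M ` Z" using fin by (intro Min_in) auto
  then have fin': "finite Z'" "Z' \<noteq> {}" using fin(1) by (auto simp: Z'_def)
  then have "Max (M' ` Z') \<in> M' ` Z'" by (intro Max_in) auto
  then obtain u where u: "u \<in> Z'" "M' u = Max (M' ` Z')" by auto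
  have up: "u \<in> paths n" "proj n u \<notin> N" "M u = Min (M ` Z)" using u by (auto simp: Z'_def Z_def)
  have IH1: "proj n v \<in> N" if "v \<in> paths n" "M v < M u" for v
    using that up(3) Min_le[of "M ` Z" "M v"] fin(1) by (fastforce simp: Z_def)
  have IH2: "proj n v \<in> N" if "v \<in> paths n" "M v = M u" "M' u < M' v" for v
  proof (rule ccontr)
    assume "proj n v \<notin> N"
    then have "v \<in> Z'" using that up(3) by (simp add: Z'_def Z_def)
    then have "M' v \<le> Max (M' ` Z')" using fin'(1) by simp
    with that(3) u(2) show False by simp
  qed
  note adj = content_adjacent_neq[OF paths_is_path[OF up(1)]]
  consider (extra) i where "1 \<le> i" "i < n" "i \<notin> S" "content (u (Suc i)) < content (u i)"
    | (missing) k where "k \<in> S" "1 \<le> k" "k < n" "content (u k) < content (u (Suc k))"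
        "\<And>i. 1 \<le> i \<Longrightarrow> i < n \<Longrightarrow> i \<notin> S \<Longrightarrow> content (u i) < content (u (Suc i))"
    | (equal) "\<And>i. 1 \<le> i \<Longrightarrow> i < n \<Longrightarrow> i \<in> S \<longleftrightarrow> content (u (Suc i)) < content (u i)"
    using adj by (metis linorder_neqE_linordered_idom)
  then have "proj n u \<in> N"
  proof cases
    case extra
    then show ?thesis using proj_extra_descent[OF up(1) extra] IH2 by blast
  next
    case missing
    show ?thesis by (rule proj_missing_descent[OF up(1) missing(1-3)]) (use missing IH1 in auto)
  next
    case equal
    then show ?thesis by (rule N_proj[OF up(1)])
  qed
  with up(2) show False by simp
qed

text \<open>For the ideal of elements that send a monomial into a submodule this says that the
  monomial itself lies in the submodule.\<close>

lemma one_in_N: "1 \<in> N"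
  using N_sum[of "paths n" "proj n", OF proj_in_N] by (simp add: sum_proj)

end

section \<open>The number of pairs of paths of the same shape\<close>

definition num_paths :: "nat \<Rightarrow> box set \<Rightarrow> nat" where
  "num_paths n D = card {t \<in> paths n. t ` {1..n} = D}"

lemma finite_inner_corners: "young_diagram D \<Longrightarrow> finite (inner_corners D)"
  using young_diagram_finite by (auto simp: inner_corners_def)

lemma insert_outer_inner: "b \<in> outer_corners D \<Longrightarrow> young_diagram D \<Longrightarrow> b \<in> inner_corners (insert b D)"
  using inner_corner_iff_outer[OF young_diagram_insert, of b D b] outer_corner_not_mem[of b D] by simp

text \<open>Every inner corner has exactly one outer corner in the next row below it.\<close>

lemma card_outer_corners:
  assumes D: "young_diagram D"
  shows "card (outer_corners D) = Suc (card (inner_corners D))"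
proof -
  define len where "len r = (LEAST c. (r, c) \<notin> D)" for r
  have ex: "\<exists>c. (r, c) \<notin> D" for r
  proof -
    have "finite (snd ` D)" using young_diagram_finite[OF D] by simp
    then obtain c where "c \<notin> snd ` D" using ex_new_if_finite[OF infinite_UNIV_nat] by blast
    then show ?thesis by (force simp: image_iff)
  qed
  have len: "(r, c) \<in> D \<longleftrightarrow> c < len r" for r c
    using LeastI_ex[OF ex, of r] not_less_Least[of c "\<lambda>c. (r, c) \<notin> D"] young_diagram_down[OF D, of r c r "len r"]
    unfolding len_def by (meson le_refl not_less)
  have mono: "len (Suc r) \<le> len r" for r
    using len[of "Suc r" "len r"] len[of r "len r"] young_diagram_down[OF D, of "Suc r" "len r" r "len r"] by fastforce
  have outer: "outer_corners D = insert (0, len 0) ((\<lambda>r. (Suc r, len (Suc r))) ` {r. len (Suc r) < len r})"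
  proof (intro Set.set_eqI)
    fix x :: box
    obtain r c where x: "x = (r, c)" by (cases x)
    show "x \<in> outer_corners D \<longleftrightarrow> x \<in> insert (0, len 0) ((\<lambda>r. (Suc r, len (Suc r))) ` {r. len (Suc r) < len r})"
      unfolding x outer_corners_iff[OF D] len by (cases r; cases c) auto
  qed
  have inner: "inner_corners D = (\<lambda>r. (r, len r - 1)) ` {r. len (Suc r) < len r}"
  proof (intro Set.set_eqI)
    fix x :: box
    obtain r c where x: "x = (r, c)" by (cases x)
    show "x \<in> inner_corners D \<longleftrightarrow> x \<in> (\<lambda>r. (r, len r - 1)) ` {r. len (Suc r) < len r}"
      unfolding x inner_corners_def using mono[of r] by (auto simp: len right_def below_def)
  qed
  have inj: "inj_on (\<lambda>r. (r, len r - 1)) {r. len (Suc r) < len r}" by (auto intro: inj_onI)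
  have fin: "finite {r. len (Suc r) < len r}"
    using finite_inner_corners[OF D] unfolding inner by (rule finite_imageD[OF _ inj])
  show ?thesis unfolding outer inner using fin
    by (subst card_insert_disjoint) (auto simp: card_image inj_on_def)
qed

lemma bij_betw_Collect: "bij_betw f A B \<Longrightarrow> bij_betw f {x \<in> A. P (f x)} {y \<in> B. P y}"
  by (auto simp: bij_betw_def inj_on_def)

lemma num_paths_Suc:
  assumes D: "young_diagram D"
  shows "num_paths (Suc n) D = (\<Sum>b\<in>inner_corners D. num_paths n (D - {b}))"
proof -
  define E where "E b = {t \<in> paths n. t ` {1..n} = D - {b}}" for b
  let ?f = "\<lambda>(t, b). t(Suc n := b)" and ?A = "SIGMA t:paths n. outer_corners (t ` {1..n})"
  have img: "?f x ` {1..Suc n} = insert (snd x) (fst x ` {1..n})" for x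
    by (simp only: split_def image_Suc_interval image_upd_Suc fun_upd_same)
  have "bij_betw ?f {x \<in> ?A. ?f x ` {1..Suc n} = D} {t \<in> paths (Suc n). t ` {1..Suc n} = D}"
    by (rule bij_betw_Collect[OF paths_Suc])
  then have "bij_betw ?f {x \<in> ?A. insert (snd x) (fst x ` {1..n}) = D} {t \<in> paths (Suc n). t ` {1..Suc n} = D}"
    unfolding img .
  then have "num_paths (Suc n) D = card {x \<in> (SIGMA t:paths n. outer_corners (t ` {1..n})). insert (snd x) (fst x ` {1..n}) = D}"
    unfolding num_paths_def by (rule bij_betw_same_card[symmetric])
  also have "{x \<in> (SIGMA t:paths n. outer_corners (t ` {1..n})). insert (snd x) (fst x ` {1..n}) = D} =
      (\<lambda>(b, t). (t, b)) ` (SIGMA b:inner_corners D. E b)" (is "?L = ?R")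
  proof (intro Set.set_eqI iffI)
    fix x assume "x \<in> ?L"
    then obtain t b where x: "x = (t, b)" "t \<in> paths n" "b \<in> outer_corners (t ` {1..n})" "insert b (t ` {1..n}) = D"
      by auto
    have "b \<in> inner_corners D"
      using insert_outer_inner[OF x(3)] x(4) is_path_young[of n t] x(2) by (simp add: paths_def)
    moreover have "t ` {1..n} = D - {b}" using x outer_corner_not_mem[OF x(3)] by blast
    ultimately show "x \<in> ?R" using x by (auto simp: E_def)
  next
    fix x assume "x \<in> ?R"
    then obtain t b where x: "x = (t, b)" "b \<in> inner_corners D" "t \<in> paths n" "t ` {1..n} = D - {b}"
      by (auto simp: E_def)
    then show "x \<in> ?L" using young_diagram_remove[OF D x(2)] by (auto simp: inner_corners_def)
  qed
  also have "card \<dots> = card (SIGMA b:inner_corners D. E b)" by (rule card_image) (auto intro: inj_onI)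
  also have "\<dots> = (\<Sum>b\<in>inner_corners D. card (E b))"
    using finite_inner_corners[OF D] by (intro card_SigmaI) (auto simp: E_def finite_paths)
  finally show ?thesis by (simp only: E_def num_paths_def)
qed

lemma young_diagram_Int: "young_diagram D \<Longrightarrow> young_diagram E \<Longrightarrow> young_diagram (D \<inter> E)"
  unfolding young_diagram_def by (auto simp: Ball_def)

lemma young_diagram_Un: "young_diagram D \<Longrightarrow> young_diagram E \<Longrightarrow> young_diagram (D \<union> E)"
  unfolding young_diagram_def by (auto simp: Ball_def)

text \<open>Intersections and unions of Young diagrams are Young diagrams. Adding and removing a box
  can thus be exchanged, unless it is the same box.\<close>

lemma corner_swap:
  assumes D: "young_diagram D" and "b \<noteq> c"
  shows "b \<in> outer_corners D \<and> c \<in> inner_corners (insert b D) \<longleftrightarrow>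
    c \<in> inner_corners D \<and> b \<in> outer_corners (D - {c})"
proof
  assume a: "b \<in> outer_corners D \<and> c \<in> inner_corners (insert b D)"
  have y: "young_diagram (insert b D)" using a young_diagram_insert by blast
  have c: "c \<in> D" "young_diagram (insert b D - {c})"
    using a inner_corner_iff_outer[OF y] assms(2) by auto
  have "(insert b D - {c}) \<inter> D = D - {c}" by auto
  then have "young_diagram (D - {c})" using young_diagram_Int[OF c(2) D] by simp
  then have "c \<in> inner_corners D" using inner_corner_iff_outer[OF D] c by blast
  moreover have "insert b (D - {c}) = insert b D - {c}" using assms(2) by auto
  ultimately show "c \<in> inner_corners D \<and> b \<in> outer_corners (D - {c})"
    using c a by (simp add: outer_corners_def)
next
  assume a: "c \<in> inner_corners D \<and> b \<in> outer_corners (D - {c})"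
  have c: "c \<in> D" using a by (simp add: inner_corners_def)
  have i: "insert b (D - {c}) = insert b D - {c}" using assms(2) by auto
  have y1: "young_diagram (insert b D - {c})" using a i by (simp add: outer_corners_def)
  have "insert b D = (insert b D - {c}) \<union> D" using c by auto
  then have y: "young_diagram (insert b D)" using young_diagram_Un[OF y1 D] by simp
  have "b \<notin> D" using a assms(2) by (auto simp: outer_corners_def)
  then show "b \<in> outer_corners D \<and> c \<in> inner_corners (insert b D)"
    using y inner_corner_iff_outer[OF y] c y1 by (auto simp: outer_corners_def)
qed

text \<open>Adding and then removing a box can be exchanged except for one extra copy of
  \<open>D\<close>, since a diagram has one more outer than inner corner. This commutation rule of
  Young's lattice gives the factor \<open>Suc n\<close> by induction.\<close>

lemma sum_num_paths_insert:
  assumes "young_diagram D"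
  shows "(\<Sum>b\<in>outer_corners D. num_paths (Suc n) (insert b D)) = Suc n * num_paths n D"
  using assms
proof (induction n arbitrary: D)
  case 0
  note D = 0
  have np0: "num_paths 0 E = (if E = {} then 1 else 0)" for E
    unfolding num_paths_def by (auto simp: paths_0)
  have np1: "num_paths (Suc 0) (insert b D) = (if D = {} then 1 else 0)" if b: "b \<in> outer_corners D" for b
  proof -
    have y: "young_diagram (insert b D)" using b by (rule young_diagram_insert)
    have "num_paths (Suc 0) (insert b D) = (\<Sum>c\<in>inner_corners (insert b D). if insert b D - {c} = {} then 1 else 0)"
      unfolding num_paths_Suc[OF y] np0 ..
    also have "\<dots> = (\<Sum>c\<in>inner_corners (insert b D). if c = b then if D = {} then 1 else 0 else 0)"
      using outer_corner_not_mem[OF b] by (intro sum.cong refl) auto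
    also have "\<dots> = (if D = {} then 1 else 0)"
      using finite_inner_corners[OF y] insert_outer_inner[OF b D] by simp
    finally show ?thesis .
  qed
  have "(\<Sum>b\<in>outer_corners D. num_paths (Suc 0) (insert b D)) = (\<Sum>b\<in>outer_corners D. if D = {} then 1 else 0)"
    by (intro sum.cong refl np1)
  then show ?case by (cases "D = {}") (simp_all add: np0)
next
  case (Suc n)
  note D = Suc.prems
  let ?e = "num_paths (Suc n)"
  have fo: "finite (outer_corners D)" and fi: "finite (inner_corners D)"
    using D by (simp_all add: finite_outer_corners finite_inner_corners)
  have 1: "num_paths (Suc (Suc n)) (insert b D) = ?e D + (\<Sum>c\<in>inner_corners (insert b D) - {b}. ?e (insert b D - {c}))"
    if b: "b \<in> outer_corners D" for b
  proof -
    have y: "young_diagram (insert b D)" using b by (rule young_diagram_insert)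
    have "insert b D - {b} = D" using outer_corner_not_mem[OF b] by auto
    then show ?thesis unfolding num_paths_Suc[OF y, of "Suc n"]
      using sum.remove[OF finite_inner_corners[OF y] insert_outer_inner[OF b D], of "\<lambda>c. ?e (insert b D - {c})"] by simp
  qed
  have 2: "(\<Sum>b\<in>outer_corners D. \<Sum>c\<in>inner_corners (insert b D) - {b}. ?e (insert b D - {c})) =
      (\<Sum>c\<in>inner_corners D. \<Sum>b\<in>outer_corners (D - {c}) - {c}. ?e (insert b (D - {c})))"
  proof -
    have "(\<Sum>b\<in>outer_corners D. \<Sum>c\<in>inner_corners (insert b D) - {b}. ?e (insert b D - {c})) =
        (\<Sum>(b, c)\<in>(SIGMA b:outer_corners D. inner_corners (insert b D) - {b}). ?e (insert b D - {c}))"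
      using fo finite_inner_corners[OF young_diagram_insert] by (intro sum.Sigma) auto
    also have "\<dots> = (\<Sum>(c, b)\<in>(SIGMA c:inner_corners D. outer_corners (D - {c}) - {c}). ?e (insert b (D - {c})))"
    proof (rule sum.reindex_bij_witness[of _ "\<lambda>(c, b). (b, c)" "\<lambda>(b, c). (c, b)"])
      fix x assume x: "x \<in> (SIGMA b:outer_corners D. inner_corners (insert b D) - {b})"
      obtain b c where [simp]: "x = (b, c)" by (cases x)
      have bc: "b \<noteq> c" using x by auto
      then show "(case x of (b, c) \<Rightarrow> (c, b)) \<in> (SIGMA c:inner_corners D. outer_corners (D - {c}) - {c})"
        using corner_swap[OF D bc] x by simp
      have "insert b (D - {c}) = insert b D - {c}" using bc by auto
      then show "(case case x of (b, c) \<Rightarrow> (c, b) of (c, b) \<Rightarrow> ?e (insert b (D - {c}))) = (case x of (b, c) \<Rightarrow> ?e (insert b D - {c}))"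
        by simp
    next
      fix x assume x: "x \<in> (SIGMA c:inner_corners D. outer_corners (D - {c}) - {c})"
      obtain c b where [simp]: "x = (c, b)" by (cases x)
      have bc: "b \<noteq> c" using x by auto
      then show "(case x of (c, b) \<Rightarrow> (b, c)) \<in> (SIGMA b:outer_corners D. inner_corners (insert b D) - {b})"
        using corner_swap[OF D bc] x by simp
    qed auto
    also have "\<dots> = (\<Sum>c\<in>inner_corners D. \<Sum>b\<in>outer_corners (D - {c}) - {c}. ?e (insert b (D - {c})))"
      using fi finite_outer_corners[OF young_diagram_remove(1)[OF D]] by (intro sum.Sigma[symmetric]) auto
    finally show ?thesis .
  qed
  have 3: "?e D + (\<Sum>b\<in>outer_corners (D - {c}) - {c}. ?e (insert b (D - {c}))) = Suc n * num_paths n (D - {c})"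
    if c: "c \<in> inner_corners D" for c
  proof -
    note y = young_diagram_remove[OF D c]
    have "insert c (D - {c}) = D" using c by (auto simp: inner_corners_def)
    then show ?thesis using Suc.IH[OF y(1)]
      sum.remove[OF finite_outer_corners[OF y(1)] y(2), of "\<lambda>b. ?e (insert b (D - {c}))"] by simp
  qed
  have "(\<Sum>b\<in>outer_corners D. num_paths (Suc (Suc n)) (insert b D)) =
      card (outer_corners D) * ?e D + (\<Sum>c\<in>inner_corners D. \<Sum>b\<in>outer_corners (D - {c}) - {c}. ?e (insert b (D - {c})))"
    by (simp add: 1 sum.distrib 2[symmetric] del: One_nat_def)
  \<comment> \<open>One copy of \<open>?e D\<close> goes to each inner corner and completes the sum
    of the induction hypothesis there; the surplus outer corner leaves one copy over.\<close>
  also have "\<dots> = ?e D + (\<Sum>c\<in>inner_corners D. ?e D + (\<Sum>b\<in>outer_corners (D - {c}) - {c}. ?e (insert b (D - {c}))))"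
    by (simp add: card_outer_corners[OF D] sum.distrib)
  also have "\<dots> = ?e D + Suc n * ?e D"
    by (simp add: 3 sum_distrib_left[symmetric] num_paths_Suc[OF D, symmetric] del: mult_Suc)
  finally show ?case by simp
qed

text \<open>The left side is the sum of the squares of the numbers of standard tableaux, over all
  shapes of size \<open>n\<close>.\<close>

lemma sum_num_paths: "(\<Sum>t\<in>paths n. num_paths n (t ` {1..n})) = fact n"
proof (induction n)
  case 0
  show ?case by (simp add: paths_0 num_paths_def)
next
  case (Suc n)
  have "(\<Sum>t\<in>paths (Suc n). num_paths (Suc n) (t ` {1..Suc n})) =
      (\<Sum>x\<in>(SIGMA t:paths n. outer_corners (t ` {1..n})). num_paths (Suc n) (((\<lambda>(t, b). t(Suc n := b)) x) ` {1..Suc n}))"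
    by (rule sum.reindex_bij_betw[OF paths_Suc, symmetric])
  also have "\<dots> = (\<Sum>(t, b)\<in>(SIGMA t:paths n. outer_corners (t ` {1..n})). num_paths (Suc n) (insert b (t ` {1..n})))"
    by (intro sum.cong refl) (auto simp only: split_def image_Suc_interval image_upd_Suc fun_upd_same)
  also have "\<dots> = (\<Sum>t\<in>paths n. \<Sum>b\<in>outer_corners (t ` {1..n}). num_paths (Suc n) (insert b (t ` {1..n})))"
    using finite_outer_corners[OF paths_young] by (subst sum.Sigma) (auto simp: finite_paths)
  also have "\<dots> = (\<Sum>t\<in>paths n. Suc n * num_paths n (t ` {1..n}))"
    by (intro sum.cong refl sum_num_paths_insert paths_young)
  also have "\<dots> = fact (Suc n)" using Suc by (simp only: sum_distrib_left[symmetric] fact_Suc of_nat_id)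
  finally show ?case .
qed

lemma card_same_shape_paths: "card {(t, u). t \<in> paths n \<and> u \<in> paths n \<and> t ` {1..n} = u ` {1..n}} = fact n"
proof -
  have "{(t, u). t \<in> paths n \<and> u \<in> paths n \<and> t ` {1..n} = u ` {1..n}} =
      (SIGMA t:paths n. {u \<in> paths n. u ` {1..n} = t ` {1..n}})" by auto
  then have "card {(t, u). t \<in> paths n \<and> u \<in> paths n \<and> t ` {1..n} = u ` {1..n}} =
      (\<Sum>t\<in>paths n. card {u \<in> paths n. u ` {1..n} = t ` {1..n}})"
    by (simp only:) (intro card_SigmaI, auto simp: finite_paths)
  then show ?thesis using sum_num_paths[of n] by (simp only: num_paths_def)
qed

section \<open>Polynomials\<close>

text \<open>The additive extension of a map on single terms. Both the evaluation of polynomials and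
  the action of the group algebra are of this form.\<close>

definition pm_lift :: "('k \<Rightarrow> 'c \<Rightarrow> 'b) \<Rightarrow> ('k \<Rightarrow>\<^sub>0 'c::zero) \<Rightarrow> 'b::comm_monoid_add" where
  "pm_lift h p = (\<Sum>k\<in>Poly_Mapping.keys p. h k (Poly_Mapping.lookup p k))"

lemma pm_lift_superset:
  assumes "\<And>k. h k 0 = 0" "finite K" "Poly_Mapping.keys p \<subseteq> K"
  shows "pm_lift h p = (\<Sum>k\<in>K. h k (Poly_Mapping.lookup p k))"
  unfolding pm_lift_def using assms
  by (intro sum.mono_neutral_left) (auto simp: not_in_keys_iff_lookup_eq_zero)

lemma pm_lift_0 [simp]: "pm_lift h 0 = 0"
  by (simp add: pm_lift_def)

lemma pm_lift_single: "(\<And>k. h k 0 = 0) \<Longrightarrow> pm_lift h (Poly_Mapping.single k c) = h k c"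
  by (simp add: pm_lift_def lookup_single)

lemma pm_lift_add:
  fixes p q :: "'k \<Rightarrow>\<^sub>0 'c::monoid_add"
  assumes h: "\<And>k. h k 0 = 0" "\<And>k a b. h k (a + b) = h k a + h k b"
  shows "pm_lift h (p + q) = pm_lift h p + pm_lift h q"
proof -
  let ?K = "Poly_Mapping.keys p \<union> Poly_Mapping.keys q"
  have "pm_lift h (p + q) = (\<Sum>k\<in>?K. h k (Poly_Mapping.lookup (p + q) k))"
    using Poly_Mapping.keys_add[of p q] by (intro pm_lift_superset h) auto
  also have "\<dots> = (\<Sum>k\<in>?K. h k (Poly_Mapping.lookup p k)) + (\<Sum>k\<in>?K. h k (Poly_Mapping.lookup q k))"
    by (simp add: lookup_add h(2) sum.distrib)
  also have "\<dots> = pm_lift h p + pm_lift h q"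
    using pm_lift_superset[of h ?K p] pm_lift_superset[of h ?K q] h(1) by simp
  finally show ?thesis .
qed

lemma pm_lift_sum:
  fixes p :: "'i \<Rightarrow> 'k \<Rightarrow>\<^sub>0 'c::comm_monoid_add"
  assumes h: "\<And>k. h k 0 = 0" "\<And>k a b. h k (a + b) = h k a + h k b"
  shows "pm_lift h (\<Sum>i\<in>I. p i) = (\<Sum>i\<in>I. pm_lift h (p i))"
  by (induction I rule: infinite_finite_induct) (simp_all add: pm_lift_add[OF h])

lemma poly_mapping_expand: "p = (\<Sum>k\<in>Poly_Mapping.keys p. Poly_Mapping.single k (Poly_Mapping.lookup p k))"
  for p :: "'k \<Rightarrow>\<^sub>0 'c::comm_monoid_add"
proof (rule poly_mapping_eqI)
  fix k
  have "Poly_Mapping.lookup (\<Sum>k\<in>Poly_Mapping.keys p. Poly_Mapping.single k (Poly_Mapping.lookup p k)) k =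
      (\<Sum>l\<in>Poly_Mapping.keys p. if l = k then Poly_Mapping.lookup p k else 0)"
    by (simp add: lookup_sum lookup_single when_def cong: sum.cong)
  then show "Poly_Mapping.lookup p k = Poly_Mapping.lookup
      (\<Sum>k\<in>Poly_Mapping.keys p. Poly_Mapping.single k (Poly_Mapping.lookup p k)) k"
    by (simp add: in_keys_iff)
qed

lemma pm_lift_mult:
  fixes p q :: "'k::monoid_add \<Rightarrow>\<^sub>0 'c::semiring_0" and h :: "'k \<Rightarrow> 'c \<Rightarrow> 'b::semiring_0"
  assumes h: "\<And>k. h k 0 = 0" "\<And>k a b. h k (a + b) = h k a + h k b"
    and m: "\<And>k l a b. h (k + l) (a * b) = h k a * h l b"
  shows "pm_lift h (p * q) = pm_lift h p * pm_lift h q"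
proof -
  have "p * q = (\<Sum>k\<in>Poly_Mapping.keys p. \<Sum>l\<in>Poly_Mapping.keys q.
      Poly_Mapping.single (k + l) (Poly_Mapping.lookup p k * Poly_Mapping.lookup q l))"
    by (subst poly_mapping_expand[of p], subst poly_mapping_expand[of q])
      (simp add: sum_product mult_single)
  then show ?thesis
    by (simp add: pm_lift_sum[OF h] pm_lift_single h m sum_product pm_lift_def[of h p] pm_lift_def[of h q])
qed

definition pmon :: "(nat \<Rightarrow> 'b::comm_semiring_1) \<Rightarrow> (nat \<Rightarrow>\<^sub>0 nat) \<Rightarrow> 'b" where
  "pmon x m = (\<Prod>i\<in>Poly_Mapping.keys m. x i ^ Poly_Mapping.lookup m i)"

lemma pmon_superset: "finite K \<Longrightarrow> Poly_Mapping.keys m \<subseteq> K \<Longrightarrow> pmon x m = (\<Prod>i\<in>K. x i ^ Poly_Mapping.lookup m i)"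
  unfolding pmon_def by (intro prod.mono_neutral_left) (auto simp: not_in_keys_iff_lookup_eq_zero)

lemma pmon_0 [simp]: "pmon x 0 = 1"
  by (simp add: pmon_def)

lemma pmon_add: "pmon x (m + m') = pmon x m * pmon x m'"
proof -
  let ?K = "Poly_Mapping.keys m \<union> Poly_Mapping.keys m'"
  have "pmon x (m + m') = (\<Prod>i\<in>?K. x i ^ Poly_Mapping.lookup (m + m') i)"
    using Poly_Mapping.keys_add[of m m'] by (intro pmon_superset) auto
  also have "\<dots> = pmon x m * pmon x m'"
    using pmon_superset[of ?K m x] pmon_superset[of ?K m' x] by (simp add: lookup_add power_add prod.distrib)
  finally show ?thesis .
qed

lemma pmon_single: "pmon x (Poly_Mapping.single i k) = x i ^ k"
  by (simp add: pmon_def lookup_single)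

text \<open>One notion of substitution serves the action of permutations, the value at the origin
  and the restriction to a line.\<close>

locale poly_eval =
  fixes h :: "complex \<Rightarrow> 'b::comm_ring_1" and x :: "nat \<Rightarrow> 'b"
  assumes h: "h 0 = 0" "h 1 = 1" "\<And>a b. h (a + b) = h a + h b" "\<And>a b. h (a * b) = h a * h b"
begin

definition eval :: "mpoly \<Rightarrow> 'b" where
  "eval = pm_lift (\<lambda>m c. h c * pmon x m)"

lemma eval_add: "eval (p + q) = eval p + eval q"
  unfolding eval_def by (rule pm_lift_add) (simp_all add: h algebra_simps)

lemma eval_mult: "eval (p * q) = eval p * eval q"
  unfolding eval_def by (rule pm_lift_mult) (simp_all add: h pmon_add algebra_simps)

lemma eval_single: "eval (Poly_Mapping.single m c) = h c * pmon x m"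
  unfolding eval_def by (rule pm_lift_single) (simp add: h)

lemma eval_const: "eval (const c) = h c"
  by (simp add: const_def eval_single)

lemma eval_var: "eval (var i) = x i"
  by (simp add: var_def eval_single pmon_single h)

lemma eval_0: "eval 0 = 0"
  by (simp add: eval_def)

lemma eval_1: "eval 1 = 1"
  using eval_const[of 1] by (simp add: const_def h)

lemma eval_sum: "eval (\<Sum>i\<in>I. p i) = (\<Sum>i\<in>I. eval (p i))"
  by (induction I rule: infinite_finite_induct) (simp_all add: eval_add eval_0)

lemma eval_prod: "eval (\<Prod>i\<in>I. p i) = (\<Prod>i\<in>I. eval (p i))"
  by (induction I rule: infinite_finite_induct) (simp_all add: eval_mult eval_1)

lemma eval_power: "eval (p ^ k) = eval p ^ k"
  by (induction k) (simp_all add: eval_mult eval_1)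

lemma eval_pmon_var: "eval (pmon (\<lambda>i. var (\<sigma> i)) m) = pmon (\<lambda>i. x (\<sigma> i)) m"
  by (simp add: pmon_def eval_prod eval_power eval_var)

end

lemma const_simps: "const 0 = 0" "const 1 = 1" "const (a + b) = const a + const b" "const (a * b) = const a * const b"
  "const (- a) = - const a"
  by (simp_all add: const_def single_add mult_single single_uminus)

interpretation perm: poly_eval const "\<lambda>i. var (\<sigma> i)"
  rewrites "poly_eval.eval const (\<lambda>i. var (\<sigma> i)) = perm_act \<sigma>" for \<sigma>
proof -
  show "poly_eval const" by unfold_locales (simp_all add: const_simps)
  then interpret poly_eval const "\<lambda>i. var (\<sigma> i)" .
  show "eval = perm_act \<sigma>"
    by (rule ext) (simp add: eval_def pm_lift_def perm_act_def pmon_def)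
qed

lemma single_eq_pmon: "Poly_Mapping.single m c = const c * pmon var m"
proof -
  have pow: "var i ^ k = Poly_Mapping.single (Poly_Mapping.single i k) 1" for i k
    by (induction k) (simp_all add: var_def mult_single single_add[symmetric])
  have prd: "(\<Prod>i\<in>I. Poly_Mapping.single (f i) (1::complex)) = Poly_Mapping.single (\<Sum>i\<in>I. f i) 1"
    for I :: "nat set" and f :: "nat \<Rightarrow> nat \<Rightarrow>\<^sub>0 nat"
    by (induction I rule: infinite_finite_induct) (simp_all add: mult_single)
  have "pmon var m = Poly_Mapping.single m 1"
    unfolding pmon_def pow prd poly_mapping_expand[of m, symmetric] ..
  then show ?thesis by (simp add: const_def mult_single)
qed

lemma mpoly_expand: "p = (\<Sum>m\<in>Poly_Mapping.keys p. const (Poly_Mapping.lookup p m) * pmon var m)"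
  unfolding single_eq_pmon[symmetric] by (rule poly_mapping_expand)

lemma perm_act_comp: "perm_act (\<sigma> \<circ> \<tau>) p = perm_act \<sigma> (perm_act \<tau> p)"
proof -
  have "perm_act (\<sigma> \<circ> \<tau>) p = (\<Sum>m\<in>Poly_Mapping.keys p. const (Poly_Mapping.lookup p m) * pmon (\<lambda>i. var (\<sigma> (\<tau> i))) m)"
    by (simp add: perm_act_def pmon_def)
  also have "\<dots> = perm_act \<sigma> (\<Sum>m\<in>Poly_Mapping.keys p. const (Poly_Mapping.lookup p m) * pmon (\<lambda>i. var (\<tau> i)) m)"
    by (simp add: perm.eval_sum perm.eval_mult perm.eval_const perm.eval_pmon_var)
  finally show ?thesis by (simp add: perm_act_def pmon_def)
qed

lemma perm_act_id [simp]: "perm_act id p = p"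
  by (subst (2) mpoly_expand) (simp add: perm_act_def pmon_def)

section \<open>Polynomials in n variables and the coinvariant ideal\<close>

definition polys :: "nat \<Rightarrow> mpoly set" where "polys n = carrier (poly_algebra n)"

lemma polys_iff: "p \<in> polys n \<longleftrightarrow> (\<forall>m\<in>Poly_Mapping.keys p. Poly_Mapping.keys m \<subseteq> {1..n})"
  by (simp add: polys_def poly_algebra_def)

lemma polys_0 [simp]: "0 \<in> polys n" and polys_1 [simp]: "1 \<in> polys n" and polys_const [simp]: "const c \<in> polys n"
  by (simp_all add: polys_iff const_def)

lemma polys_add [intro]: "p \<in> polys n \<Longrightarrow> q \<in> polys n \<Longrightarrow> p + q \<in> polys n"
  unfolding polys_iff using Poly_Mapping.keys_add[of p q] by blast

lemma polys_mult [intro]: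
  assumes p: "p \<in> polys n" and q: "q \<in> polys n"
  shows "p * q \<in> polys n"
  unfolding polys_iff
proof
  fix m assume "m \<in> Poly_Mapping.keys (p * q)"
  then obtain a b where "m = a + b" "a \<in> Poly_Mapping.keys p" "b \<in> Poly_Mapping.keys q"
    using Poly_Mapping.keys_mult[of p q] by auto
  then show "Poly_Mapping.keys m \<subseteq> {1..n}"
    using p q Poly_Mapping.keys_add[of a b] unfolding polys_iff by blast
qed

lemma polys_uminus [intro]: "p \<in> polys n \<Longrightarrow> - p \<in> polys n"
  by (simp add: polys_iff)

lemma polys_sum [intro]: "(\<And>i. i \<in> I \<Longrightarrow> f i \<in> polys n) \<Longrightarrow> (\<Sum>i\<in>I. f i) \<in> polys n"
  by (induction I rule: infinite_finite_induct) auto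

lemma polys_prod [intro]: "(\<And>i. i \<in> I \<Longrightarrow> f i \<in> polys n) \<Longrightarrow> (\<Prod>i\<in>I. f i) \<in> polys n"
  by (induction I rule: infinite_finite_induct) auto

lemma polys_power [intro]: "p \<in> polys n \<Longrightarrow> p ^ k \<in> polys n"
  by (induction k) auto

lemma polys_var [intro]: "i \<in> {1..n} \<Longrightarrow> var i \<in> polys n"
  by (simp add: polys_iff var_def)

lemma polys_perm_act [intro]:
  assumes "p \<in> polys n" and \<sigma>: "\<sigma> permutes {1..n}"
  shows "perm_act \<sigma> p \<in> polys n"
  unfolding perm_act_def
proof (intro polys_sum polys_mult polys_const polys_prod polys_power polys_var)
  fix m i assume "m \<in> Poly_Mapping.keys p" "i \<in> Poly_Mapping.keys m"
  then have "i \<in> {1..n}" using assms(1) unfolding polys_iff by blast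
  then show "\<sigma> i \<in> {1..n}" using permutes_in_image[OF \<sigma>] by blast
qed

definition zmon :: "nat \<Rightarrow> (nat \<Rightarrow> nat) \<Rightarrow> mpoly" where
  "zmon n e = (\<Prod>i\<in>{1..n}. var i ^ e i)"

lemma polys_zmon [simp]: "zmon n e \<in> polys n"
  unfolding zmon_def by (intro polys_prod polys_power polys_var)

lemma zmon_cong: "(\<And>i. i \<in> {1..n} \<Longrightarrow> e i = f i) \<Longrightarrow> zmon n e = zmon n f"
  unfolding zmon_def by (intro prod.cong) auto

lemma zmon_mult: "zmon n e * zmon n f = zmon n (\<lambda>i. e i + f i)"
  by (simp add: zmon_def prod.distrib power_add)

lemma polys_expand:
  assumes "p \<in> polys n"
  shows "p = (\<Sum>m\<in>Poly_Mapping.keys p. const (Poly_Mapping.lookup p m) * zmon n (Poly_Mapping.lookup m))"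
  by (subst mpoly_expand, intro sum.cong refl arg_cong2[where f = "(*)"])
    (use assms in \<open>auto simp: polys_iff zmon_def intro!: pmon_superset\<close>)

lemma perm_act_zmon:
  assumes \<sigma>: "\<sigma> permutes {1..n}" and e: "\<And>i. i \<in> {1..n} \<Longrightarrow> e i = f (\<sigma> i)"
  shows "perm_act \<sigma> (zmon n e) = zmon n f"
proof -
  have "perm_act \<sigma> (zmon n e) = (\<Prod>i\<in>{1..n}. var (\<sigma> i) ^ f (\<sigma> i))"
    unfolding zmon_def perm.eval_prod perm.eval_power perm.eval_var by (intro prod.cong refl) (simp only: e)
  also have "\<dots> = zmon n f"
    unfolding zmon_def using prod.permute[OF \<sigma>, of "\<lambda>i. var i ^ f i"] by (simp add: comp_def)
  finally show ?thesis .
qed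

lemma poly_algebra_simps [simp]:
  "carrier (poly_algebra n) = polys n" "x \<oplus>\<^bsub>poly_algebra n\<^esub> y = x + y" "x \<otimes>\<^bsub>poly_algebra n\<^esub> y = x * y"
  "\<zero>\<^bsub>poly_algebra n\<^esub> = 0" "\<one>\<^bsub>poly_algebra n\<^esub> = 1" "c \<odot>\<^bsub>poly_algebra n\<^esub> p = const c * p"
  by (simp_all add: polys_def poly_algebra_def)

lemma cring_poly_algebra: "cring (poly_algebra n)"
proof (rule cringI)
  show "abelian_group (poly_algebra n)"
  proof (rule abelian_groupI)
    fix x assume "x \<in> carrier (poly_algebra n)"
    then show "\<exists>y\<in>carrier (poly_algebra n). y \<oplus>\<^bsub>poly_algebra n\<^esub> x = \<zero>\<^bsub>poly_algebra n\<^esub>"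
      by (intro bexI[of _ "- x"]) auto
  qed (auto simp: ac_simps)
  show "Group.comm_monoid (poly_algebra n)"
    by (rule comm_monoidI) (auto simp: ac_simps)
qed (simp add: distrib_right)

lemma coinv_ideal: "ideal (coinv_ideal n) (poly_algebra n)"
  unfolding coinv_ideal_def
  by (intro ring.genideal_ideal cring.axioms(1) cring_poly_algebra) (auto simp: symmetric_pos_def)

lemma coinv_ideal_minimal: "ideal J (poly_algebra n) \<Longrightarrow> symmetric_pos n \<subseteq> J \<Longrightarrow> coinv_ideal n \<subseteq> J"
  unfolding coinv_ideal_def by (intro ring.genideal_minimal cring.axioms(1) cring_poly_algebra)

lemma symmetric_pos_coinv_ideal: "symmetric_pos n \<subseteq> coinv_ideal n"
  unfolding coinv_ideal_def
  by (intro ring.genideal_self cring.axioms(1) cring_poly_algebra) (auto simp: symmetric_pos_def)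

lemma coinv_ideal_polys: "p \<in> coinv_ideal n \<Longrightarrow> p \<in> polys n"
  using additive_subgroup.a_subset[OF ideal.axioms(1)[OF coinv_ideal[of n]]] by auto

lemma coinv_ideal_add: "p \<in> coinv_ideal n \<Longrightarrow> q \<in> coinv_ideal n \<Longrightarrow> p + q \<in> coinv_ideal n"
  using additive_subgroup.a_closed[OF ideal.axioms(1)[OF coinv_ideal[of n]], of p q] by simp

lemma coinv_ideal_mult: "p \<in> polys n \<Longrightarrow> q \<in> coinv_ideal n \<Longrightarrow> p * q \<in> coinv_ideal n"
  using ideal.I_l_closed[OF coinv_ideal[of n], of q p] by simp

lemma coinv_ideal_0: "0 \<in> coinv_ideal n"
  using additive_subgroup.zero_closed[OF ideal.axioms(1)[OF coinv_ideal[of n]]] by simp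

lemma coinv_ideal_uminus: "p \<in> coinv_ideal n \<Longrightarrow> - p \<in> coinv_ideal n"
  using coinv_ideal_mult[OF polys_const[of "-1" n], of p] by (simp add: const_simps)

lemma coinv_ideal_diff: "p \<in> coinv_ideal n \<Longrightarrow> q \<in> coinv_ideal n \<Longrightarrow> p - q \<in> coinv_ideal n"
  using coinv_ideal_add[OF _ coinv_ideal_uminus, of p n q] by simp

lemma idealI_polys:
  assumes "J \<subseteq> polys n" "0 \<in> J" "\<And>p q. p \<in> J \<Longrightarrow> q \<in> J \<Longrightarrow> p + q \<in> J"
    "\<And>p q. p \<in> polys n \<Longrightarrow> q \<in> J \<Longrightarrow> p * q \<in> J"
  shows "ideal J (poly_algebra n)"
proof (rule idealI)
  show "Ring.ring (poly_algebra n)" by (rule cring.axioms(1)[OF cring_poly_algebra])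
  interpret R: cring "poly_algebra n" by (rule cring_poly_algebra)
  show "subgroup J (add_monoid (poly_algebra n))"
  proof (rule R.add.subgroupI)
    fix a assume a: "a \<in> J"
    have "\<ominus>\<^bsub>poly_algebra n\<^esub> a = - a"
      using a assms(1) by (intro R.minus_equality) auto
    moreover have "- a \<in> J" using assms(4)[OF polys_const[of "-1" n] a] by (simp add: const_simps)
    ultimately show "\<ominus>\<^bsub>poly_algebra n\<^esub> a \<in> J" by simp
  qed (use assms in auto)
next
  fix a x assume "a \<in> J" "x \<in> carrier (poly_algebra n)"
  then show "x \<otimes>\<^bsub>poly_algebra n\<^esub> a \<in> J" "a \<otimes>\<^bsub>poly_algebra n\<^esub> x \<in> J"
    using assms(4)[of x a] by (simp_all add: mult.commute[of a x])
qed

text \<open>The polynomials that \<open>\<sigma>\<close> maps into the ideal form an ideal that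
  contains the generators.\<close>

lemma coinv_ideal_perm_act:
  assumes \<sigma>: "\<sigma> permutes {1..n}" and p: "p \<in> coinv_ideal n"
  shows "perm_act \<sigma> p \<in> coinv_ideal n"
proof -
  have "coinv_ideal n \<subseteq> {p \<in> polys n. perm_act \<sigma> p \<in> coinv_ideal n}"
  proof (rule coinv_ideal_minimal[OF idealI_polys])
    show "symmetric_pos n \<subseteq> {p \<in> polys n. perm_act \<sigma> p \<in> coinv_ideal n}"
    proof
      fix x assume x: "x \<in> symmetric_pos n"
      then have "perm_act \<sigma> x = x" "x \<in> polys n" using \<sigma> by (simp_all add: symmetric_pos_def sym_group_def)
      then show "x \<in> {p \<in> polys n. perm_act \<sigma> p \<in> coinv_ideal n}" using x symmetric_pos_coinv_ideal[of n] by auto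
    qed
  next
    fix p q assume "p \<in> polys n" "q \<in> {p \<in> polys n. perm_act \<sigma> p \<in> coinv_ideal n}"
    then show "p * q \<in> {p \<in> polys n. perm_act \<sigma> p \<in> coinv_ideal n}"
      using coinv_ideal_mult[OF polys_perm_act[OF _ \<sigma>]] by (auto simp: perm.eval_mult)
  qed (auto simp: perm.eval_0 perm.eval_add coinv_ideal_0 intro: coinv_ideal_add)
  with p show ?thesis by blast
qed

section \<open>Reduction of monomials modulo the coinvariant ideal\<close>

definition elem_sym :: "nat \<Rightarrow> nat \<Rightarrow> mpoly" where
  "elem_sym n r = (\<Sum>B | B \<subseteq> {1..n} \<and> card B = r. \<Prod>i\<in>B. var i)"

lemma prod_var_zmon: "B \<subseteq> {1..n} \<Longrightarrow> (\<Prod>i\<in>B. var i) = zmon n (\<lambda>i. of_bool (i \<in> B))"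
  unfolding zmon_def by (subst prod.mono_neutral_cong_right[of "{1..n}" B _ var]) auto

lemma elem_sym_zmon: "elem_sym n r = (\<Sum>B | B \<subseteq> {1..n} \<and> card B = r. zmon n (\<lambda>i. of_bool (i \<in> B)))"
  unfolding elem_sym_def by (intro sum.cong refl prod_var_zmon) simp

lemma elem_sym_mult_zmon:
  "elem_sym n r * zmon n e = (\<Sum>B | B \<subseteq> {1..n} \<and> card B = r. zmon n (\<lambda>i. e i + of_bool (i \<in> B)))"
  unfolding elem_sym_zmon sum_distrib_right zmon_mult by (simp add: add.commute)

lemma perm_act_elem_sym:
  assumes \<sigma>: "\<sigma> permutes {1..n}"
  shows "perm_act \<sigma> (elem_sym n r) = elem_sym n r"
proof -
  have inj: "inj \<sigma>" using permutes_inj[OF \<sigma>] .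
  have "perm_act \<sigma> (elem_sym n r) = (\<Sum>B | B \<subseteq> {1..n} \<and> card B = r. \<Prod>i\<in>\<sigma> ` B. var i)"
    unfolding elem_sym_def perm.eval_sum perm.eval_prod perm.eval_var
    by (intro sum.cong refl) (simp add: prod.reindex inj_on_subset[OF inj])
  also have "\<dots> = elem_sym n r"
    unfolding elem_sym_def
  proof (rule sum.reindex_bij_witness[of _ "(`) (inv_into UNIV \<sigma>)" "(`) \<sigma>"])
    fix B assume B: "B \<in> {B. B \<subseteq> {1..n} \<and> card B = r}"
    have "\<sigma> ` B \<subseteq> {1..n}" using B permutes_image[OF \<sigma>] by blast
    then show "\<sigma> ` B \<in> {B. B \<subseteq> {1..n} \<and> card B = r}"
      using B card_image[OF inj_on_subset[OF inj subset_UNIV], of B] by simp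
    show "inv_into UNIV \<sigma> ` \<sigma> ` B = B" using inj by (rule image_inv_f_f)
    have inv: "inv_into UNIV \<sigma> permutes {1..n}" by (rule permutes_inv[OF \<sigma>])
    have "inv_into UNIV \<sigma> ` B \<subseteq> {1..n}" using B permutes_image[OF inv] by blast
    then show "inv_into UNIV \<sigma> ` B \<in> {B. B \<subseteq> {1..n} \<and> card B = r}"
      using B card_image[OF inj_on_subset[OF permutes_inj[OF inv] subset_UNIV], of B] by simp
    show "\<sigma> ` inv_into UNIV \<sigma> ` B = B" by (rule image_f_inv_f[OF permutes_surj[OF \<sigma>]])
  qed auto
  finally show ?thesis .
qed

lemma elem_sym_coinv_ideal:
  assumes "r \<ge> 1"
  shows "elem_sym n r \<in> coinv_ideal n"
proof -
  interpret z: poly_eval "\<lambda>c. c" "\<lambda>i. 0 :: complex" by unfold_locales simp_all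
  \<comment> \<open>The constant coefficient is the value at the origin, which is
    multiplicative.\<close>
  have l: "Poly_Mapping.lookup p 0 = z.eval p" for p
  proof -
    have "z.eval p = (\<Sum>m\<in>Poly_Mapping.keys p. if m = 0 then Poly_Mapping.lookup p 0 else 0)"
      unfolding z.eval_def pm_lift_def
    proof (intro sum.cong refl)
      fix m :: "nat \<Rightarrow>\<^sub>0 nat"
      have "pmon (\<lambda>i. 0 :: complex) m = of_bool (m = 0)"
      proof (cases "m = 0")
        case False
        then obtain i where "i \<in> Poly_Mapping.keys m" by (metis Poly_Mapping.keys_eq_empty ex_in_conv)
        then show ?thesis using False
          by (auto simp: pmon_def prod_zero_iff in_keys_iff intro!: bexI[of _ i])
      qed simp
      then show "Poly_Mapping.lookup p m * pmon (\<lambda>i. 0) m = (if m = 0 then Poly_Mapping.lookup p 0 else 0)"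
        by simp
    qed
    then show ?thesis by (simp add: in_keys_iff)
  qed
  have "elem_sym n r \<in> polys n"
    unfolding elem_sym_zmon by (intro polys_sum polys_zmon)
  moreover have "z.eval (elem_sym n r) = 0"
    unfolding elem_sym_def z.eval_sum z.eval_prod z.eval_var
  proof (rule sum.neutral, rule ballI)
    fix B assume "B \<in> {B. B \<subseteq> {1..n} \<and> card B = r}"
    then have "finite B" "B \<noteq> {}" using assms by (auto intro: finite_subset)
    then show "(\<Prod>i\<in>B. 0 :: complex) = 0" by (simp add: card_gt_0_iff)
  qed
  ultimately have "elem_sym n r \<in> symmetric_pos n"
    using perm_act_elem_sym by (auto simp: symmetric_pos_def sym_group_def l)
  then show ?thesis using symmetric_pos_coinv_ideal by blast
qed

definition sqsum :: "nat \<Rightarrow> (nat \<Rightarrow> nat) \<Rightarrow> nat" where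
  "sqsum n e = (\<Sum>i\<in>{1..n}. (e i)\<^sup>2)"

text \<open>Among sets \<open>B\<close> of one size only the sum of \<open>e\<close> over
  \<open>B\<close> matters. This makes the sum of squares a usable order on the monomials of a
  product with \<open>elem_sym\<close>.\<close>

lemma sqsum_add_indicator:
  assumes "B \<subseteq> {1..n}"
  shows "sqsum n (\<lambda>i. e i + of_bool (i \<in> B)) = sqsum n e + 2 * (\<Sum>i\<in>B. e i) + card B"
proof -
  have fin: "finite B" using assms finite_subset by blast
  have "sqsum n (\<lambda>i. e i + of_bool (i \<in> B)) = (\<Sum>i\<in>{1..n}. (e i)\<^sup>2 + (if i \<in> B then 2 * e i + 1 else 0))"
    unfolding sqsum_def by (intro sum.cong refl) (simp add: power2_eq_square algebra_simps)
  also have "\<dots> = sqsum n e + (\<Sum>i\<in>{1..n} \<inter> B. 2 * e i + 1)"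
    by (simp add: sum.distrib sqsum_def sum.If_cases)
  also have "{1..n} \<inter> B = B" using assms by blast
  also have "(\<Sum>i\<in>B. 2 * e i + 1) = 2 * (\<Sum>i\<in>B. e i) + card B"
    unfolding sum.distrib sum_distrib_left by simp
  finally show ?thesis by simp
qed

lemma exchange_permutation:
  assumes "finite X" "finite Y" "X \<inter> Y = {}" "card X = card Y"
  obtains u where "u permutes (X \<union> Y)" "u ` X = Y" "u ` Y = X"
proof -
  obtain f where f: "bij_betw f X Y" using assms finite_same_card_bij by blast
  define f' where "f' = inv_into X f"
  have f': "bij_betw f' Y X" unfolding f'_def by (rule bij_betw_inv_into[OF f])
  define u where "u i = (if i \<in> X then f i else if i \<in> Y then f' i else i)" for i
  have uX: "u ` X = Y" using f by (auto simp: u_def bij_betw_def)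
  have uY: "u ` Y = X"
  proof -
    have "u ` Y = f' ` Y" using assms(3) by (intro image_cong) (auto simp: u_def)
    then show ?thesis using f' by (simp add: bij_betw_def)
  qed
  have uu: "u (u i) = i" for i
  proof -
    consider "i \<in> X" | "i \<in> Y" "i \<notin> X" | "i \<notin> X" "i \<notin> Y" by blast
    then show ?thesis
    proof cases
      case 1
      then have "f i \<in> Y" using f by (auto simp: bij_betw_def)
      then have "f i \<notin> X" using assms(3) by blast
      with 1 \<open>f i \<in> Y\<close> show ?thesis using f by (simp add: u_def f'_def bij_betw_inv_into_left)
    next
      case 2
      then have "f' i \<in> X" using f' by (auto simp: bij_betw_def)
      with 2 show ?thesis using f by (simp add: u_def) (simp add: f'_def bij_betw_inv_into_right)
    qed (simp add: u_def)
  qed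
  have "u permutes (X \<union> Y)"
    unfolding permutes_def by (metis UnI1 UnI2 u_def uu)
  with uX uY show ?thesis using that by blast
qed

text \<open>
  Among the monomials of \<open>elem_sym n (n - k) * zmon n e\<close> the sum of the squares of the exponents
  is largest when \<open>B\<close> collects the largest exponents; only ties can be permuted.
\<close>

lemma max_indicator:
  assumes mono: "\<And>i. 1 \<le> i \<Longrightarrow> i < n \<Longrightarrow> e i \<le> e (Suc i)"
    and k: "1 \<le> k" "k < n" and B: "B \<subseteq> {1..n}" "card B = n - k"
  defines "T \<equiv> {Suc k..n}"
  shows "sqsum n (\<lambda>i. e i + of_bool (i \<in> B)) < sqsum n (\<lambda>i. e i + of_bool (i \<in> T)) \<or>
    (\<exists>u. u permutes {i \<in> {1..n}. e i = e (Suc k)} \<and> u ` T = B \<and> (e k < e (Suc k) \<longrightarrow> B = T))"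
proof -
  define \<theta> where "\<theta> = e (Suc k)"
  have mono': "e i \<le> e j" if "1 \<le> i" "i \<le> j" "j \<le> n" for i j
    using that(2,3)
  proof (induction rule: dec_induct)
    case (step m)
    then show ?case using mono[of m] that(1) by simp
  qed simp
  have fin: "finite B" "finite T" using B finite_subset by (auto simp: T_def)
  have T: "T \<subseteq> {1..n}" "card T = n - k" by (auto simp: T_def)
  have ge: "e i \<ge> \<theta>" if "i \<in> T" for i using that mono'[of "Suc k" i] by (simp add: T_def \<theta>_def)
  have le: "e i \<le> \<theta>" if "i \<in> B - T" for i
    using that B mono'[of i "Suc k"] k by (auto simp: T_def \<theta>_def subset_iff)
  have cd: "card (T - B) = card (B - T)"
    using card_Diff_subset_Int[of T B] card_Diff_subset_Int[of B T] fin B(2) T(2) by (simp add: Int_commute)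
  have s: "(\<Sum>i\<in>T. e i) = (\<Sum>i\<in>T \<inter> B. e i) + (\<Sum>i\<in>T - B. e i)"
    "(\<Sum>i\<in>B. e i) = (\<Sum>i\<in>T \<inter> B. e i) + (\<Sum>i\<in>B - T. e i)"
    using sum.Int_Diff[OF fin(2), of e B] sum.Int_Diff[OF fin(1), of e T] by (simp_all add: Int_commute)
  have 1: "\<theta> * card (T - B) \<le> (\<Sum>i\<in>T - B. e i)"
    using sum_mono[of "T - B" "\<lambda>_. \<theta>" e] ge by (simp add: mult.commute)
  have 2: "(\<Sum>i\<in>B - T. e i) \<le> \<theta> * card (T - B)"
    using sum_mono[of "B - T" e "\<lambda>_. \<theta>"] le cd by (simp add: mult.commute)
  show ?thesis
  proof (cases "(\<Sum>i\<in>B. e i) < (\<Sum>i\<in>T. e i)")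
    case True
    then show ?thesis using sqsum_add_indicator[OF B(1)] sqsum_add_indicator[OF T(1)] B(2) T(2) by simp
  next
    case False
    then have eq: "(\<Sum>i\<in>B - T. e i) = \<theta> * card (T - B)" "(\<Sum>i\<in>T - B. e i) = \<theta> * card (T - B)"
      using 1 2 s by auto
    have eB: "e i = \<theta>" if "i \<in> B - T" for i
      using sum_mono_inv[of e "B - T" "\<lambda>_. \<theta>" i] le that eq(1) fin(1) cd by (simp add: mult.commute)
    have eT: "e i = \<theta>" if "i \<in> T - B" for i
      using sum_mono_inv[of "\<lambda>_. \<theta>" "T - B" e i] ge that eq(2) fin(2) by (simp add: mult.commute)
    obtain u where u: "u permutes ((T - B) \<union> (B - T))" "u ` (T - B) = B - T" "u ` (B - T) = T - B"
      using exchange_permutation[of "T - B" "B - T"] fin cd by blast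
    have "u permutes {i \<in> {1..n}. e i = e (Suc k)}"
      using eB eT B(1) T(1) by (intro permutes_subset[OF u(1)]) (auto simp: \<theta>_def)
    moreover have "u ` T = B"
    proof -
      have "u ` (T \<inter> B) = T \<inter> B" using permutes_not_in[OF u(1)] by force
      then show ?thesis using u(2) by (metis Int_Diff_Un Int_commute image_Un)
    qed
    moreover have "B = T" if "e k < e (Suc k)"
    proof -
      have "B - T = {}"
      proof (rule ccontr)
        assume "B - T \<noteq> {}"
        then obtain j where j: "j \<in> B - T" by blast
        then have "e j \<le> e k" using B(1) k mono'[of j k] by (auto simp: T_def subset_iff)
        with eB[OF j] that show False by (simp add: \<theta>_def)
      qed
      then show ?thesis using fin B(2) T(2) by (metis Diff_eq_empty_iff card_subset_eq)
    qed
    ultimately show ?thesis by blast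
  qed
qed

text \<open>Take a permutation that maximizes the sum of \<open>i * m (\<sigma> i)\<close>: swapping
  a descent would increase it.\<close>

lemma sort_exponents:
  obtains \<sigma> where "\<sigma> permutes {1..n}" "\<And>i. 1 \<le> i \<Longrightarrow> i < n \<Longrightarrow> m (\<sigma> i) \<le> (m (\<sigma> (Suc i)) :: nat)"
proof -
  define W where "W \<sigma> = (\<Sum>i\<in>{1..n}. i * m (\<sigma> i))" for \<sigma> :: "nat \<Rightarrow> nat"
  define A where "A = {\<sigma>. \<sigma> permutes {1..n}}"
  have A: "finite A" by (simp add: A_def finite_permutations)
  have "id \<in> A" unfolding A_def by (intro CollectI permutes_id)
  then have A: "finite A" "A \<noteq> {}" using A by auto
  have "Max (W ` A) \<in> W ` A" using A by (intro Max_in) auto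
  then obtain \<sigma> where \<sigma>: "\<sigma> permutes {1..n}" "W \<sigma> = Max (W ` A)" by (auto simp: A_def)
  have "m (\<sigma> i) \<le> m (\<sigma> (Suc i))" if i: "1 \<le> i" "i < n" for i
  proof (rule ccontr)
    assume less: "\<not> m (\<sigma> i) \<le> m (\<sigma> (Suc i))"
    have split: "(\<Sum>j\<in>{1..n}. h j) = h i + h (Suc i) + (\<Sum>j\<in>{1..n} - {i, Suc i}. h j)" for h :: "nat \<Rightarrow> nat"
    proof -
      have "{1..n} - {i, Suc i} = {1..n} - {i} - {Suc i}" by auto
      then show ?thesis using i sum.remove[of "{1..n}" i h] sum.remove[of "{1..n} - {i}" "Suc i" h] by simp
    qed
    have rest: "(\<Sum>j\<in>{1..n} - {i, Suc i}. j * m ((\<sigma> \<circ> adj i) j)) = (\<Sum>j\<in>{1..n} - {i, Suc i}. j * m (\<sigma> j))"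
      by (intro sum.cong refl) (simp add: transpose_def)
    have "W \<sigma> < W (\<sigma> \<circ> adj i)"
      unfolding W_def split[of "\<lambda>j. j * m ((\<sigma> \<circ> adj i) j)"] split[of "\<lambda>j. j * m (\<sigma> j)"] rest using less by simp
    moreover have "W (\<sigma> \<circ> adj i) \<le> Max (W ` A)"
      using A permutes_compose[OF adj_permutes[OF i] \<sigma>(1)] by (intro Max_ge) (auto simp: A_def)
    ultimately show False using \<sigma>(2) by simp
  qed
  with \<sigma>(1) show ?thesis using that by blast
qed

text \<open>The sequence that starts at 0 and goes up by 1 right after each element of
  \<open>S\<close>. For the descent set of a tableau it is the charge vector.\<close>

definition steps :: "nat set \<Rightarrow> nat \<Rightarrow> nat" where
  "steps S i = card {s \<in> S. s < i}"

lemma steps_Suc: "finite S \<Longrightarrow> steps S (Suc i) = (if i \<in> S then Suc (steps S i) else steps S i)"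
proof -
  assume S: "finite S"
  have "{s \<in> S. s < Suc i} = (if i \<in> S then insert i {s \<in> S. s < i} else {s \<in> S. s < i})" by (auto simp: less_Suc_eq)
  then show ?thesis using S by (simp add: steps_def)
qed

text \<open>This separates the reduction of monomials from the group algebra. Charge monomials enter
  only through the assumption \<open>L_steps\<close>, which \<open>descent_ideal\<close> will
  provide.\<close>

locale coinv_submodule =
  fixes n :: nat and L :: "mpoly set"
  assumes L_ideal: "coinv_ideal n \<subseteq> L"
    and L_add: "\<And>p q. p \<in> L \<Longrightarrow> q \<in> L \<Longrightarrow> p + q \<in> L"
    and L_const: "\<And>c p. p \<in> L \<Longrightarrow> const c * p \<in> L"
    and L_perm: "\<And>\<sigma> p. \<sigma> permutes {1..n} \<Longrightarrow> p \<in> L \<Longrightarrow> perm_act \<sigma> p \<in> L"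
    and L_steps: "\<And>S. S \<subseteq> {1..<n} \<Longrightarrow>
      (\<And>k. k \<in> S \<Longrightarrow> \<exists>a b. 1 \<le> a \<and> a \<le> k \<and> k < b \<and> b \<le> n \<and> (\<forall>i. a \<le> i \<and> i < b \<and> i \<noteq> k \<longrightarrow> i \<notin> S) \<and>
        (\<Sum>w | w permutes {a..b}. perm_act w (zmon n (steps S))) \<in> L) \<Longrightarrow> zmon n (steps S) \<in> L"
begin

lemma L_0: "0 \<in> L"
  using L_ideal coinv_ideal_0 by blast

lemma L_sum: "(\<And>i. i \<in> I \<Longrightarrow> f i \<in> L) \<Longrightarrow> (\<Sum>i\<in>I. f i) \<in> L"
  by (induction I rule: infinite_finite_induct) (simp_all add: L_0 L_add)

lemma L_diff: "p \<in> L \<Longrightarrow> q \<in> L \<Longrightarrow> p - q \<in> L"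
  using L_add[OF _ L_const, of p q "-1"] by (simp add: const_simps)

lemma L_const_cancel: "const c * p \<in> L \<Longrightarrow> c \<noteq> 0 \<Longrightarrow> p \<in> L"
  using L_const[of "const c * p" "1 / c"] by (simp add: mult.assoc[symmetric] const_simps(4)[symmetric] const_simps)

text \<open>Lower the exponents after \<open>k\<close> by 1 and multiply by the elementary symmetric
  polynomial of degree \<open>n - k\<close>: the product is in the ideal, the given monomial comes
  back as a leading term, and all other leading terms come from ties.\<close>

lemma sorted_zmon_in_L:
  assumes mono: "\<And>i. 1 \<le> i \<Longrightarrow> i < n \<Longrightarrow> m i \<le> m (Suc i)"
    and less: "\<And>e. sqsum n e < sqsum n m \<Longrightarrow> zmon n e \<in> L"
  shows "zmon n m \<in> L"
proof -
  define \<B> where "\<B> k = {B. B \<subseteq> {1..n} \<and> card B = n - k}" for k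
  define low where "low k i = (if k < i then m i - 1 else m i)" for k i
  have fin\<B>: "finite (\<B> k)" for k unfolding \<B>_def by (rule finite_subset[of _ "Pow {1..n}"]) auto
  have el: "(\<Sum>B\<in>\<B> k. zmon n (\<lambda>i. low k i + of_bool (i \<in> B))) \<in> L" if "k < n" for k
  proof -
    have "zmon n (low k) * elem_sym n (n - k) \<in> coinv_ideal n"
      using that by (intro coinv_ideal_mult polys_zmon elem_sym_coinv_ideal) simp
    then show ?thesis using L_ideal by (auto simp: mult.commute[of "zmon n (low k)"] elem_sym_mult_zmon \<B>_def)
  qed
  have top: "{Suc k..n} \<in> \<B> k" for k by (auto simp: \<B>_def)
  have top_eq: "sqsum n (\<lambda>i. low k i + of_bool (i \<in> {Suc k..n})) = sqsum n m"
    "zmon n (\<lambda>i. low k i + of_bool (i \<in> {Suc k..n})) = zmon n m"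
    if "\<And>i. k < i \<Longrightarrow> i \<le> n \<Longrightarrow> m i \<ge> 1" for k
  proof -
    have "low k i + of_bool (i \<in> {Suc k..n}) = m i" if "i \<in> {1..n}" for i
      using that \<open>\<And>i. k < i \<Longrightarrow> i \<le> n \<Longrightarrow> m i \<ge> 1\<close>[of i] by (auto simp: low_def)
    then show "sqsum n (\<lambda>i. low k i + of_bool (i \<in> {Suc k..n})) = sqsum n m"
      "zmon n (\<lambda>i. low k i + of_bool (i \<in> {Suc k..n})) = zmon n m"
      by (auto simp: sqsum_def intro!: sum.cong zmon_cong)
  qed
  have mono': "m i \<le> m j" if "1 \<le> i" "i \<le> j" "j \<le> n" for i j
    using that(2,3)
  proof (induction rule: dec_induct)
    case (step l)
    then show ?case using mono[of l] that(1) by simp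
  qed simp
  consider "n = 0" | "n \<ge> 1" "m 1 > 0" | k where "1 \<le> k" "k < n" "m k + 2 \<le> m (Suc k)"
    | "n \<ge> 1" "m 1 = 0" "\<And>k. 1 \<le> k \<Longrightarrow> k < n \<Longrightarrow> m (Suc k) \<le> Suc (m k)"
  proof -
    have "m k + 2 \<le> m (Suc k) \<or> m (Suc k) \<le> Suc (m k)" for k by linarith
    moreover have "n = 0 \<or> n \<ge> 1" "m 1 = 0 \<or> m 1 > 0" by auto
    ultimately show thesis using that by blast
  qed
  then show ?thesis
  proof cases
    case 1
    then have "zmon n m = zmon n (steps {})" by (simp add: zmon_def)
    also have "\<dots> \<in> L" by (rule L_steps) auto
    finally show ?thesis .
  next
    case 2
    \<comment> \<open>For \<open>k = 0\<close> the elementary symmetric polynomial is the product of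
      all variables, so there is no other monomial.\<close>
    have "B = {Suc 0..n}" if "B \<in> \<B> 0" for B
      using that card_subset_eq[of "{1..n}" B] by (simp add: \<B>_def)
    then have \<B>0: "\<B> 0 = {{Suc 0..n}}" using top[of 0] by blast
    have pos: "m i \<ge> 1" if "0 < i" "i \<le> n" for i using mono'[of 1 i] 2 that by simp
    have "zmon n (\<lambda>i. low 0 i + of_bool (i \<in> {Suc 0..n})) \<in> L" using el[of 0] 2(1) by (simp only: \<B>0) simp
    moreover have "zmon n (\<lambda>i. low 0 i + of_bool (i \<in> {Suc 0..n})) = zmon n m"
      by (rule top_eq(2)) (rule pos)
    ultimately show ?thesis by (simp only:)
  next
    case 3
    have pos: "m i \<ge> 1" if "k < i" "i \<le> n" for i using mono'[of "Suc k" i] 3 that by simp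
    have lm: "low k i \<le> low k (Suc i)" if "1 \<le> i" "i < n" for i
      using mono[OF that] 3 by (cases "i = k") (auto simp: low_def)
    have "zmon n (\<lambda>i. low k i + of_bool (i \<in> B)) \<in> L" if B: "B \<in> \<B> k - {{Suc k..n}}" for B
    proof (rule less)
      \<comment> \<open>An ascent of at least 2 remains a strict ascent after lowering, so the
        leading term is unique.\<close>
      have "low k k < low k (Suc k)" using 3 by (simp add: low_def)
      then show "sqsum n (\<lambda>i. low k i + of_bool (i \<in> B)) < sqsum n m"
        using max_indicator[of n "low k" k B, OF lm 3(1,2)] B top_eq(1)[OF pos] by (auto simp: \<B>_def)
    qed
    then have "(\<Sum>B\<in>\<B> k - {{Suc k..n}}. zmon n (\<lambda>i. low k i + of_bool (i \<in> B))) \<in> L" by (rule L_sum)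
    from L_diff[OF el[OF 3(2)] this] show ?thesis
      using sum.remove[OF fin\<B> top, of "\<lambda>B. zmon n (\<lambda>i. low k i + of_bool (i \<in> B))" k] top_eq(2)[OF pos] by simp
  next
    case 4
    define S where "S = {k \<in> {1..<n}. m (Suc k) = Suc (m k)}"
    have S: "finite S" by (simp add: S_def)
    have mS: "m (Suc k) = (if k \<in> S then Suc (m k) else m k)" if "1 \<le> k" "k < n" for k
      using mono[OF that] 4(3)[OF that] that by (auto simp: S_def)
    have m: "m i = steps S i" if "1 \<le> i" "i \<le> n" for i
      using that
    proof (induction i rule: dec_induct)
      case base
      have "{s \<in> S. s < 1} = {}" by (auto simp: S_def)
      then show ?case using 4(2) by (simp add: steps_def)
    next
      case (step i)
      then show ?case using mS[of i] steps_Suc[OF S, of i] by simp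
    qed
    have zm: "zmon n m = zmon n (steps S)" by (rule zmon_cong) (simp add: m)
    have "zmon n (steps S) \<in> L"
    proof (rule L_steps)
      show "S \<subseteq> {1..<n}" by (auto simp: S_def)
      fix k assume kS: "k \<in> S"
      then have k: "1 \<le> k" "k < n" and mk: "m (Suc k) = Suc (m k)" by (auto simp: S_def)
      have pos: "m i \<ge> 1" if "k < i" "i \<le> n" for i using mono'[of "Suc k" i] mk that by simp
      have lm: "low k i \<le> low k (Suc i)" if "1 \<le> i" "i < n" for i
        using mono[OF that] mk by (cases "i = k") (auto simp: low_def)
      have lm': "low k i \<le> low k j" if "1 \<le> i" "i \<le> j" "j \<le> n" for i j
        using that(2,3)
      proof (induction rule: dec_induct)
        case (step l)
        then show ?case using lm[of l] that(1) by simp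
      qed simp
      \<comment> \<open>Lowering turns the ascent at \<open>k\<close> into a tie. \<open>D\<close>
        is the whole tie; it is an interval because \<open>low k\<close> is weakly
        increasing.\<close>
      define D where "D = {i \<in> {1..n}. low k i = low k (Suc k)}"
      have D: "finite D" "k \<in> D" "Suc k \<in> D" using k mk by (auto simp: D_def low_def)
      define a where "a = Min D" define b where "b = Max D"
      have aD: "a \<in> D" and bD: "b \<in> D" unfolding a_def b_def using D by (auto intro: Min_in Max_in)
      have ak: "a \<le> k" and kb: "Suc k \<le> b" unfolding a_def b_def using D by auto
      have ab: "1 \<le> a" "b \<le> n" using aD bD by (auto simp: D_def)
      have Dab: "D \<subseteq> {a..b}" unfolding a_def b_def using D(1) by auto
      have const_ab: "low k i = low k (Suc k)" if "a \<le> i" "i \<le> b" for i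
        using lm'[of a i] lm'[of i b] that ab aD bD by (simp add: D_def)
      \<comment> \<open>Since \<open>low k\<close> is constant on the interval, \<open>m\<close> can
        jump there only at \<open>k\<close>.\<close>
      have noS: "i \<notin> S" if "a \<le> i" "i < b" "i \<noteq> k" for i
      proof
        assume "i \<in> S"
        then have "m (Suc i) = Suc (m i)" by (simp add: S_def)
        moreover have "low k (Suc i) = low k i" using const_ab[of i] const_ab[of "Suc i"] that by simp
        ultimately show False using that(3) pos[of i] that(2) ab by (auto simp: low_def split: if_splits)
      qed
      define Y where "Y p = (\<Sum>w | w permutes {a..b}. perm_act w p)" for p
      have Y_L: "Y p \<in> L" if "p \<in> L" for p
        unfolding Y_def by (rule L_sum, rule L_perm[OF permutes_interval_mono[OF _ ab] that]) simp
      have Y_perm: "Y (perm_act u p) = Y p" if "u permutes {a..b}" for u p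
      proof -
        have "Y (perm_act u p) = (\<Sum>w | w permutes {a..b}. perm_act (w \<circ> u) p)"
          by (simp add: Y_def perm_act_comp)
        also have "\<dots> = Y p" unfolding Y_def by (rule sum_permutations_compose_right[OF that, symmetric])
        finally show ?thesis .
      qed
      have Y_sum: "Y (\<Sum>i\<in>I. f i) = (\<Sum>i\<in>I. Y (f i))" for I :: "nat set set" and f
        unfolding Y_def perm.eval_sum by (rule sum.swap)
      let ?z = "\<lambda>B. zmon n (\<lambda>i. low k i + of_bool (i \<in> B))"
      \<comment> \<open>The sets whose monomials are not smaller than the given one. Each such
        monomial arises from it by permuting the tie, so after symmetrization over
        \<open>{a..b}\<close> all of them agree, and their nonzero number can be divided
        out.\<close>
      define \<M> where "\<M> = {B \<in> \<B> k. sqsum n (\<lambda>i. low k i + of_bool (i \<in> B)) \<ge> sqsum n m}"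
      have M: "Y (?z B) = Y (zmon n m)" if B: "B \<in> \<M>" for B
      proof -
        from B obtain u where u: "u permutes D" "u ` {Suc k..n} = B"
          using max_indicator[of n "low k" k B, OF lm k] top_eq(1)[OF pos] by (auto simp: \<M>_def \<B>_def D_def)
        have ui: "u permutes {a..b}" by (rule permutes_subset[OF u(1) Dab])
        have "perm_act u (?z {Suc k..n}) = ?z B"
        proof (rule perm_act_zmon)
          show "u permutes {1..n}" by (rule permutes_interval_mono[OF ui ab])
          fix i assume "i \<in> {1..n}"
          have "u i \<in> B \<longleftrightarrow> i \<in> {Suc k..n}" using u(2) permutes_inj[OF u(1)] by (metis inj_image_mem_iff)
          moreover have "low k (u i) = low k i"
            using permutes_not_in[OF u(1), of i] permutes_in_image[OF u(1), of i] by (cases "i \<in> D") (auto simp: D_def)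
          ultimately show "low k i + of_bool (i \<in> {Suc k..n}) = low k (u i) + of_bool (u i \<in> B)" by simp
        qed
        then show ?thesis using Y_perm[OF ui] top_eq(2)[OF pos] by metis
      qed
      have 1: "Y (\<Sum>B\<in>\<B> k. ?z B) \<in> L" by (rule Y_L[OF el[OF k(2)]])
      have 2: "Y (?z B) \<in> L" if "B \<in> \<B> k - \<M>" for B
        using that by (intro Y_L less) (auto simp: \<M>_def)
      have "(\<Sum>B\<in>\<B> k. Y (?z B)) = (\<Sum>B\<in>\<M>. Y (?z B)) + (\<Sum>B\<in>\<B> k - \<M>. Y (?z B))"
        using fin\<B> by (subst sum.subset_diff[of \<M>]) (auto simp: \<M>_def)
      also have "(\<Sum>B\<in>\<M>. Y (?z B)) = (\<Sum>B\<in>\<M>. Y (zmon n m))" using M by (rule sum.cong[OF refl])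
      also have "\<dots> = of_nat (card \<M>) * Y (zmon n m)" by simp
      finally have eq: "of_nat (card \<M>) * Y (zmon n m) = Y (\<Sum>B\<in>\<B> k. ?z B) - (\<Sum>B\<in>\<B> k - \<M>. Y (?z B))"
        unfolding Y_sum by simp
      have 3: "of_nat (card \<M>) * Y (zmon n m) \<in> L" unfolding eq by (rule L_diff[OF 1 L_sum[OF 2]])
      have "{Suc k..n} \<in> \<M>" using top[of k] top_eq(1)[OF pos] by (simp add: \<M>_def)
      then have "card \<M> \<noteq> 0" using fin\<B>[of k] by (auto simp: \<M>_def)
      moreover have "of_nat (card \<M>) = const (of_nat (card \<M>))"
        by (simp add: const_def)
      ultimately have "Y (zmon n m) \<in> L" using L_const_cancel[of "of_nat (card \<M>)"] 3 by simp
      then show "\<exists>a b. 1 \<le> a \<and> a \<le> k \<and> k < b \<and> b \<le> n \<and> (\<forall>i. a \<le> i \<and> i < b \<and> i \<noteq> k \<longrightarrow> i \<notin> S) \<and>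
          (\<Sum>w | w permutes {a..b}. perm_act w (zmon n (steps S))) \<in> L"
        using ab ak kb noS unfolding Y_def zm by (intro exI[of _ a] exI[of _ b]) auto
    qed
    then show ?thesis by (simp only: zm)
  qed
qed

lemma zmon_in_L: "zmon n m \<in> L"
proof (induction "sqsum n m" arbitrary: m rule: less_induct)
  case less
  obtain \<sigma> where \<sigma>: "\<sigma> permutes {1..n}" "\<And>i. 1 \<le> i \<Longrightarrow> i < n \<Longrightarrow> m (\<sigma> i) \<le> m (\<sigma> (Suc i))"
    using sort_exponents by metis
  have eq: "sqsum n (\<lambda>i. m (\<sigma> i)) = sqsum n m"
    unfolding sqsum_def using sum.permute[OF \<sigma>(1), of "\<lambda>i. (m i)\<^sup>2"] by (simp only: comp_def)
  have "zmon n (\<lambda>i. m (\<sigma> i)) \<in> L"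
    by (rule sorted_zmon_in_L) (use \<sigma>(2) less.hyps in \<open>simp_all only: eq\<close>)
  from L_perm[OF \<sigma>(1) this] show ?case
    by (simp only: perm_act_zmon[OF \<sigma>(1), of "\<lambda>i. m (\<sigma> i)" m])
qed

lemma polys_in_L:
  assumes "p \<in> polys n"
  shows "p \<in> L"
  by (subst polys_expand[OF assms]) (intro L_sum L_const zmon_in_L)

end

section \<open>Functions on the orbit of a regular point\<close>

text \<open>
  Evaluation along the line through the point \<open>(w 1, \<dots>, w n)\<close>; the coefficient of degree \<open>d\<close> is the
  value of the homogeneous component of degree \<open>d\<close> at that point.
\<close>

definition line_eval :: "(nat \<Rightarrow> nat) \<Rightarrow> mpoly \<Rightarrow> complex poly" where
  "line_eval w = poly_eval.eval (\<lambda>c. [:c:]) (\<lambda>i. [:0, of_nat (w i):])"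

interpretation line: poly_eval "\<lambda>c. [:c:]" "\<lambda>i. [:0, of_nat (w i):]"
  rewrites "poly_eval.eval (\<lambda>c. [:c:]) (\<lambda>i. [:0, of_nat (w i):]) = line_eval w" for w
  by unfold_locales (simp_all add: line_eval_def one_pCons)

definition expo :: "nat \<Rightarrow> (nat \<Rightarrow> nat) \<Rightarrow> nat" where "expo n e = (\<Sum>i\<in>{1..n}. e i)"

lemma line_eval_zmon: "line_eval w (zmon n e) = monom (\<Prod>i\<in>{1..n}. of_nat (w i) ^ e i) (expo n e)"
proof -
  have x: "[:0, a:] ^ k = monom (a ^ k) k" for a :: complex and k
    by (induction k) (simp_all add: monom_Suc smult_monom one_pCons monom_0)
  have p: "(\<Prod>i\<in>I. monom (f i) (g i)) = monom (\<Prod>i\<in>I. f i) (\<Sum>i\<in>I. g i)"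
    for I :: "nat set" and f :: "nat \<Rightarrow> complex" and g
    by (induction I rule: infinite_finite_induct) (simp_all add: mult_monom)
  show ?thesis unfolding zmon_def line.eval_prod line.eval_power line.eval_var x p expo_def ..
qed

lemma line_eval_perm_act: "line_eval w (perm_act \<sigma> p) = line_eval (w \<circ> \<sigma>) p"
proof -
  have "line_eval w (perm_act \<sigma> p) = (\<Sum>m\<in>Poly_Mapping.keys p.
      line_eval w (const (Poly_Mapping.lookup p m)) * line_eval w (pmon (\<lambda>i. var (\<sigma> i)) m))"
    by (simp add: perm_act_def pmon_def line.eval_sum line.eval_mult)
  also have "\<dots> = line_eval (w \<circ> \<sigma>) (\<Sum>m\<in>Poly_Mapping.keys p. const (Poly_Mapping.lookup p m) * pmon var m)"
    unfolding line.eval_sum line.eval_mult line.eval_const line.eval_pmon_var[of _ id, simplified] line.eval_pmon_var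
    by simp
  finally show ?thesis using mpoly_expand[of p] by simp
qed

lemma sum_apply: "(\<Sum>i\<in>I. f i) w = (\<Sum>i\<in>I. f i w)" for f :: "'i \<Rightarrow> 'a \<Rightarrow> 'b::comm_monoid_add"
  by (induction I rule: infinite_finite_induct) simp_all

interpretation fs: vector_space "\<lambda>(c :: complex) (f :: (nat \<Rightarrow> nat) \<Rightarrow> complex) w. c * f w"
  by unfold_locales (simp_all add: fun_eq_iff algebra_simps)

locale orbit_functions =
  fixes n :: nat
begin

text \<open>The permutation \<open>w\<close> stands for the point with coordinates
  \<open>w 1\<close>, ..., \<open>w n\<close> in the orbit of (1, ..., n).\<close>

definition Orb :: "(nat \<Rightarrow> nat) set" where "Orb = {w. w permutes {1..n}}"

text \<open>Set to 0 outside the orbit, so that equality of functions is equality on the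
  orbit.\<close>

definition monf :: "(nat \<Rightarrow> nat) \<Rightarrow> (nat \<Rightarrow> nat) \<Rightarrow> complex" where
  "monf e w = (if w \<in> Orb then \<Prod>i\<in>{1..n}. of_nat (w i) ^ e i else 0)"

text \<open>The functions on the orbit of degree less than \<open>d\<close>. The strict bound is
  there because elements of the coinvariant ideal drop in degree when restricted to the
  orbit.\<close>

definition F :: "nat \<Rightarrow> ((nat \<Rightarrow> nat) \<Rightarrow> complex) set" where
  "F d = fs.span {monf e |e. expo n e < d}"

definition comp :: "mpoly \<Rightarrow> nat \<Rightarrow> (nat \<Rightarrow> nat) \<Rightarrow> complex" where
  "comp p d w = (if w \<in> Orb then Polynomial.coeff (line_eval w p) d else 0)"

lemma monf_mult: "monf e * monf f = monf (\<lambda>i. e i + f i)"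
  by (simp add: fun_eq_iff monf_def prod.distrib power_add)

lemma monf_in_F: "expo n e < d \<Longrightarrow> monf e \<in> F d"
  unfolding F_def by (rule fs.span_base) blast

lemma F_add: "f \<in> F d \<Longrightarrow> g \<in> F d \<Longrightarrow> f + g \<in> F d"
  unfolding F_def by (rule fs.span_add)

lemma F_sum: "(\<And>i. i \<in> I \<Longrightarrow> f i \<in> F d) \<Longrightarrow> (\<Sum>i\<in>I. f i) \<in> F d"
  unfolding F_def by (rule fs.span_sum)

lemma F_scale: "f \<in> F d \<Longrightarrow> (\<lambda>w. c * f w) \<in> F d"
  unfolding F_def by (rule fs.span_scale)

lemma F_0: "0 \<in> F d"
  unfolding F_def by (rule fs.span_zero)

lemma F_zero: "F 0 = {0}"
  by (simp add: F_def)

text \<open>Degree at most \<open>i\<close> times degree less than \<open>j\<close>; hence the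
  \<open>Suc\<close> in only one hypothesis.\<close>

lemma F_mult:
  assumes f: "f \<in> F (Suc i)" and g: "g \<in> F j"
  shows "f * g \<in> F (i + j)"
  using f unfolding F_def[of "Suc i"]
proof (induction rule: fs.span_induct_alt)
  case base
  have "(0 :: (nat \<Rightarrow> nat) \<Rightarrow> complex) * g = 0" by (simp add: fun_eq_iff)
  then show ?case using F_0 by (simp only:)
next
  case (step c x y)
  then obtain e where e: "x = monf e" "expo n e < Suc i" by blast
  have "monf e * g \<in> F (i + j)"
    using g unfolding F_def[of j]
  proof (induction rule: fs.span_induct_alt)
    case base
    have "monf e * (0 :: (nat \<Rightarrow> nat) \<Rightarrow> complex) = 0" by (simp add: fun_eq_iff)
    then show ?case using F_0 by (simp only:)
  next
    case (step c x y)
    then obtain e' where e': "x = monf e'" "expo n e' < j" by blast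
    have "expo n (\<lambda>k. e k + e' k) < i + j" using e(2) e'(2) by (simp add: expo_def sum.distrib)
    then have "monf e * monf e' \<in> F (i + j)" unfolding monf_mult by (rule monf_in_F)
    moreover have "monf e * ((\<lambda>w. c * x w) + y) = (\<lambda>w. c * (monf e * monf e') w) + monf e * y"
      by (simp add: fun_eq_iff e' algebra_simps)
    ultimately show ?case using F_add F_scale step.IH step(2) by metis
  qed
  moreover have "((\<lambda>w. c * x w) + y) * g = (\<lambda>w. c * (monf e * g) w) + y * g"
    by (simp add: fun_eq_iff e algebra_simps)
  ultimately show ?case using F_add F_scale step by metis
qed

lemma comp_add: "comp (p + q) d = comp p d + comp q d"
  by (simp add: fun_eq_iff comp_def line.eval_add)

lemma comp_sum: "comp (\<Sum>i\<in>I. p i) d = (\<Sum>i\<in>I. comp (p i) d)"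
proof (induction I rule: infinite_finite_induct)
  case (insert x A)
  then show ?case by (simp add: comp_add)
qed (simp_all add: fun_eq_iff comp_def line.eval_0)

lemma comp_const: "comp (const c * p) d = (\<lambda>w. c * comp p d w)"
  by (simp add: fun_eq_iff comp_def line.eval_mult line.eval_const)

lemma comp_zmon: "comp (zmon n e) d = (if expo n e = d then monf e else 0)"
  by (auto simp: fun_eq_iff comp_def monf_def line_eval_zmon)

lemma comp_mult: "comp (p * q) d = (\<Sum>i\<le>d. comp p i * comp q (d - i))"
proof
  fix w
  have "(\<Sum>i\<le>d. comp p i * comp q (d - i)) w = (\<Sum>i\<le>d. comp p i w * comp q (d - i) w)"
    by (induction d) (simp_all add: sum_apply)
  then show "comp (p * q) d w = (\<Sum>i\<le>d. comp p i * comp q (d - i)) w"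
    by (simp add: comp_def line.eval_mult coeff_mult)
qed

lemma comp_in_F:
  assumes "p \<in> polys n"
  shows "comp p d \<in> F (Suc d)"
  by (subst polys_expand[OF assms])
    (auto simp: comp_sum comp_const comp_zmon F_0 intro!: F_sum F_scale monf_in_F)

text \<open>A symmetric polynomial is constant on the orbit, and so is each homogeneous component:
  in positive degree \<open>d\<close> this means degree 0 instead of \<open>d\<close>, and in degree
  0 the component vanishes. The drop survives multiplication by any polynomial.\<close>

lemma coinv_ideal_comp:
  assumes "p \<in> coinv_ideal n"
  shows "comp p d \<in> F d"
proof -
  have "coinv_ideal n \<subseteq> {p \<in> polys n. \<forall>d. comp p d \<in> F d}"
  proof (rule coinv_ideal_minimal[OF idealI_polys])
    fix p q assume p: "p \<in> polys n" and q: "q \<in> {p \<in> polys n. \<forall>d. comp p d \<in> F d}"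
    have "comp (p * q) d \<in> F d" for d
      unfolding comp_mult
    proof (rule F_sum)
      fix i assume "i \<in> {..d}"
      then show "comp p i * comp q (d - i) \<in> F d"
        using F_mult[OF comp_in_F[OF p, of i], of "comp q (d - i)" "d - i"] q by simp
    qed
    then show "p * q \<in> {p \<in> polys n. \<forall>d. comp p d \<in> F d}" using p q by blast
  next
    show "symmetric_pos n \<subseteq> {p \<in> polys n. \<forall>d. comp p d \<in> F d}"
    proof
      fix p assume "p \<in> symmetric_pos n"
      then have p: "p \<in> polys n" "\<And>w. w permutes {1..n} \<Longrightarrow> perm_act w p = p" "Poly_Mapping.lookup p 0 = 0"
        by (auto simp: symmetric_pos_def sym_group_def)
      have "comp p d \<in> F d" for d
      proof (cases d)
        case 0
        have z: "Polynomial.coeff (line_eval w p) 0 = 0" for w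
        proof -
          have "poly (line_eval w p) 0 = (\<Sum>m\<in>Poly_Mapping.keys p. Poly_Mapping.lookup p m * poly (pmon (\<lambda>i. [:0, of_nat (w i):]) m) 0)"
            by (simp add: line.eval_def pm_lift_def poly_sum)
          also have "\<dots> = 0"
          proof (rule sum.neutral, rule ballI)
            fix m assume m: "m \<in> Poly_Mapping.keys p"
            then have "m \<noteq> 0" using p(3) by (auto simp: in_keys_iff)
            then obtain i where "i \<in> Poly_Mapping.keys m" by (metis Poly_Mapping.keys_eq_empty ex_in_conv)
            then have "poly (pmon (\<lambda>i. [:0, of_nat (w i):]) m) 0 = (0 :: complex)"
              by (auto simp: pmon_def poly_prod prod_zero_iff in_keys_iff intro!: bexI[of _ i])
            then show "Poly_Mapping.lookup p m * poly (pmon (\<lambda>i. [:0, of_nat (w i):]) m) 0 = 0" by simp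
          qed
          finally show ?thesis by (simp add: poly_0_coeff_0)
        qed
        have "comp p 0 = 0" by (simp add: fun_eq_iff comp_def z)
        then show ?thesis using 0 F_0 by simp
      next
        case (Suc d')
        have "comp p d w = Polynomial.coeff (line_eval id p) d * monf (\<lambda>_. 0) w" for w
        proof (cases "w \<in> Orb")
          case True
          then have "line_eval w p = line_eval id p"
            using line_eval_perm_act[of id w p] p(2)[of w] by (simp only: Orb_def mem_Collect_eq id_comp)
          then show ?thesis using True by (simp add: comp_def monf_def)
        qed (simp add: comp_def monf_def)
        then have "comp p d = (\<lambda>w. Polynomial.coeff (line_eval id p) d * monf (\<lambda>_. 0) w)" by blast
        moreover have "monf (\<lambda>_. 0) \<in> F d" using Suc by (intro monf_in_F) (simp add: expo_def)
        ultimately show ?thesis using F_scale by simp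
      qed
      then show "p \<in> {p \<in> polys n. \<forall>d. comp p d \<in> F d}" using p(1) by blast
    qed
  next
    have "comp 0 d = 0" for d by (simp add: fun_eq_iff comp_def line.eval_0)
    then show "0 \<in> {p \<in> polys n. \<forall>d. comp p d \<in> F d}" using F_0 by (simp del: zero_fun_apply)
  qed (auto simp: comp_add F_add)
  with assms show ?thesis by blast
qed

definition delta :: "(nat \<Rightarrow> nat) \<Rightarrow> (nat \<Rightarrow> nat) \<Rightarrow> complex" where
  "delta v w = (if w = v then 1 else 0)"

lemma finite_Orb: "finite Orb"
  by (simp add: Orb_def finite_permutations)

lemma card_Orb: "card Orb = fact n"
  unfolding Orb_def by (rule card_permutations) simp_all

text \<open>Interpolation: for each other point of the orbit take an affine function that is 1 at
  \<open>v\<close> and 0 there, and multiply. The span is closed under products, since products of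
  monomials are monomials.\<close>

lemma delta_in_span:
  assumes v: "v \<in> Orb"
  shows "delta v \<in> fs.span (range monf)"
proof -
  let ?G = "fs.span (range monf)"
  have mult: "f * g \<in> ?G" if "f \<in> ?G" "g \<in> ?G" for f g
    using that(1)
  proof (induction rule: fs.span_induct_alt)
    case base
    have "(0 :: (nat \<Rightarrow> nat) \<Rightarrow> complex) * g = 0" by (simp add: fun_eq_iff)
    then show ?case using fs.span_zero by (simp only:)
  next
    case (step c x y)
    then obtain e where e: "x = monf e" by blast
    have "monf e * g \<in> ?G"
      using that(2)
    proof (induction rule: fs.span_induct_alt)
      case base
      have "monf e * (0 :: (nat \<Rightarrow> nat) \<Rightarrow> complex) = 0" by (simp add: fun_eq_iff)
      then show ?case using fs.span_zero by (simp only:)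
    next
      case (step c x y)
      then obtain e' where e': "x = monf e'" by blast
      have "monf e * monf e' \<in> ?G" unfolding monf_mult by (rule fs.span_base) simp
      moreover have "monf e * ((\<lambda>w. c * x w) + y) = (\<lambda>w. c * (monf e * monf e') w) + monf e * y"
        by (simp add: fun_eq_iff e' algebra_simps)
      ultimately show ?case using fs.span_add fs.span_scale step by metis
    qed
    moreover have "((\<lambda>w. c * x w) + y) * g = (\<lambda>w. c * (monf e * g) w) + y * g"
      by (simp add: fun_eq_iff e algebra_simps)
    ultimately show ?case using fs.span_add fs.span_scale step by metis
  qed
  have one: "monf (\<lambda>_. 0) \<in> ?G" by (rule fs.span_base) simp
  have factor: "\<exists>f\<in>?G. f v = 1 \<and> f u = 0" if u: "u \<in> Orb - {v}" for u
  proof -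
    obtain i where i: "u i \<noteq> v i" using u by (metis DiffE ext insertI1)
    then have iI: "i \<in> {1..n}" using permutes_not_in[of u "{1..n}" i] permutes_not_in[of v "{1..n}" i] u v
      by (auto simp: Orb_def)
    define f where "f = (\<lambda>w. (1 / (of_nat (v i) - of_nat (u i))) * (monf (\<lambda>j. of_bool (j = i)) + (\<lambda>w. - of_nat (u i) * monf (\<lambda>_. 0) w)) w)"
    have "f \<in> ?G" unfolding f_def
      by (intro fs.span_scale fs.span_add one) (rule fs.span_base, simp)
    moreover have m: "monf (\<lambda>j. of_bool (j = i)) w = of_nat (w i)" if "w \<in> Orb" for w
    proof -
      have "(\<Prod>j\<in>{1..n}. of_nat (w j) ^ of_bool (j = i)) = (\<Prod>j\<in>{1..n}. if j = i then of_nat (w j) else (1 :: complex))"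
        by (intro prod.cong refl) simp
      then show ?thesis using iI that by (simp add: monf_def)
    qed
    have "f v = 1" "f u = 0" using i u v m by (simp_all add: f_def monf_def)
    ultimately show ?thesis by blast
  qed
  then obtain f where f: "\<And>u. u \<in> Orb - {v} \<Longrightarrow> f u \<in> ?G \<and> f u v = 1 \<and> f u u = 0" by metis
  have P: "(\<lambda>w. (\<Prod>u\<in>U. f u w) * monf (\<lambda>_. 0) w) \<in> ?G" if "finite U" "U \<subseteq> Orb - {v}" for U
    using that
  proof (induction U rule: finite_induct)
    case empty
    then show ?case using one by simp
  next
    case (insert u U)
    have "(\<lambda>w. (\<Prod>u\<in>insert u U. f u w) * monf (\<lambda>_. 0) w) = f u * (\<lambda>w. (\<Prod>u\<in>U. f u w) * monf (\<lambda>_. 0) w)"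
      using insert by (simp add: fun_eq_iff)
    then show ?case using insert f[of u] by (simp add: mult)
  qed
  have "(\<lambda>w. (\<Prod>u\<in>Orb - {v}. f u w) * monf (\<lambda>_. 0) w) = delta v"
  proof
    fix w
    show "(\<Prod>u\<in>Orb - {v}. f u w) * monf (\<lambda>_. 0) w = delta v w"
    proof (cases "w = v")
      case True
      have "(\<Prod>u\<in>Orb - {v}. f u v) = 1" using f by (intro prod.neutral) blast
      then show ?thesis using True v by (simp add: delta_def monf_def)
    next
      case False
      then show ?thesis
        using f[of w] finite_Orb by (cases "w \<in> Orb") (auto simp: delta_def monf_def intro!: prod_zero)
    qed
  qed
  with P[of "Orb - {v}"] finite_Orb show ?thesis by simp
qed

lemma delta_independent: "fs.independent (delta ` Orb)" "inj_on delta Orb"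
proof -
  show inj: "inj_on delta Orb"
    by (rule inj_onI) (metis delta_def zero_neq_one)
  show "fs.independent (delta ` Orb)"
  proof (rule fs.independent_if_scalars_zero)
    show "finite (delta ` Orb)" using finite_Orb by simp
    fix c x assume eq: "(\<Sum>x\<in>delta ` Orb. (\<lambda>w. c x * x w)) = 0" and x: "x \<in> delta ` Orb"
    then obtain v where v: "v \<in> Orb" "x = delta v" by blast
    have "(\<Sum>x\<in>delta ` Orb. (\<lambda>w. c x * x w)) v = (\<Sum>u\<in>Orb. c (delta u) * delta u v)"
      by (simp add: sum.reindex[OF inj] sum_apply)
    also have "\<dots> = (\<Sum>u\<in>Orb. if u = v then c (delta v) else 0)"
      by (intro sum.cong refl) (auto simp: delta_def)
    also have "\<dots> = c x" using v finite_Orb by simp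
    finally show "c x = 0" using eq by simp
  qed
qed

text \<open>Take the component of degree \<open>d\<close> in an expression for a monomial of degree
  \<open>d\<close>. By homogeneity each \<open>b j\<close> contributes a multiple of one fixed
  function, and the part in the ideal has lower degree on the orbit. So induction on the degree
  shows that these at most \<open>card B\<close> functions span all functions on the orbit.\<close>

lemma card_spanning_ge:
  assumes B: "finite B"
    and hom: "\<And>j w d. j \<in> B \<Longrightarrow> w \<in> Orb \<Longrightarrow> d \<noteq> deg j \<Longrightarrow> Polynomial.coeff (line_eval w (b j)) d = 0"
    and span: "\<And>p. p \<in> polys n \<Longrightarrow> \<exists>c. p - (\<Sum>j\<in>B. const (c j) * b j) \<in> coinv_ideal n"
  shows "fact n \<le> card B"
proof -
  define v where "v j = comp (b j) (deg j)" for j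
  have vd: "comp (b j) d = (if d = deg j then v j else 0)" if "j \<in> B" for j d
    using hom[OF that] by (auto simp: v_def comp_def fun_eq_iff)
  let ?W = "fs.span (v ` B)"
  have FW: "F d \<subseteq> ?W" for d
  proof (induction d)
    case 0
    show ?case unfolding F_zero using fs.span_zero by blast
  next
    case (Suc d)
    have "monf e \<in> ?W" if "expo n e < Suc d" for e
    proof (cases "expo n e = d")
      case True
      obtain c where c: "zmon n e - (\<Sum>j\<in>B. const (c j) * b j) \<in> coinv_ideal n"
        using span[OF polys_zmon] by blast
      define h where "h = zmon n e - (\<Sum>j\<in>B. const (c j) * b j)"
      have "zmon n e = (\<Sum>j\<in>B. const (c j) * b j) + h" by (simp add: h_def)
      then have "comp (zmon n e) d = (\<Sum>j\<in>B. (\<lambda>w. c j * comp (b j) d w)) + comp h d"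
        by (simp only: comp_add comp_sum comp_const)
      then have "monf e = (\<Sum>j\<in>B. (\<lambda>w. c j * comp (b j) d w)) + comp h d"
        using True by (simp add: comp_zmon)
      moreover have "(\<Sum>j\<in>B. (\<lambda>w. c j * comp (b j) d w)) \<in> ?W"
      proof (intro fs.span_sum fs.span_scale)
        fix j assume "j \<in> B"
        then show "comp (b j) d \<in> ?W" using vd[of j d] by (auto intro: fs.span_base fs.span_zero)
      qed
      moreover have "comp h d \<in> ?W" using coinv_ideal_comp[OF c, of d] Suc by (auto simp: h_def)
      ultimately show ?thesis by (simp add: fs.span_add)
    next
      case False
      then show ?thesis using that monf_in_F[of e d] Suc by auto
    qed
    then show ?case unfolding F_def by (intro fs.span_minimal fs.subspace_span) auto
  qed
  have "monf e \<in> ?W" for e using FW[of "Suc (expo n e)"] monf_in_F[of e "Suc (expo n e)"] by auto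
  then have "fs.span (range monf) \<subseteq> ?W" by (intro fs.span_minimal fs.subspace_span) auto
  then have "delta ` Orb \<subseteq> ?W" using delta_in_span by blast
  then have "card (delta ` Orb) \<le> card (v ` B)"
    using fs.independent_span_bound[OF _ delta_independent(1)] B by blast
  also have "\<dots> \<le> card B" by (rule card_image_le[OF B])
  finally show ?thesis by (simp add: card_image[OF delta_independent(2)] card_Orb)
qed

end

section \<open>The group algebra\<close>

text \<open>
  The monoid of all maps on \<open>nat\<close>, written additively, so that the convolution product of
  \<open>poly_mapping\<close> is the product of its monoid algebra, which contains all the group algebras of
  the finite symmetric groups.
\<close>

typedef mfun = "UNIV :: (nat \<Rightarrow> nat) set" morphisms app mk ..

instantiation mfun :: monoid_add
begin
definition "zero_mfun = mk id"
definition "plus_mfun a b = mk (app a \<circ> app b)"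
instance
  by standard (simp_all add: zero_mfun_def plus_mfun_def mk_inverse app_inverse comp_assoc)
end

lemma app_mk [simp]: "app (mk f) = f"
  by (simp add: mk_inverse)

lemma mk_app [simp]: "mk (app x) = x"
  by (simp add: app_inverse)

lemma app_plus: "app (a + b) = app a \<circ> app b"
  by (simp add: plus_mfun_def)

lemma mk_comp: "mk (\<sigma> \<circ> \<tau>) = mk \<sigma> + mk \<tau>"
  by (simp add: plus_mfun_def)

lemma inj_app: "inj app"
  by (rule injI) (metis mk_app)

instantiation poly_mapping :: (type, real_vector) real_vector
begin

definition scaleR_poly_mapping :: "real \<Rightarrow> ('a \<Rightarrow>\<^sub>0 'b) \<Rightarrow> 'a \<Rightarrow>\<^sub>0 'b" where
  "scaleR_poly_mapping r = Poly_Mapping.map (scaleR r)"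

lemma lookup_scaleR: "Poly_Mapping.lookup (r *\<^sub>R p) k = r *\<^sub>R Poly_Mapping.lookup p k"
  by (simp add: scaleR_poly_mapping_def Poly_Mapping.map.rep_eq when_def)

instance
  by standard (auto intro!: poly_mapping_eqI simp: lookup_scaleR lookup_add scaleR_add_right scaleR_add_left)

end

lemma scaleR_eq_mult: "r *\<^sub>R p = Poly_Mapping.single 0 (of_real r) * p"
  for p :: "'a::monoid_add \<Rightarrow>\<^sub>0 'b::real_algebra_1"
proof -
  have "r *\<^sub>R p = Poly_Mapping.map ((*) (of_real r)) p"
    by (rule poly_mapping_eqI) (simp add: lookup_scaleR Poly_Mapping.map.rep_eq when_def scaleR_conv_of_real)
  then show ?thesis by (simp add: mult_map_scale_conv_mult)
qed

lemma single_zero_commute: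
  fixes p :: "'a::monoid_add \<Rightarrow>\<^sub>0 'b::semiring_0"
  assumes "\<And>b. c * b = b * c"
  shows "Poly_Mapping.single 0 c * p = p * Poly_Mapping.single 0 c"
  by (subst (1 2) poly_mapping_expand[of p])
    (simp add: sum_distrib_left sum_distrib_right mult_single assms)

instance poly_mapping :: (monoid_add, real_algebra_1) real_algebra_1
proof
  fix r and p q :: "'a \<Rightarrow>\<^sub>0 'b"
  show "r *\<^sub>R p * q = r *\<^sub>R (p * q)" by (simp add: scaleR_eq_mult mult.assoc)
  have "Poly_Mapping.single 0 (of_real r) * p = p * Poly_Mapping.single 0 (of_real r)"
    by (rule single_zero_commute) (simp add: of_real_def)
  then show "p * r *\<^sub>R q = r *\<^sub>R (p * q)" by (simp add: scaleR_eq_mult mult.assoc[symmetric])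
qed

type_synonym ga = "mfun \<Rightarrow>\<^sub>0 complex"

definition gel :: "(nat \<Rightarrow> nat) \<Rightarrow> ga" where "gel \<sigma> = Poly_Mapping.single (mk \<sigma>) 1"

text \<open>Complex scalars as elements of the algebra, whose own scalar multiplication is
  real.\<close>

definition sc :: "complex \<Rightarrow> ga" where "sc c = Poly_Mapping.single 0 c"

definition jm :: "nat \<Rightarrow> ga" where "jm k = (\<Sum>i\<in>{1..<k}. gel (transpose i k))"

lemma gel_id: "gel id = 1"
  by (simp add: gel_def zero_mfun_def[symmetric])

lemma gel_comp: "gel (\<sigma> \<circ> \<tau>) = gel \<sigma> * gel \<tau>"
  by (simp add: gel_def mult_single mk_comp)

lemma sc_simps: "sc 0 = 0" "sc 1 = 1" "sc (a + b) = sc a + sc b" "sc (a * b) = sc a * sc b" "sc (- a) = - sc a"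
  by (simp_all add: sc_def single_add mult_single single_uminus)

lemma scaleR_sc: "r *\<^sub>R a = sc (of_real r) * a" for a :: ga
  by (simp add: sc_def scaleR_eq_mult)

text \<open>Conjugation by \<open>\<pi>\<close> permutes the transpositions that \<open>jm j\<close>
  sums.\<close>

lemma gel_jm_commute:
  assumes bij: "bij \<pi>" and j: "\<pi> j = j" and img: "\<pi> ` {1..<j} = {1..<j}"
  shows "gel \<pi> * jm j = jm j * gel \<pi>"
proof -
  have "gel \<pi> * jm j = (\<Sum>b\<in>{1..<j}. gel (\<pi> \<circ> transpose b j))"
    by (simp add: jm_def sum_distrib_left gel_comp)
  also have "\<dots> = (\<Sum>b\<in>{1..<j}. gel (transpose (\<pi> b) j \<circ> \<pi>))"
  proof (intro sum.cong refl arg_cong[where f = gel])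
    fix b
    show "\<pi> \<circ> transpose b j = transpose (\<pi> b) j \<circ> \<pi>"
      using j inj_eq[OF bij_is_inj[OF bij]] by (auto simp: fun_eq_iff transpose_def)
  qed
  also have "\<dots> = (\<Sum>b\<in>\<pi> ` {1..<j}. gel (transpose b j \<circ> \<pi>))"
    by (subst sum.reindex[OF inj_on_subset[OF bij_is_inj[OF bij] subset_UNIV]]) simp
  also have "\<dots> = jm j * gel \<pi>" unfolding img by (simp add: jm_def sum_distrib_right gel_comp)
  finally show ?thesis .
qed

interpretation S: sym_algebra "\<lambda>i. gel (adj i)" jm gel
proof
  fix i :: nat
  show "gel (adj i) * gel (adj i) = 1" by (simp add: gel_comp[symmetric] gel_id)
  have "adj i \<circ> adj (Suc i) \<circ> adj i = adj (Suc i) \<circ> adj i \<circ> adj (Suc i)"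
    by (auto simp: fun_eq_iff transpose_def)
  then show "gel (adj i) * gel (adj (Suc i)) * gel (adj i) = gel (adj (Suc i)) * gel (adj i) * gel (adj (Suc i))"
    by (simp only: gel_comp[symmetric])
next
  show "jm (Suc 0) = 0" by (simp add: jm_def)
next
  fix i :: nat assume i: "1 \<le> i"
  have "adj i \<circ> transpose j i \<circ> adj i = transpose j (Suc i)" if "j \<in> {1..<i}" for j
    using that by (auto simp: fun_eq_iff transpose_def)
  then have "gel (adj i) * jm i * gel (adj i) = (\<Sum>j\<in>{1..<i}. gel (transpose j (Suc i)))"
    by (simp add: jm_def sum_distrib_left sum_distrib_right gel_comp[symmetric])
  then show "jm (Suc i) = gel (adj i) * jm i * gel (adj i) + gel (adj i)"
    using i by (simp add: jm_def[of "Suc i"] atLeastLessThanSuc)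
next
  \<comment> \<open>Every summand of \<open>jm i\<close> permutes \<open>{1..<j}\<close> and fixes
    \<open>j\<close>, so it commutes with \<open>jm j\<close>.\<close>
  have "jm i * jm j = jm j * jm i" if "1 \<le> i" "i < j" for i j
  proof -
    have "gel (transpose a i) * jm j = jm j * gel (transpose a i)" if "a \<in> {1..<i}" for a
      by (rule gel_jm_commute) (use that \<open>i < j\<close> in \<open>auto intro!: permutes_image[of "transpose a i" "{Suc 0..<j}"] permutes_swap_id\<close>)
    then show ?thesis by (simp add: jm_def[of i] sum_distrib_left sum_distrib_right)
  qed
  then show "jm i * jm j = jm j * jm i" if "1 \<le> i" "1 \<le> j" for i j
    using that by (metis linorder_neqE_nat)
next
  fix i j :: nat assume a: "1 \<le> i" "1 \<le> j" "j \<noteq> i" "j \<noteq> Suc i"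
  show "gel (adj i) * jm j = jm j * gel (adj i)"
  proof (rule gel_jm_commute)
    show "adj i j = j" using a by (simp add: transpose_def)
    show "adj i ` {1..<j} = {1..<j}"
    proof (cases "j < i")
      case True
      have "adj i ` {1..<j} = id ` {1..<j}" by (rule image_cong) (use True in \<open>auto simp: transpose_def\<close>)
      then show ?thesis by simp
    next
      case False
      then show ?thesis using a by (intro permutes_image permutes_swap_id) auto
    qed
  qed simp
qed (simp_all add: gel_id gel_comp)

text \<open>Injective, and multiplicative for every \<open>n\<close>, so identities in
  \<open>CS n\<close> can be checked in the ring \<open>ga\<close>.\<close>

definition emb :: "((nat \<Rightarrow> nat) \<Rightarrow>\<^sub>0 complex) \<Rightarrow> ga" where
  "emb = Poly_Mapping.map_key app"

lemma lookup_emb: "Poly_Mapping.lookup (emb a) x = Poly_Mapping.lookup a (app x)"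
  by (simp add: emb_def map_key.rep_eq[OF inj_app])

lemma emb_0 [simp]: "emb 0 = 0" and emb_add: "emb (a + b) = emb a + emb b"
  by (auto intro!: poly_mapping_eqI simp: lookup_emb lookup_add)

lemma emb_sum: "emb (\<Sum>i\<in>I. a i) = (\<Sum>i\<in>I. emb (a i))"
  by (induction I rule: infinite_finite_induct) (simp_all add: emb_add)

lemma emb_single: "emb (Poly_Mapping.single \<sigma> c) = Poly_Mapping.single (mk \<sigma>) c"
  by (rule poly_mapping_eqI) (auto simp: lookup_emb lookup_single when_def)

lemma emb_perm_elt: "emb (perm_elt \<sigma>) = gel \<sigma>"
  by (simp add: emb_single gel_def)

lemma inj_emb: "emb a = emb b \<Longrightarrow> a = b"
  by (rule poly_mapping_eqI) (metis app_mk lookup_emb)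

lemma emb_mult: "emb (a \<otimes>\<^bsub>CS n\<^esub> b) = emb a * emb b"
proof -
  have "emb (a \<otimes>\<^bsub>CS n\<^esub> b) = (\<Sum>x\<in>Poly_Mapping.keys a. \<Sum>y\<in>Poly_Mapping.keys b.
      emb (Poly_Mapping.single x (Poly_Mapping.lookup a x)) * emb (Poly_Mapping.single y (Poly_Mapping.lookup b y)))"
    by (simp add: group_algebra_def sym_group_def emb_sum emb_single mult_single mk_comp)
  also have "\<dots> = emb (\<Sum>x\<in>Poly_Mapping.keys a. Poly_Mapping.single x (Poly_Mapping.lookup a x)) *
      emb (\<Sum>y\<in>Poly_Mapping.keys b. Poly_Mapping.single y (Poly_Mapping.lookup b y))"
    by (simp add: emb_sum sum_product)
  finally show ?thesis by (simp only: poly_mapping_expand[symmetric])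
qed

lemma emb_one: "emb \<one>\<^bsub>CS n\<^esub> = 1"
  by (simp add: group_algebra_def sym_group_def emb_perm_elt gel_id)

lemma emb_smult: "emb (c \<odot>\<^bsub>CS n\<^esub> a) = sc c * emb a"
proof -
  have "emb (c \<odot>\<^bsub>CS n\<^esub> a) = Poly_Mapping.map ((*) c) (emb a)"
    by (rule poly_mapping_eqI) (simp add: group_algebra_def lookup_emb Poly_Mapping.map.rep_eq)
  then show ?thesis by (simp add: sc_def mult_map_scale_conv_mult)
qed

lemma emb_pow: "emb (a [^]\<^bsub>CS n\<^esub> (k::nat)) = emb a ^ k"
  by (induction k) (simp_all add: nat_pow_def emb_one emb_mult power_commutes)

lemma CS_add: "a \<oplus>\<^bsub>CS n\<^esub> b = a + b" and CS_zero: "\<zero>\<^bsub>CS n\<^esub> = 0"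
  by (simp_all add: group_algebra_def)

lemma emb_jm: "emb (jucys_murphy k) = jm k"
  by (simp add: jucys_murphy_def jm_def emb_sum emb_perm_elt)

lemma ev_altdef: "ev p x = (\<Sum>j\<le>degree p. Polynomial.coeff p j *\<^sub>R x ^ j)"
proof -
  have "ev p x = (\<Sum>j\<le>d. Polynomial.coeff p j *\<^sub>R x ^ j)" if "degree p \<le> d" for d
    using that
  proof (induction p arbitrary: d)
    case (pCons a p)
    show ?case
    proof (cases "p = 0")
      case True
      have "(\<Sum>j\<le>d. Polynomial.coeff [:a:] j *\<^sub>R x ^ j) = (\<Sum>j\<le>d. if j = 0 then of_real a else 0)"
        by (intro sum.cong refl) (auto simp: coeff_pCons of_real_def split: nat.split)
      then show ?thesis using True by simp
    next
      case False
      then obtain d' where d: "d = Suc d'" "degree p \<le> d'" using pCons.prems by (cases d) auto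
      have "(\<Sum>j\<le>d. Polynomial.coeff (pCons a p) j *\<^sub>R x ^ j) = of_real a + x * (\<Sum>j\<le>d'. Polynomial.coeff p j *\<^sub>R x ^ j)"
        unfolding d(1) sum.atMost_Suc_shift by (simp add: of_real_def sum_distrib_left)
      then show ?thesis using pCons.IH[OF d(2)] by simp
    qed
  qed simp
  then show ?thesis by blast
qed

lemma emb_eval: "emb (eval_in_CS n (map_poly of_real p) x) = ev p (emb x)"
proof -
  have deg: "degree (map_poly of_real p :: complex poly) = degree p" by (rule degree_map_poly) simp
  have sumemb: "emb (\<Sum>j\<le>d. f j) = (\<Sum>j\<le>d. emb (f j))" for d :: nat and f by (rule emb_sum)
  show ?thesis
    unfolding eval_in_CS_def deg ev_altdef sumemb
    by (intro sum.cong refl) (simp add: emb_smult emb_pow scaleR_sc coeff_map_poly)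
qed

section \<open>The action of the group algebra on polynomials\<close>

definition act :: "ga \<Rightarrow> mpoly \<Rightarrow> mpoly" where
  "act a p = pm_lift (\<lambda>x c. const c * perm_act (app x) p) a"

lemma act_add: "act (a + b) p = act a p + act b p"
  unfolding act_def by (rule pm_lift_add) (simp_all add: const_simps distrib_right)

lemma act_0 [simp]: "act 0 p = 0"
  by (simp add: act_def)

lemma act_sum: "act (\<Sum>i\<in>I. a i) p = (\<Sum>i\<in>I. act (a i) p)"
  by (induction I rule: infinite_finite_induct) (simp_all add: act_add)

lemma act_single: "act (Poly_Mapping.single x c) p = const c * perm_act (app x) p"
  unfolding act_def by (rule pm_lift_single) (simp add: const_simps)

lemma act_gel: "act (gel \<sigma>) p = perm_act \<sigma> p"
  by (simp add: gel_def act_single const_simps)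

lemma act_sc: "act (sc c) p = const c * p"
  by (simp add: sc_def act_single zero_mfun_def)

lemma act_1 [simp]: "act 1 p = p"
  using act_gel[of id p] by (simp add: gel_id)

lemma act_add_right: "act a (p + q) = act a p + act a q"
  by (simp add: act_def pm_lift_def perm.eval_add distrib_left sum.distrib)

lemma act_sum_right: "act a (\<Sum>i\<in>I. p i) = (\<Sum>i\<in>I. act a (p i))"
proof (induction I rule: infinite_finite_induct)
  case (insert x A)
  then show ?case by (simp add: act_add_right)
qed (simp_all add: act_def pm_lift_def perm.eval_0)

lemma act_mult: "act (a * b) p = act a (act b p)"
proof -
  have "act (Poly_Mapping.single x c * b) p = act (Poly_Mapping.single x c) (act b p)" for x c
    by (subst (1 2) poly_mapping_expand[of b])
      (simp add: sum_distrib_left mult_single act_sum act_single act_sum_right app_plus perm_act_comp const_simps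
        perm.eval_mult perm.eval_const perm.eval_sum mult.assoc)
  then show ?thesis
    by (subst (1 2) poly_mapping_expand[of a]) (simp add: sum_distrib_right act_sum)
qed

lemma act_uminus: "act (- a) p = - act a p"
  by (simp add: eq_neg_iff_add_eq_0 act_add[symmetric])

lemma act_diff: "act (a - b) p = act a p - act b p"
  using act_add[of a "- b" p] by (simp add: act_uminus)

lemma act_scaleR: "act (r *\<^sub>R a) p = const (of_real r) * act a p"
  by (simp add: scaleR_sc act_mult act_sc)

lemma alg_act_emb: "alg_act a p = act (emb a) p"
proof -
  have "act (emb a) p = (\<Sum>\<sigma>\<in>Poly_Mapping.keys a. act (emb (Poly_Mapping.single \<sigma> (Poly_Mapping.lookup a \<sigma>))) p)"
    by (subst poly_mapping_expand[of a]) (simp only: emb_sum act_sum)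
  then show ?thesis by (simp add: emb_single act_single alg_act_def)
qed

definition GA :: "nat \<Rightarrow> ga set" where
  "GA n = {a. \<forall>x\<in>Poly_Mapping.keys a. app x permutes {1..n}}"

lemma emb_carrier_iff: "emb a \<in> GA n \<longleftrightarrow> a \<in> carrier (CS n)"
proof -
  have "x \<in> Poly_Mapping.keys (emb a) \<longleftrightarrow> app x \<in> Poly_Mapping.keys a" for x by (simp add: in_keys_iff lookup_emb)
  then have "emb a \<in> GA n \<longleftrightarrow> (\<forall>x. app x \<in> Poly_Mapping.keys a \<longrightarrow> app x permutes {1..n})"
    unfolding GA_def by blast
  also have "\<dots> \<longleftrightarrow> (\<forall>\<sigma>. \<sigma> \<in> Poly_Mapping.keys a \<longrightarrow> \<sigma> permutes {1..n})" by (metis app_mk)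
  finally show ?thesis by (auto simp: group_algebra_def sym_group_def)
qed

lemma emb_surj: "\<exists>a. emb a = b"
proof
  show "emb (Poly_Mapping.map_key mk b) = b"
    by (rule poly_mapping_eqI) (simp add: lookup_emb map_key.rep_eq inj_def mk_inject)
qed

lemma GA_0: "0 \<in> GA n" and GA_1: "1 \<in> GA n" and GA_sc: "sc c \<in> GA n"
  using permutes_id[of "{1..n}"] by (auto simp: GA_def sc_def zero_mfun_def id_def)

lemma GA_gel: "\<sigma> permutes {1..n} \<Longrightarrow> gel \<sigma> \<in> GA n"
  by (simp add: GA_def gel_def)

lemma GA_add: "a \<in> GA n \<Longrightarrow> b \<in> GA n \<Longrightarrow> a + b \<in> GA n"
  using Poly_Mapping.keys_add[of a b] by (auto simp: GA_def)

lemma GA_mult: "a \<in> GA n \<Longrightarrow> b \<in> GA n \<Longrightarrow> a * b \<in> GA n"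
  using Poly_Mapping.keys_mult[of a b] by (fastforce simp: GA_def app_plus intro: permutes_compose)

lemma GA_scaleR: "a \<in> GA n \<Longrightarrow> r *\<^sub>R a \<in> GA n"
  by (simp add: scaleR_sc GA_mult GA_sc)

lemma GA_expand: "a = (\<Sum>x\<in>Poly_Mapping.keys a. sc (Poly_Mapping.lookup a x) * gel (app x))"
  by (subst poly_mapping_expand) (simp add: sc_def gel_def mult_single)

lemma polys_act: "a \<in> GA n \<Longrightarrow> p \<in> polys n \<Longrightarrow> act a p \<in> polys n"
  unfolding act_def pm_lift_def by (intro polys_sum polys_mult polys_const polys_perm_act) (auto simp: GA_def)

lemma coinv_ideal_act:
  assumes a: "a \<in> GA n" and p: "p \<in> coinv_ideal n"
  shows "act a p \<in> coinv_ideal n"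
proof -
  have sm: "(\<Sum>x\<in>I. f x) \<in> coinv_ideal n" if "\<And>x. x \<in> I \<Longrightarrow> f x \<in> coinv_ideal n" for I :: "mfun set" and f
    using that by (induction I rule: infinite_finite_induct) (simp_all add: coinv_ideal_0 coinv_ideal_add)
  show ?thesis
    unfolding act_def pm_lift_def
  proof (rule sm)
    fix x assume "x \<in> Poly_Mapping.keys a"
    then have "app x permutes {1..n}" using a by (simp add: GA_def)
    then show "const (Poly_Mapping.lookup a x) * perm_act (app x) p \<in> coinv_ideal n"
      by (intro coinv_ideal_mult polys_const coinv_ideal_perm_act p)
  qed
qed

section \<open>From tableaux to paths\<close>

definition path_of :: "nat \<Rightarrow> tableau \<Rightarrow> nat \<Rightarrow> box" where
  "path_of n T = rest n (box_of T)"

lemma map_poly_of_real_mult: "map_poly of_real (p * q) = (map_poly of_real p * map_poly of_real q :: complex poly)"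
  by (rule poly_eqI) (simp add: coeff_map_poly coeff_mult)

locale std_tableau =
  fixes n :: nat and T :: tableau
  assumes T: "T \<in> standard_tableaux n"
begin

lemma young: "young_diagram (dom T)"
  using T by (simp add: standard_tableaux_def)

lemma bij: "bij_betw (\<lambda>b. the (T b)) (dom T) {1..n}"
  using T by (simp add: standard_tableaux_def)

lemma box_of_eq: "T b = Some k \<Longrightarrow> box_of T k = b"
proof -
  assume b: "T b = Some k"
  have "b' = b" if "T b' = Some k" for b'
    using inj_onD[OF bij_betw_imp_inj_on[OF bij], of b' b] b that by auto
  then show ?thesis unfolding box_of_def using b by blast
qed

lemma T_box_of: "k \<in> {1..n} \<Longrightarrow> T (box_of T k) = Some k"
proof -
  assume "k \<in> {1..n}"
  then obtain b where "b \<in> dom T" "the (T b) = k"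
    unfolding bij_betw_imp_surj_on[OF bij, symmetric] by blast
  then have "T b = Some k" by auto
  then show ?thesis using box_of_eq by simp
qed

lemma T_range: "T b = Some k \<Longrightarrow> k \<in> {1..n}"
  using bij_betw_imp_surj_on[OF bij] by (metis domI imageI option.sel)

lemma dom_eq: "dom T = box_of T ` {1..n}"
proof (intro equalityI subsetI)
  fix b assume "b \<in> dom T"
  then obtain k where "T b = Some k" by blast
  then show "b \<in> box_of T ` {1..n}" using box_of_eq T_range by blast
next
  fix b assume "b \<in> box_of T ` {1..n}"
  then show "b \<in> dom T" using T_box_of by blast
qed

lemma mono: "T (r, c) = Some k \<Longrightarrow> r' \<le> r \<Longrightarrow> c' \<le> c \<Longrightarrow> \<exists>k'\<le>k. T (r', c') = Some k'"
proof -
  assume a: "T (r, c) = Some k" "r' \<le> r" "c' \<le> c"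
  have d: "(r, c) \<in> dom T" "(r', c) \<in> dom T" "(r', c') \<in> dom T"
    using a young_diagram_down[OF young, of r c] by auto
  have row: "the (T (r, c)) < the (T (r, c'))" if "(r, c) \<in> dom T" "(r, c') \<in> dom T" "c < c'" for r c c'
    using T that unfolding standard_tableaux_def by blast
  have col: "the (T (r, c)) < the (T (r', c))" if "(r, c) \<in> dom T" "(r', c) \<in> dom T" "r < r'" for r r' c
    using T that unfolding standard_tableaux_def by blast
  have "the (T (r', c)) \<le> the (T (r, c))"
    using col[OF d(2,1)] a(2) by (cases "r' = r") auto
  moreover have "the (T (r', c')) \<le> the (T (r', c))"
    using row[OF d(3,2)] a(3) by (cases "c' = c") auto
  ultimately have "the (T (r', c')) \<le> k" using a by simp
  then show ?thesis using d(3) by auto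
qed

lemma initial: "m \<le> n \<Longrightarrow> box_of T ` {1..m} = {b. \<exists>k\<le>m. T b = Some k}"
proof (intro Set.set_eqI iffI)
  fix b assume "m \<le> n" "b \<in> box_of T ` {1..m}"
  then show "b \<in> {b. \<exists>k\<le>m. T b = Some k}" using T_box_of by fastforce
next
  fix b assume "m \<le> n" "b \<in> {b. \<exists>k\<le>m. T b = Some k}"
  then obtain k where "k \<le> m" "T b = Some k" by blast
  then show "b \<in> box_of T ` {1..m}" using box_of_eq[of b k] T_range[of b k] by auto
qed

lemma young_initial:
  assumes "m \<le> n"
  shows "young_diagram (box_of T ` {1..m})"
proof -
  have "finite {b. \<exists>k\<le>m. T b = Some k}" unfolding initial[OF assms, symmetric] by simp
  moreover have "\<forall>(r, c)\<in>{b. \<exists>k\<le>m. T b = Some k}. \<forall>r'\<le>r. \<forall>c'\<le>c. (r', c') \<in> {b. \<exists>k\<le>m. T b = Some k}"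
    using mono by (fastforce intro: order_trans)
  ultimately show ?thesis unfolding initial[OF assms] young_diagram_def by blast
qed

lemma box_of_notin: "1 \<le> k \<Longrightarrow> k \<le> n \<Longrightarrow> box_of T k \<notin> box_of T ` {1..<k}"
proof
  assume k: "1 \<le> k" "k \<le> n" and "box_of T k \<in> box_of T ` {1..<k}"
  then obtain j where j: "1 \<le> j" "j < k" "box_of T j = box_of T k" by auto
  then show False using T_box_of[of j] T_box_of[of k] k by simp
qed

lemma is_path_box_of: "is_path n (box_of T)"
  unfolding is_path_def
proof
  fix k assume k: "k \<in> {1..n}"
  have "insert (box_of T k) (box_of T ` {1..<k}) = box_of T ` {1..k}"
  proof -
    have "{1..k} = insert k {1..<k}" using k by auto
    then show ?thesis by simp
  qed
  then show "box_of T k \<in> outer_corners (box_of T ` {1..<k})"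
    using young_initial[of k] box_of_notin[of k] k by (simp add: outer_corners_def)
qed

lemma path_of_in_paths: "path_of n T \<in> paths n"
  unfolding path_of_def by (rule rest_in_paths[OF is_path_box_of])

lemma path_of_image: "path_of n T ` {1..n} = dom T"
  unfolding dom_eq path_of_def by (intro image_cong) auto

lemma dom_subtableau: "1 \<le> k \<Longrightarrow> k \<le> n \<Longrightarrow> dom (subtableau T (k - 1)) = box_of T ` {1..<k}"
proof -
  assume k: "1 \<le> k" "k \<le> n"
  have "{1..<k} = {1..k - 1}" using k by auto
  then have "box_of T ` {1..<k} = {b. \<exists>j\<le>k - 1. T b = Some j}" using initial[of "k - 1"] k by simp
  then show ?thesis by (auto simp: subtableau_def restrict_map_def split: if_splits)
qed

lemma step_poly_eq:
  assumes k: "1 \<le> k" "k \<le> n"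
  shows "step_poly T k = map_poly of_real (lagrange_poly (path_of n T ` {1..<k}) (path_of n T k))"
proof -
  have im: "path_of n T ` {1..<k} = box_of T ` {1..<k}"
    unfolding path_of_def using k by (intro image_cong) auto
  have bk: "path_of n T k = box_of T k" unfolding path_of_def using k by simp
  have m: "map_poly of_real (\<Prod>b\<in>B. f b) = (\<Prod>b\<in>B. map_poly of_real (f b) :: complex poly)" for B :: "box set" and f
    by (induction B rule: infinite_finite_induct) (simp_all add: map_poly_of_real_mult)
  show ?thesis
    unfolding step_poly_def lagrange_poly_def im bk dom_subtableau[OF k] Let_def m
    by (intro prod.cong refl) (simp add: cnt_def map_poly_pCons)
qed

text \<open>The charge goes up exactly after a descent, since neighbouring positions never have
  equal contents.\<close>

lemma charge_eq: "1 \<le> i \<Longrightarrow> i \<le> n \<Longrightarrow>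
  charge T i = steps {j \<in> {1..<n}. content (path_of n T (Suc j)) < content (path_of n T j)} i"
proof (induction i)
  case (Suc i)
  let ?S = "{j \<in> {1..<n}. content (path_of n T (Suc j)) < content (path_of n T j)}"
  show ?case
  proof (cases i)
    case 0
    have "{j \<in> ?S. j < Suc 0} = {}" by auto
    then show ?thesis using 0 by (simp add: steps_def)
  next
    case (Suc j)
    have i: "1 \<le> i" "i < n" using Suc Suc.prems by auto
    have p: "path_of n T i = box_of T i" "path_of n T (Suc i) = box_of T (Suc i)"
      unfolding path_of_def using i by auto
    have "content (box_of T (Suc i)) \<noteq> content (box_of T i)" by (rule content_adjacent_neq[OF is_path_box_of i])
    then show ?thesis using Suc.IH i p steps_Suc[of ?S i] Suc by auto
  qed
qed simp

end

lemma path_of_inj: "inj_on (path_of n) (standard_tableaux n)"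
proof (rule inj_onI)
  fix T U assume T: "T \<in> standard_tableaux n" and U: "U \<in> standard_tableaux n" and eq: "path_of n T = path_of n U"
  interpret t: std_tableau n T by unfold_locales (rule T)
  interpret u: std_tableau n U by unfold_locales (rule U)
  have e: "box_of T k = box_of U k" if "k \<in> {1..n}" for k
    using fun_cong[OF eq, of k] that by (simp add: path_of_def)
  have "T b = Some k \<longleftrightarrow> U b = Some k" for b k
    using t.T_range[of b k] u.T_range[of b k] t.T_box_of[of k] u.T_box_of[of k] t.box_of_eq[of b k] u.box_of_eq[of b k] e[of k]
    by metis
  then show "T = U" by (metis not_Some_eq ext)
qed

text \<open>The tableau is the inverse of the path. It increases along rows and columns because a
  box weakly above and to the left of \<open>t j\<close> belongs to the diagram reached at step
  \<open>j\<close>, hence was added earlier.\<close>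

lemma path_of_surj:
  assumes t: "t \<in> paths n"
  shows "\<exists>T\<in>standard_tableaux n. path_of n T = t"
proof -
  have p: "is_path n t" using t by (rule paths_is_path)
  have inj: "inj_on t {1..n}" by (rule is_path_inj[OF p])
  define T where "T b = (if b \<in> t ` {1..n} then Some (inv_into {1..n} t b) else None)" for b
  have Tt: "T (t k) = Some k" if "k \<in> {1..n}" for k
    using that inj by (simp add: T_def inv_into_f_f)
  have dom: "dom T = t ` {1..n}" by (auto simp: T_def split: if_splits)
  have Tb: "T b = Some k \<longleftrightarrow> k \<in> {1..n} \<and> b = t k" for b k
    using Tt by (auto simp: T_def f_inv_into_f inv_into_into split: if_splits)
  have less: "the (T (r, c)) < the (T (r', c'))"
    if rc: "(r, c) \<in> dom T" "(r', c') \<in> dom T" "r \<le> r'" "c \<le> c'" "(r, c) \<noteq> (r', c')" for r c r' c'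
  proof -
    obtain i j where i: "i \<in> {1..n}" "(r, c) = t i" and j: "j \<in> {1..n}" "(r', c') = t j"
      using rc(1,2) unfolding dom by blast
    have "young_diagram (t ` {1..j})" using is_path_mono[OF p, of j] j by (intro is_path_young) auto
    then have "(r, c) \<in> t ` {1..j}" using young_diagram_down[of _ r' c' r c] rc(3,4) j by auto
    then obtain k where "k \<in> {1..j}" "t k = t i" using i by auto
    then have "i \<in> {1..j}" using inj_onD[OF inj, of k i] i j by auto
    moreover have "i \<noteq> j" using i j rc(5) by auto
    ultimately show ?thesis using Tt[OF i(1)] Tt[OF j(1)] i(2) j(2) by simp
  qed
  have "T \<in> standard_tableaux n"
    unfolding standard_tableaux_def mem_Collect_eq
  proof (intro conjI)
    show "young_diagram (dom T)" unfolding dom by (rule is_path_young[OF p])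
    show "bij_betw (\<lambda>b. the (T b)) (dom T) {1..n}"
      unfolding dom by (rule bij_betwI[where g = t]) (auto simp: Tt Tt[simplified])
    show "\<forall>r c c'. (r, c) \<in> dom T \<and> (r, c') \<in> dom T \<and> c < c' \<longrightarrow> the (T (r, c)) < the (T (r, c'))"
      using less by force
    show "\<forall>r r' c. (r, c) \<in> dom T \<and> (r', c) \<in> dom T \<and> r < r' \<longrightarrow> the (T (r, c)) < the (T (r', c))"
      using less by force
  qed
  moreover have "path_of n T = t"
  proof
    fix k
    show "path_of n T k = t k"
    proof (cases "k \<in> {1..n}")
      case True
      then have "box_of T k = t k" unfolding box_of_def using Tb by blast
      then show ?thesis using True by (simp add: path_of_def)
    next
      case False
      then show ?thesis using t by (auto simp: path_of_def rest_def paths_def)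
    qed
  qed
  ultimately show ?thesis by blast
qed

lemma path_of_bij: "bij_betw (path_of n) (standard_tableaux n) (paths n)"
proof -
  have "path_of n T \<in> paths n" if "T \<in> standard_tableaux n" for T
  proof -
    interpret std_tableau n T by unfold_locales (rule that)
    show ?thesis by (rule path_of_in_paths)
  qed
  then have "path_of n ` standard_tableaux n = paths n" using path_of_surj[of _ n] by blast
  then show ?thesis using path_of_inj by (simp add: bij_betw_def)
qed

lemma emb_tableau_proj:
  assumes T: "T \<in> standard_tableaux n"
  shows "emb (tableau_proj n T) = S.proj n (path_of n T)"
proof -
  interpret std_tableau n T by unfold_locales (rule T)
  define f where "f k = ev (lagrange_poly (path_of n T ` {1..<k}) (path_of n T k)) (jm k)" for k
  have f: "emb (eval_in_CS n (step_poly T k) (jucys_murphy k)) = f k" if "1 \<le> k" "k \<le> n" for k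
    unfolding step_poly_eq[OF that] emb_eval emb_jm f_def ..
  have 1: "emb (foldr (\<lambda>k a. eval_in_CS n (step_poly T k) (jucys_murphy k) \<otimes>\<^bsub>CS n\<^esub> a) ks \<one>\<^bsub>CS n\<^esub>) =
      prod_list (map f ks)" if "\<forall>k\<in>set ks. 1 \<le> k \<and> k \<le> n" for ks
    using that by (induction ks) (simp_all add: emb_one emb_mult f)
  have "prod_list (map f [2..<Suc m]) = S.proj m (path_of n T)" if "m \<le> n" for m
    using that
  proof (induction m)
    case (Suc m)
    have i: "{1..<Suc m} = {1..m}" by auto
    have fS: "f (Suc m) = ev (lagrange_poly (path_of n T ` {1..m}) (path_of n T (Suc m))) (jm (Suc m))"
      by (simp only: f_def i)
    show ?case
    proof (cases "m = 0")
      case True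
      \<comment> \<open>The product over \<open>k\<close> starts at 2, while \<open>proj\<close>
        also has a factor for step 1; that factor is 1, since (0, 0) is the only corner of the empty
        diagram.\<close>
      have "path_of n T 1 = (0, 0)"
        using is_path_corner[OF paths_is_path[OF path_of_in_paths], of 1] Suc.prems by simp
      then have "lagrange_poly {} (path_of n T 1) = 1" by (simp add: lagrange_poly_def)
      then show ?thesis using True by simp
    next
      case False
      then have "[2..<Suc (Suc m)] = [2..<Suc m] @ [Suc m]" by simp
      then show ?thesis using Suc fS by (simp only: map_append prod_list.append S.proj.simps) simp
    qed
  qed simp
  then show ?thesis unfolding tableau_proj_def by (subst 1) auto
qed

lemma sigma_permutation:
  assumes T: "T \<in> standard_tableaux n" and T': "T' \<in> standard_tableaux n"
    and \<tau>: "\<tau> permutes {1..n}" and eq: "path_of n T = path_of n T' \<circ> \<tau>"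
  shows "sigma n T T' = pinv \<tau>"
proof
  fix i
  interpret t: std_tableau n T by unfold_locales (rule T)
  interpret t': std_tableau n T' by unfold_locales (rule T')
  have inv: "pinv \<tau> permutes {1..n}" by (rule permutes_inv[OF \<tau>])
  show "sigma n T T' i = pinv \<tau> i"
  proof (cases "i \<in> {1..n}")
    case True
    define j where "j = pinv \<tau> i"
    have j: "j \<in> {1..n}" using permutes_in_image[OF inv] True by (simp add: j_def)
    have "\<tau> j = i" unfolding j_def by (rule surj_f_inv_f[OF permutes_surj[OF \<tau>]])
    then have "box_of T j = box_of T' i"
      using fun_cong[OF eq, of j] j True by (simp add: path_of_def)
    then show ?thesis using t.T_box_of[OF j] True by (simp add: sigma_def j_def)
  next
    case False
    then show ?thesis using permutes_not_in[OF inv False] by (simp only: sigma_def if_False)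
  qed
qed

lemma charge_monomial_eq:
  assumes T: "T \<in> standard_tableaux n"
  shows "charge_monomial n T =
    zmon n (steps {j \<in> {1..<n}. content (path_of n T (Suc j)) < content (path_of n T j)})"
proof -
  interpret std_tableau n T by unfold_locales (rule T)
  show ?thesis unfolding charge_monomial_def zmon_def
    by (intro prod.cong refl arg_cong2[where f = "(^)"] charge_eq) auto
qed

section \<open>The charge map\<close>

text \<open>With the whole ring as \<open>N\<close> the assumptions on \<open>N\<close> hold
  trivially; what is gained are the facts about the subalgebra, such as \<open>A_proj\<close>, for
  \<open>GA n\<close>.\<close>

interpretation trivial: descent_ideal "\<lambda>i. gel (adj i)" jm gel n "{}" "\<lambda>_. 0" "GA n" UNIV for n
  by unfold_locales (simp_all add: GA_1 GA_add GA_mult GA_scaleR GA_gel adj_permutes[unfolded One_nat_def])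

lemma GA_proj: "S.proj n t \<in> GA n"
  by (rule trivial.A_proj) simp

definition des :: "nat \<Rightarrow> (nat \<Rightarrow> box) \<Rightarrow> nat set" where
  "des n t = {j \<in> {1..<n}. content (t (Suc j)) < content (t j)}"

definition zch :: "nat \<Rightarrow> (nat \<Rightarrow> box) \<Rightarrow> mpoly" where
  "zch n t = zmon n (steps (des n t))"

text \<open>On the left ideal of \<open>proj n t\<close> only the summand of \<open>t\<close>
  survives, see \<open>Chg_proj\<close>, so one formula glues the maps Ch_T.\<close>

definition Chg :: "nat \<Rightarrow> ga \<Rightarrow> mpoly" where
  "Chg n a = (\<Sum>t\<in>paths n. act (a * S.proj n t) (zch n t))"

lemma Chg_add: "Chg n (a + b) = Chg n a + Chg n b"
  by (simp add: Chg_def distrib_right act_add sum.distrib)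

lemma Chg_mult: "Chg n (a * b) = act a (Chg n b)"
  by (simp add: Chg_def act_sum_right mult.assoc act_mult)

lemma Chg_sc: "Chg n (sc c * a) = const c * Chg n a"
  by (simp add: Chg_mult act_sc)

lemma Chg_0: "Chg n 0 = 0"
  by (simp add: Chg_def)

lemma Chg_sum: "Chg n (\<Sum>i\<in>I. f i) = (\<Sum>i\<in>I. Chg n (f i))"
  by (induction I rule: infinite_finite_induct) (simp_all add: Chg_add Chg_0)

lemma Chg_proj:
  assumes t: "t \<in> paths n"
  shows "Chg n (a * S.proj n t) = act (a * S.proj n t) (zch n t)"
proof -
  have "act (a * S.proj n t * S.proj n u) (zch n u) = (if u = t then act (a * S.proj n t) (zch n t) else 0)"
    if "u \<in> paths n" for u
    using S.proj_mult[OF t that] by (simp add: mult.assoc)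
  then show ?thesis using t by (simp add: Chg_def finite_paths cong: sum.cong)
qed

lemma polys_Chg: "a \<in> GA n \<Longrightarrow> Chg n a \<in> polys n"
  unfolding Chg_def zch_def by (intro polys_sum polys_act GA_mult GA_proj polys_zmon)

definition Limg :: "nat \<Rightarrow> mpoly set" where
  "Limg n = {Chg n a + p |a p. a \<in> GA n \<and> p \<in> coinv_ideal n}"

lemma LimgI: "a \<in> GA n \<Longrightarrow> p \<in> coinv_ideal n \<Longrightarrow> Chg n a + p \<in> Limg n"
  by (auto simp: Limg_def)

lemma Limg_act: "a \<in> GA n \<Longrightarrow> p \<in> Limg n \<Longrightarrow> act a p \<in> Limg n"
proof -
  assume a: "a \<in> GA n" and "p \<in> Limg n"
  then obtain b i where p: "p = Chg n b + i" "b \<in> GA n" "i \<in> coinv_ideal n" by (auto simp: Limg_def)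
  show ?thesis
    using LimgI[OF GA_mult[OF a p(2)] coinv_ideal_act[OF a p(3)]] unfolding p(1) act_add_right Chg_mult .
qed

lemma Limg_add: "p \<in> Limg n \<Longrightarrow> q \<in> Limg n \<Longrightarrow> p + q \<in> Limg n"
proof -
  assume "p \<in> Limg n" "q \<in> Limg n"
  then obtain a i b j where "p = Chg n a + i" "q = Chg n b + j" "a \<in> GA n" "b \<in> GA n" "i \<in> coinv_ideal n" "j \<in> coinv_ideal n"
    by (auto simp: Limg_def)
  then show ?thesis using LimgI[OF GA_add[of a n b] coinv_ideal_add[of i n j]] by (simp add: Chg_add algebra_simps)
qed

lemma Limg_0: "0 \<in> Limg n"
  using LimgI[OF GA_0 coinv_ideal_0] by (simp add: Chg_0)

lemma act_sym_sum: "act (S.sym_sum a b) p = (\<Sum>w | w permutes {a..b}. perm_act w p)"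
  by (simp add: S.sym_sum_def act_sum act_gel)

lemma Limg_submodule: "coinv_submodule n (Limg n)"
proof
  show "coinv_ideal n \<subseteq> Limg n" using LimgI[OF GA_0] by (auto simp: Chg_0)
  show "const c * p \<in> Limg n" if "p \<in> Limg n" for c p using Limg_act[OF GA_sc that] by (simp add: act_sc)
  show "perm_act \<sigma> p \<in> Limg n" if "\<sigma> permutes {1..n}" "p \<in> Limg n" for \<sigma> p
    using Limg_act[OF GA_gel that(2)] that(1) by (simp add: act_gel)
next
  fix D assume D: "D \<subseteq> {1..<n}"
    and Y: "\<And>k. k \<in> D \<Longrightarrow> \<exists>a b. 1 \<le> a \<and> a \<le> k \<and> k < b \<and> b \<le> n \<and> (\<forall>i. a \<le> i \<and> i < b \<and> i \<noteq> k \<longrightarrow> i \<notin> D) \<and>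
      (\<Sum>w | w permutes {a..b}. perm_act w (zmon n (steps D))) \<in> Limg n"
  have fin: "finite D" using D finite_subset by blast
  define z where "z = zmon n (steps D)"
  define N where "N = {a. act a z \<in> Limg n}"
  interpret descent_ideal "\<lambda>i. gel (adj i)" jm gel n D "steps D" "GA n" N
  proof
    fix i assume i: "1 \<le> i" "i < n" "i \<notin> D"
    \<comment> \<open>Since \<open>i \<notin> D\<close>, the exponents at \<open>i\<close> and
      \<open>Suc i\<close> agree.\<close>
    have "steps D k = steps D (adj i k)" for k
      using steps_Suc[OF fin, of i] i(3) by (auto simp: transpose_def)
    then have "perm_act (adj i) z = z"
      unfolding z_def by (intro perm_act_zmon adj_permutes i) auto
    then show "gel (adj i) - 1 \<in> N" by (simp add: N_def act_diff act_gel Limg_0)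
  next
    fix t assume t: "t \<in> paths n"
      and d: "\<And>i. 1 \<le> i \<Longrightarrow> i < n \<Longrightarrow> i \<in> D \<longleftrightarrow> content (t (Suc i)) < content (t i)"
    \<comment> \<open>A path with descent set \<open>D\<close> has \<open>z\<close> as its charge
      monomial, so \<open>act (S.proj n t) z\<close> is a value of the charge map.\<close>
    have "des n t = D" using d D by (auto simp: des_def)
    then have "Chg n (S.proj n t) = act (S.proj n t) z"
      using Chg_proj[OF t, of 1] by (simp add: zch_def z_def)
    then show "S.proj n t \<in> N" using LimgI[OF GA_proj coinv_ideal_0, of n t] by (simp add: N_def)
  next
    fix k assume "k \<in> D"
    then show "\<exists>a b. 1 \<le> a \<and> a \<le> k \<and> k < b \<and> b \<le> n \<and> (\<forall>i. a \<le> i \<and> i < b \<and> i \<noteq> k \<longrightarrow> i \<notin> D) \<and> S.sym_sum a b \<in> N"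
      unfolding N_def mem_Collect_eq act_sym_sum z_def by (rule Y)
  qed (use D in \<open>auto simp: N_def GA_1 GA_add GA_mult GA_scaleR GA_gel adj_permutes[unfolded One_nat_def]
      act_add Limg_add Limg_0 act_mult Limg_act steps_Suc[OF fin] act_scaleR act_sc[symmetric] GA_sc\<close>)
  show "zmon n (steps D) \<in> Limg n" using one_in_N by (simp add: N_def z_def)
qed (rule Limg_add)

lemma Chg_surj:
  assumes "p \<in> polys n"
  shows "\<exists>a\<in>GA n. p - Chg n a \<in> coinv_ideal n"
proof -
  have "p \<in> Limg n" by (rule coinv_submodule.polys_in_L[OF Limg_submodule assms])
  then obtain a i where "p = Chg n a + i" "a \<in> GA n" "i \<in> coinv_ideal n" by (auto simp: Limg_def)
  then show ?thesis by (intro bexI[of _ a]) simp_all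
qed

section \<open>The images of the weight vectors span the coinvariants and are independent\<close>

definition wpairs :: "nat \<Rightarrow> ((nat \<Rightarrow> box) \<times> (nat \<Rightarrow> nat)) set" where
  "wpairs n = (SIGMA t:paths n. {\<tau>. \<tau> permutes {1..n} \<and> t \<circ> \<tau> \<in> paths n})"

lemma finite_wpairs: "finite (wpairs n)"
  unfolding wpairs_def
  by (intro finite_SigmaI finite_paths) (rule finite_subset[OF _ finite_permutations[of "{1..n}"]], auto)

lemma wpairs_bij: "bij_betw (\<lambda>(t, \<tau>). (t, t \<circ> \<tau>)) (wpairs n)
    {(t, u). t \<in> paths n \<and> u \<in> paths n \<and> t ` {1..n} = u ` {1..n}}"
  unfolding bij_betw_def
proof (intro conjI equalityI subsetI)
  show "inj_on (\<lambda>(t, \<tau>). (t, t \<circ> \<tau>)) (wpairs n)"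
    by (rule inj_onI) (auto simp: wpairs_def dest: paths_comp_inj)
next
  fix x assume "x \<in> (\<lambda>(t, \<tau>). (t, t \<circ> \<tau>)) ` wpairs n"
  then obtain t \<tau> where x: "x = (t, t \<circ> \<tau>)" "t \<in> paths n" "\<tau> permutes {1..n}" "t \<circ> \<tau> \<in> paths n"
    by (auto simp: wpairs_def)
  moreover have "(t \<circ> \<tau>) ` {1..n} = t ` {1..n}" using permutes_image[OF x(3)] by (simp only: image_comp[symmetric])
  ultimately show "x \<in> {(t, u). t \<in> paths n \<and> u \<in> paths n \<and> t ` {1..n} = u ` {1..n}}" by simp
next
  fix x assume "x \<in> {(t, u). t \<in> paths n \<and> u \<in> paths n \<and> t ` {1..n} = u ` {1..n}}"
  then obtain t u where x: "x = (t, u)" "t \<in> paths n" "u \<in> paths n" "t ` {1..n} = u ` {1..n}" by blast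
  obtain \<tau> where \<tau>: "\<tau> permutes {1..n}" "\<And>k. k \<in> {1..n} \<Longrightarrow> u k = t (\<tau> k)"
    using same_shape_permutes[OF paths_is_path[OF x(2)] paths_is_path[OF x(3)] x(4)] by blast
  have "u = t \<circ> \<tau>"
  proof
    fix k
    show "u k = (t \<circ> \<tau>) k"
      using \<tau>(2)[of k] permutes_not_in[OF \<tau>(1), of k] x(2,3) by (cases "k \<in> {1..n}") (auto simp: paths_def)
  qed
  then show "x \<in> (\<lambda>(t, \<tau>). (t, t \<circ> \<tau>)) ` wpairs n" using x \<tau>(1) by (auto simp: wpairs_def image_iff)
qed

lemma card_wpairs: "card (wpairs n) = fact n"
  using bij_betw_same_card[OF wpairs_bij] card_same_shape_paths by simp

lemma GA_span_wvec:
  assumes a: "a \<in> GA n"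
  shows "\<exists>c. a = (\<Sum>(t, \<tau>)\<in>wpairs n. sc (c (t, \<tau>)) * S.wvec n t \<tau>)"
proof -
  define T where "T t = {\<tau>. \<tau> permutes {1..n} \<and> t \<circ> \<tau> \<in> paths n}" for t :: "nat \<Rightarrow> box"
  have finT: "finite (T t)" for t unfolding T_def
    by (rule finite_subset[OF _ finite_permutations[of "{1..n}"]]) auto
  define W where "W t = {x. \<exists>c. x = (\<Sum>\<tau>\<in>T t. sc (c \<tau>) * S.wvec n t \<tau>)}" for t
  have W0: "0 \<in> W t" for t unfolding W_def by (intro CollectI exI[of _ "\<lambda>_. 0"]) (simp add: sc_simps)
  have Wadd: "x + y \<in> W t" if xy: "x \<in> W t" "y \<in> W t" for x y t
  proof -
    obtain c d where "x = (\<Sum>\<tau>\<in>T t. sc (c \<tau>) * S.wvec n t \<tau>)" "y = (\<Sum>\<tau>\<in>T t. sc (d \<tau>) * S.wvec n t \<tau>)"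
      using xy unfolding W_def by blast
    then have "x + y = (\<Sum>\<tau>\<in>T t. sc (c \<tau> + d \<tau>) * S.wvec n t \<tau>)"
      by (simp add: sc_simps distrib_right sum.distrib)
    then show ?thesis unfolding W_def by (intro CollectI exI[of _ "\<lambda>\<tau>. c \<tau> + d \<tau>"])
  qed
  have Wsc: "sc k * x \<in> W t" if xy: "x \<in> W t" for k x t
  proof -
    obtain c where "x = (\<Sum>\<tau>\<in>T t. sc (c \<tau>) * S.wvec n t \<tau>)" using xy unfolding W_def by blast
    then have "sc k * x = (\<Sum>\<tau>\<in>T t. sc (k * c \<tau>) * S.wvec n t \<tau>)"
      by (simp add: sc_simps sum_distrib_left mult.assoc)
    then show ?thesis unfolding W_def by (intro CollectI exI[of _ "\<lambda>\<tau>. k * c \<tau>"])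
  qed
  have Wsum: "(\<Sum>i\<in>I. f i) \<in> W t" if "\<And>i. i \<in> I \<Longrightarrow> f i \<in> W t" for I :: "mfun set" and f t
    using that by (induction I rule: infinite_finite_induct) (simp_all add: W0 Wadd)
  have Wvec: "S.wvec n t \<tau> \<in> W t" if \<tau>: "\<tau> \<in> T t" for t \<tau>
  proof -
    have "(\<Sum>\<rho>\<in>T t. sc (of_bool (\<rho> = \<tau>)) * S.wvec n t \<rho>) = (\<Sum>\<rho>\<in>T t. if \<rho> = \<tau> then S.wvec n t \<tau> else 0)"
      by (intro sum.cong refl) (simp add: sc_simps)
    also have "\<dots> = S.wvec n t \<tau>" using \<tau> finT by simp
    finally show ?thesis unfolding W_def by (intro CollectI exI[of _ "\<lambda>\<rho>. of_bool (\<rho> = \<tau>)"]) simp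
  qed
  \<comment> \<open>\<open>g_proj_span\<close> speaks of the real span, which is contained in the
    complex span \<open>W t\<close>.\<close>
  have span: "Real_Vector_Spaces.span (S.vecs n t) \<subseteq> W t" for t
  proof (rule Real_Vector_Spaces.span_minimal)
    show "S.vecs n t \<subseteq> W t" using Wvec by (auto simp: S.vecs_def T_def)
    show "Real_Vector_Spaces.subspace (W t)" unfolding Real_Vector_Spaces.subspace_def scaleR_sc using W0 Wadd Wsc by blast
  qed
  have aW: "a * S.proj n t \<in> W t" if t: "t \<in> paths n" for t
  proof -
    have "gel (app x) * S.proj n t \<in> W t" if "x \<in> Poly_Mapping.keys a" for x
    proof -
      have p: "app x permutes {1..n}" using a that by (simp add: GA_def)
      have "pinv (pinv (app x)) = app x" by (rule inv_inv_eq[OF permutes_bij[OF p]])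
      then have "gel (app x) * S.proj n t \<in> Real_Vector_Spaces.span (S.vecs n t)"
        using S.g_proj_span[OF t permutes_inv[OF p]] by simp
      then show ?thesis by (rule subsetD[OF span])
    qed
    then have "(\<Sum>x\<in>Poly_Mapping.keys a. sc (Poly_Mapping.lookup a x) * (gel (app x) * S.proj n t)) \<in> W t"
      by (intro Wsum Wsc)
    moreover have "(\<Sum>x\<in>Poly_Mapping.keys a. sc (Poly_Mapping.lookup a x) * (gel (app x) * S.proj n t)) = a * S.proj n t"
      using arg_cong[OF GA_expand[of a], of "\<lambda>y. y * S.proj n t"] by (simp only: sum_distrib_right mult.assoc)
    ultimately show ?thesis by simp
  qed
  then have "\<forall>t\<in>paths n. \<exists>c. a * S.proj n t = (\<Sum>\<tau>\<in>T t. sc (c \<tau>) * S.wvec n t \<tau>)"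
    unfolding W_def by blast
  from bchoice[OF this] obtain c where c: "\<And>t. t \<in> paths n \<Longrightarrow> a * S.proj n t = (\<Sum>\<tau>\<in>T t. sc (c t \<tau>) * S.wvec n t \<tau>)"
    by blast
  have "a = (\<Sum>t\<in>paths n. a * S.proj n t)" by (simp add: sum_distrib_left[symmetric] S.sum_proj)
  also have "\<dots> = (\<Sum>t\<in>paths n. \<Sum>\<tau>\<in>T t. sc (c t \<tau>) * S.wvec n t \<tau>)" by (intro sum.cong refl c)
  also have "\<dots> = (\<Sum>(t, \<tau>)\<in>wpairs n. sc (c t \<tau>) * S.wvec n t \<tau>)"
    unfolding wpairs_def T_def[symmetric] using finT finite_paths by (intro sum.Sigma) auto
  finally show ?thesis by (intro exI[of _ "\<lambda>(t, \<tau>). c t \<tau>"]) simp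
qed

definition wimg :: "nat \<Rightarrow> (nat \<Rightarrow> box) \<times> (nat \<Rightarrow> nat) \<Rightarrow> mpoly" where
  "wimg n = (\<lambda>(t, \<tau>). Chg n (S.wvec n t \<tau>))"

lemma wimg_act: "t \<in> paths n \<Longrightarrow> wimg n (t, \<tau>) = act (S.wvec n t \<tau>) (zch n t)"
  using Chg_proj[of t n "S.wvec n t \<tau>"] by (simp add: wimg_def S.wvec_proj)

lemma wimg_span:
  assumes "p \<in> polys n"
  shows "\<exists>c. p - (\<Sum>j\<in>wpairs n. const (c j) * wimg n j) \<in> coinv_ideal n"
proof -
  obtain a where a: "a \<in> GA n" "p - Chg n a \<in> coinv_ideal n" using Chg_surj[OF assms] by blast
  obtain c where "a = (\<Sum>(t, \<tau>)\<in>wpairs n. sc (c (t, \<tau>)) * S.wvec n t \<tau>)" using GA_span_wvec[OF a(1)] by blast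
  then have "Chg n a = (\<Sum>j\<in>wpairs n. const (c j) * wimg n j)"
    by (simp add: Chg_sum Chg_sc wimg_def split_def)
  with a(2) show ?thesis by metis
qed

lemma wimg_homogeneous:
  assumes j: "j \<in> wpairs n" and d: "d \<noteq> expo n (steps (des n (fst j)))"
  shows "Polynomial.coeff (line_eval w (wimg n j)) d = 0"
proof -
  obtain t \<tau> where jt: "j = (t, \<tau>)" by fastforce
  then have t: "t \<in> paths n" using j by (simp add: wpairs_def)
  have "Polynomial.coeff (line_eval w (const c * perm_act \<sigma> (zch n t))) d = 0" for c \<sigma>
    using d by (simp add: line.eval_mult line.eval_const line_eval_perm_act zch_def line_eval_zmon jt)
  then show ?thesis
    unfolding jt wimg_act[OF t] act_def pm_lift_def line.eval_sum coeff_sum by (intro sum.neutral) blast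
qed

text \<open>A linear relation would leave a spanning family of fewer than \<open>fact n\<close> homogeneous elements.\<close>

lemma wimg_independent:
  assumes rel: "(\<Sum>j\<in>wpairs n. const (c j) * wimg n j) \<in> coinv_ideal n" and k: "k \<in> wpairs n"
  shows "c k = 0"
proof (rule ccontr)
  assume ck: "c k \<noteq> 0"
  interpret orbit_functions n .
  let ?B = "wpairs n - {k}"
  have "fact n \<le> card ?B"
  proof (rule card_spanning_ge[where b = "wimg n" and deg = "\<lambda>j. expo n (steps (des n (fst j)))"])
    show "finite ?B" using finite_wpairs by simp
    show "Polynomial.coeff (line_eval w (wimg n j)) d = 0"
      if "j \<in> ?B" "d \<noteq> expo n (steps (des n (fst j)))" for j w d
      using that by (intro wimg_homogeneous) auto
    fix p assume "p \<in> polys n"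
    then obtain e where e: "p - (\<Sum>j\<in>wpairs n. const (e j) * wimg n j) \<in> coinv_ideal n" using wimg_span by blast
    \<comment> \<open>The multiple of the relation that cancels the term of
      \<open>k\<close>.\<close>
    define r where "r = e k / c k"
    have "(p - (\<Sum>j\<in>wpairs n. const (e j) * wimg n j)) + const r * (\<Sum>j\<in>wpairs n. const (c j) * wimg n j) \<in> coinv_ideal n"
      by (intro coinv_ideal_add e coinv_ideal_mult polys_const rel)
    also have "(p - (\<Sum>j\<in>wpairs n. const (e j) * wimg n j)) + const r * (\<Sum>j\<in>wpairs n. const (c j) * wimg n j) =
        p - (\<Sum>j\<in>wpairs n. const (e j - r * c j) * wimg n j)"
      by (simp add: sum_distrib_left diff_conv_add_uminus const_simps distrib_right sum.distrib sum_negf mult.assoc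
          del: add_uminus_conv_diff)
    also have "(\<Sum>j\<in>wpairs n. const (e j - r * c j) * wimg n j) = (\<Sum>j\<in>?B. const (e j - r * c j) * wimg n j)"
      using sum.remove[OF finite_wpairs k, of "\<lambda>j. const (e j - r * c j) * wimg n j"] ck
      by (simp add: r_def const_simps)
    finally show "\<exists>c. p - (\<Sum>j\<in>?B. const (c j) * wimg n j) \<in> coinv_ideal n"
      by (rule exI[of _ "\<lambda>j. e j - r * c j"])
  qed
  also have "card ?B < card (wpairs n)" using k finite_wpairs by (intro psubset_card_mono) auto
  finally show False by (simp add: card_wpairs)
qed

lemma Chg_inj:
  assumes a: "a \<in> GA n" and I: "Chg n a \<in> coinv_ideal n"
  shows "a = 0"
proof -
  obtain c where c: "a = (\<Sum>(t, \<tau>)\<in>wpairs n. sc (c (t, \<tau>)) * S.wvec n t \<tau>)" using GA_span_wvec[OF a] by blast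
  then have "Chg n a = (\<Sum>j\<in>wpairs n. const (c j) * wimg n j)"
    by (simp add: Chg_sum Chg_sc wimg_def split_def)
  then have "c j = 0" if "j \<in> wpairs n" for j using wimg_independent[of c n j] I that by simp
  then show ?thesis unfolding c by (intro sum.neutral) (auto simp: sc_simps)
qed

section \<open>Identification of the charge map\<close>

lemma zch_path_of: "T \<in> standard_tableaux n \<Longrightarrow> zch n (path_of n T) = charge_monomial n T"
  unfolding zch_def des_def by (simp only: charge_monomial_eq)

lemma path_of_in_paths: "T \<in> standard_tableaux n \<Longrightarrow> path_of n T \<in> paths n"
  using bij_betwE[OF path_of_bij] by blast

lemma finite_standard_tableaux: "finite (standard_tableaux n)"
  using bij_betw_finite[OF path_of_bij] finite_paths by blast

lemma tableau_proj_carrier: "T \<in> standard_tableaux n \<Longrightarrow> tableau_proj n T \<in> carrier (CS n)"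
  by (subst emb_carrier_iff[symmetric]) (simp add: emb_tableau_proj GA_proj)

lemma CS_mult_carrier: "a \<in> carrier (CS n) \<Longrightarrow> b \<in> carrier (CS n) \<Longrightarrow> a \<otimes>\<^bsub>CS n\<^esub> b \<in> carrier (CS n)"
  by (simp only: emb_carrier_iff[symmetric] emb_mult GA_mult)

lemma CS_smult_carrier: "a \<in> carrier (CS n) \<Longrightarrow> c \<odot>\<^bsub>CS n\<^esub> a \<in> carrier (CS n)"
  by (simp only: emb_carrier_iff[symmetric] emb_smult GA_mult GA_sc)

lemma CS_add_carrier: "a \<in> carrier (CS n) \<Longrightarrow> b \<in> carrier (CS n) \<Longrightarrow> a + b \<in> carrier (CS n)"
  by (simp only: emb_carrier_iff[symmetric] emb_add GA_add)

lemma CS_0_carrier: "0 \<in> carrier (CS n)"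
  by (simp only: emb_carrier_iff[symmetric] emb_0 GA_0)

lemma CS_sum_carrier: "(\<And>i. i \<in> I \<Longrightarrow> f i \<in> carrier (CS n)) \<Longrightarrow> (\<Sum>i\<in>I. f i) \<in> carrier (CS n)"
  by (induction I rule: infinite_finite_induct) (simp_all add: CS_0_carrier CS_add_carrier)

lemma sum_tableau_proj: "(\<Sum>T\<in>standard_tableaux n. a \<otimes>\<^bsub>CS n\<^esub> tableau_proj n T) = a"
proof (rule inj_emb)
  have "emb (\<Sum>T\<in>standard_tableaux n. a \<otimes>\<^bsub>CS n\<^esub> tableau_proj n T) =
      (\<Sum>T\<in>standard_tableaux n. emb a * S.proj n (path_of n T))"
    unfolding emb_sum by (rule sum.cong) (simp_all add: emb_mult emb_tableau_proj)
  also have "\<dots> = (\<Sum>t\<in>paths n. emb a * S.proj n t)"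
    by (rule sum.reindex_bij_betw[OF path_of_bij])
  also have "\<dots> = emb a"
    by (simp add: sum_distrib_left[symmetric] S.sum_proj)
  finally show "emb (\<Sum>T\<in>standard_tableaux n. a \<otimes>\<^bsub>CS n\<^esub> tableau_proj n T) = emb a" .
qed

lemma Chg_V_of:
  assumes T: "T \<in> standard_tableaux n" and a: "a \<in> V_of n T"
  shows "Chg n (emb a) = alg_act a (charge_monomial n T)"
proof -
  obtain x where x: "a = x \<otimes>\<^bsub>CS n\<^esub> tableau_proj n T" using a by (auto simp: V_of_def)
  have "emb a = emb x * S.proj n (path_of n T)" unfolding x emb_mult by (simp add: emb_tableau_proj[OF T])
  then show ?thesis
    using Chg_proj[OF path_of_in_paths[OF T], of "emb x"] by (simp only: alg_act_emb zch_path_of[OF T])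
qed

lemma V_of_carrier: "T \<in> standard_tableaux n \<Longrightarrow> a \<in> V_of n T \<Longrightarrow> a \<in> carrier (CS n)"
  by (auto simp only: V_of_def mem_Collect_eq intro: CS_mult_carrier tableau_proj_carrier)

text \<open>Existence is the formula \<open>Chg\<close>. Uniqueness holds because every
  \<open>a\<close> is the sum of its products with the projectors, these lie in the left ideals on
  which the values are prescribed, and the map is additive.\<close>

lemma charge_map_eq:
  assumes a: "a \<in> carrier (CS n)"
  shows "charge_map n a = Chg n (emb a)"
proof -
  define f0 where "f0 = restrict (\<lambda>a. Chg n (emb a)) (carrier (CS n))"
  have f0: "f0 x = Chg n (emb x)" if "x \<in> carrier (CS n)" for x using that by (simp add: f0_def)
  have "charge_map n = f0"
    unfolding charge_map_def
  proof (rule the_equality, intro conjI ballI)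
    show "f0 \<in> extensional (carrier (CS n))" by (simp add: f0_def)
    show "f0 \<in> LinearCombinations.module_hom class_ring (CS n) (poly_algebra n)"
      unfolding LinearCombinations.module_hom_def
    proof (intro CollectI conjI allI impI Pi_I)
      fix x assume "x \<in> carrier (CS n)"
      then show "f0 x \<in> carrier (poly_algebra n)" by (simp add: f0 polys_Chg emb_carrier_iff)
    next
      fix x y assume "x \<in> carrier (CS n) \<and> y \<in> carrier (CS n)"
      then show "f0 (x \<oplus>\<^bsub>CS n\<^esub> y) = f0 x \<oplus>\<^bsub>poly_algebra n\<^esub> f0 y"
        by (simp add: f0 CS_add CS_add_carrier emb_add Chg_add)
    next
      fix c :: complex and x assume "c \<in> carrier class_ring \<and> x \<in> carrier (CS n)"
      then show "f0 (c \<odot>\<^bsub>CS n\<^esub> x) = c \<odot>\<^bsub>poly_algebra n\<^esub> f0 x"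
        by (simp add: f0 CS_smult_carrier emb_smult Chg_sc)
    qed
    show "f0 x = alg_act x (charge_monomial n T)" if "T \<in> standard_tableaux n" "x \<in> V_of n T" for T x
      using that by (simp add: f0 V_of_carrier Chg_V_of)
  next
    fix f assume f: "f \<in> extensional (carrier (CS n)) \<and>
        f \<in> LinearCombinations.module_hom class_ring (CS n) (poly_algebra n) \<and>
        (\<forall>T\<in>standard_tableaux n. \<forall>a\<in>V_of n T. f a = alg_act a (charge_monomial n T))"
    have add: "f (x + y) = f x + f y" if "x \<in> carrier (CS n)" "y \<in> carrier (CS n)" for x y
      using f that by (simp add: LinearCombinations.module_hom_def CS_add)
    have f_0: "f 0 = 0" using add[OF CS_0_carrier CS_0_carrier] by simp
    have sum: "f (\<Sum>i\<in>I. g i) = (\<Sum>i\<in>I. f (g i))"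
      if "finite I" "\<And>i. i \<in> I \<Longrightarrow> g i \<in> carrier (CS n)" for I :: "tableau set" and g
      using that by (induction I rule: finite_induct) (simp_all add: f_0 add CS_sum_carrier)
    show "f = f0"
    proof (rule extensionalityI)
      fix x assume x: "x \<in> carrier (CS n)"
      have V: "x \<otimes>\<^bsub>CS n\<^esub> tableau_proj n T \<in> V_of n T" for T using x by (auto simp only: V_of_def)
      have "f x = (\<Sum>T\<in>standard_tableaux n. f (x \<otimes>\<^bsub>CS n\<^esub> tableau_proj n T))"
        by (subst (1) sum_tableau_proj[symmetric, of x n], rule sum)
          (simp_all add: finite_standard_tableaux V_of_carrier[OF _ V])
      also have "\<dots> = (\<Sum>T\<in>standard_tableaux n. Chg n (emb (x \<otimes>\<^bsub>CS n\<^esub> tableau_proj n T)))"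
        using f V by (intro sum.cong refl) (simp add: Chg_V_of)
      also have "\<dots> = f0 x"
        unfolding f0[OF x] Chg_sum[symmetric] emb_sum[symmetric] sum_tableau_proj ..
      finally show "f x = f0 x" .
    qed (use f in \<open>simp_all add: f0_def\<close>)
  qed
  then show ?thesis using f0[OF a] by simp
qed

section \<open>The quotient by the coinvariant ideal\<close>

lemma coinv_class_eq_iff:
  assumes "p \<in> polys n" "q \<in> polys n"
  shows "coinv_class n p = coinv_class n q \<longleftrightarrow> p - q \<in> coinv_ideal n"
proof -
  have cl: "coinv_class n r = {h + r |h. h \<in> coinv_ideal n}" for r
    by (auto simp: coinv_class_def a_r_coset_def')
  show ?thesis
  proof
    assume "coinv_class n p = coinv_class n q"
    moreover have "p \<in> coinv_class n p" unfolding cl using coinv_ideal_0 by force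
    ultimately show "p - q \<in> coinv_ideal n" by (auto simp: cl)
  next
    assume d: "p - q \<in> coinv_ideal n"
    show "coinv_class n p = coinv_class n q" unfolding cl
    proof (intro equalityI subsetI)
      fix x assume "x \<in> {h + p |h. h \<in> coinv_ideal n}"
      then obtain h where "x = (h + (p - q)) + q" "h \<in> coinv_ideal n" by (auto simp: algebra_simps)
      then show "x \<in> {h + q |h. h \<in> coinv_ideal n}" using coinv_ideal_add[OF _ d] by blast
    next
      fix x assume "x \<in> {h + q |h. h \<in> coinv_ideal n}"
      then obtain h where "x = (h - (p - q)) + p" "h \<in> coinv_ideal n" by (auto simp: algebra_simps)
      then show "x \<in> {h + p |h. h \<in> coinv_ideal n}" using coinv_ideal_diff[OF _ d] by blast
    qed
  qed
qed

lemma coinv_class_mem_iff: "q \<in> coinv_class n p \<longleftrightarrow> q - p \<in> coinv_ideal n"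
  unfolding coinv_class_def a_r_coset_def' by (auto intro: bexI[of _ "q - p"])

lemma coinv_class_polys: "p \<in> polys n \<Longrightarrow> q \<in> coinv_class n p \<Longrightarrow> q \<in> polys n"
  using polys_add[of p n "q - p"] coinv_ideal_polys[of "q - p" n] by (simp add: coinv_class_mem_iff)

text \<open>Scalar multiplication and the group action on classes are unions over all
  representatives. If \<open>f\<close> respects the ideal, the classes in such a union
  coincide.\<close>

lemma coinv_class_UNION:
  assumes p: "p \<in> polys n"
    and f: "\<And>q. q \<in> polys n \<Longrightarrow> f q \<in> polys n"
    and I: "\<And>q. q \<in> polys n \<Longrightarrow> q - p \<in> coinv_ideal n \<Longrightarrow> f q - f p \<in> coinv_ideal n"
  shows "(\<Union>q\<in>coinv_class n p. coinv_class n (f q)) = coinv_class n (f p)"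
proof -
  have "coinv_class n (f q) = coinv_class n (f p)" if "q \<in> coinv_class n p" for q
    using coinv_class_polys[OF p that] that p f I by (simp add: coinv_class_eq_iff coinv_class_mem_iff)
  moreover have "p \<in> coinv_class n p" using coinv_ideal_0 by (simp add: coinv_class_mem_iff)
  ultimately show ?thesis by blast
qed

lemma coinvariants_carrier: "carrier (coinvariants n) = coinv_class n ` polys n"
  by (auto simp: coinvariants_def ring.defs FactRing_def A_RCOSETS_def' coinv_class_def)

lemma coinvariants_add:
  "p \<in> polys n \<Longrightarrow> q \<in> polys n \<Longrightarrow>
    coinv_class n p \<oplus>\<^bsub>coinvariants n\<^esub> coinv_class n q = coinv_class n (p + q)"
  using ring_hom_add[OF ideal.rcos_ring_hom[OF coinv_ideal], of p n q]
  by (simp add: coinvariants_def ring.defs FactRing_def coinv_class_def)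

lemma coinvariants_zero: "\<zero>\<^bsub>coinvariants n\<^esub> = coinv_class n 0"
  by (auto simp: coinvariants_def ring.defs FactRing_def coinv_class_mem_iff)

lemma coinvariants_smult:
  assumes p: "p \<in> polys n"
  shows "c \<odot>\<^bsub>coinvariants n\<^esub> coinv_class n p = coinv_class n (const c * p)"
proof -
  have "const c * q - const c * p \<in> coinv_ideal n" if "q - p \<in> coinv_ideal n" for q
    using coinv_ideal_mult[OF polys_const[of c n] that] by (simp add: right_diff_distrib)
  then show ?thesis
    using coinv_class_UNION[OF p, of "\<lambda>p. const c * p"] by (simp add: coinvariants_def ring.defs polys_mult)
qed

lemma coinv_act_class:
  assumes "\<sigma> permutes {1..n}" "p \<in> polys n"
  shows "coinv_act n \<sigma> (coinv_class n p) = coinv_class n (perm_act \<sigma> p)"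
  unfolding coinv_act_def
proof (rule coinv_class_UNION[OF assms(2)])
  fix q assume "q - p \<in> coinv_ideal n"
  then have "act (gel \<sigma>) (q - p) \<in> coinv_ideal n" using coinv_ideal_perm_act[OF assms(1)] by (simp only: act_gel)
  moreover have "perm_act \<sigma> (q - p) = perm_act \<sigma> q - perm_act \<sigma> p"
    using perm.eval_add[of \<sigma> "q - p" p] by (simp add: algebra_simps)
  ultimately show "perm_act \<sigma> q - perm_act \<sigma> p \<in> coinv_ideal n" by (simp only: act_gel)
qed (rule polys_perm_act[OF _ assms(1)])

lemma CS_vectorspace: "vectorspace class_ring (CS n)"
proof -
  have "module class_ring (CS n)"
  proof (rule module_criteria)
    show "\<forall>v\<in>carrier (CS n). \<exists>w\<in>carrier (CS n). v \<oplus>\<^bsub>CS n\<^esub> w = \<zero>\<^bsub>CS n\<^esub>"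
    proof
      fix v assume v: "v \<in> carrier (CS n)"
      show "\<exists>w\<in>carrier (CS n). v \<oplus>\<^bsub>CS n\<^esub> w = \<zero>\<^bsub>CS n\<^esub>"
        using CS_smult_carrier[OF v, of "-1"]
        by (rule bexI[rotated]) (rule inj_emb, simp add: CS_add CS_zero emb_add emb_smult sc_simps)
    qed
  qed (auto simp: CS_add CS_zero CS_add_carrier CS_smult_carrier CS_0_carrier ac_simps
      class_cring.is_cring intro!: inj_emb simp: emb_add emb_smult sc_simps distrib_left distrib_right)
  then show ?thesis by (simp add: vectorspace_def class_field)
qed

lemma coinvariants_vectorspace: "vectorspace class_ring (coinvariants n)"
proof -
  have "module class_ring (coinvariants n)"
  proof (rule module_criteria)
    show "\<forall>v\<in>carrier (coinvariants n). \<exists>w\<in>carrier (coinvariants n). v \<oplus>\<^bsub>coinvariants n\<^esub> w = \<zero>\<^bsub>coinvariants n\<^esub>"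
    proof
      fix v assume "v \<in> carrier (coinvariants n)"
      then obtain p where p: "p \<in> polys n" "v = coinv_class n p" by (auto simp: coinvariants_carrier)
      then have "- p \<in> polys n" by (intro polys_uminus)
      with p show "\<exists>w\<in>carrier (coinvariants n). v \<oplus>\<^bsub>coinvariants n\<^esub> w = \<zero>\<^bsub>coinvariants n\<^esub>"
        by (intro bexI[of _ "coinv_class n (- p)"]) (simp_all add: coinvariants_add coinvariants_zero coinvariants_carrier)
    qed
  qed (auto simp: coinvariants_carrier coinvariants_add coinvariants_zero coinvariants_smult
      polys_add polys_mult const_simps ac_simps distrib_left distrib_right class_cring.is_cring
      simp del: Un_iff UN_iff intro!: imageI)
  then show ?thesis by (simp add: vectorspace_def class_field)
qed

lemma Chg_diff: "Chg n (a - b) = Chg n a - Chg n b"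
  using Chg_add[of n "a - b" b] by (simp add: algebra_simps)

lemma GA_diff: "a \<in> GA n \<Longrightarrow> b \<in> GA n \<Longrightarrow> a - b \<in> GA n"
  using GA_add[of a n "sc (- 1) * b"] GA_mult[OF GA_sc, of b n "- 1"] by (simp add: sc_simps)

lemma charge_map_G_module_iso:
  "G_module_iso (sym_group n) (CS n) (left_mult n) (coinvariants n) (coinv_act n)
     (\<lambda>a. coinv_class n (charge_map n a))"
  unfolding G_module_iso_def
proof (intro conjI ballI)
  have polys: "Chg n (emb a) \<in> polys n" if "a \<in> carrier (CS n)" for a
    using that by (simp add: polys_Chg emb_carrier_iff)
  show "linear_map class_ring (CS n) (coinvariants n) (\<lambda>a. coinv_class n (charge_map n a))"
    unfolding linear_map_def mod_hom_def mod_hom_axioms_def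
  proof (intro conjI CS_vectorspace coinvariants_vectorspace vectorspace.axioms(1))
    show "(\<lambda>a. coinv_class n (charge_map n a)) \<in> LinearCombinations.module_hom class_ring (CS n) (coinvariants n)"
      unfolding LinearCombinations.module_hom_def
      by (auto simp: coinvariants_carrier coinvariants_add coinvariants_smult charge_map_eq polys
          CS_add CS_add_carrier CS_smult_carrier emb_add emb_smult Chg_add Chg_sc)
  qed
  show "bij_betw (\<lambda>a. coinv_class n (charge_map n a)) (carrier (CS n)) (carrier (coinvariants n))"
    unfolding bij_betw_def
  proof (intro conjI equalityI subsetI inj_onI)
    fix a b assume ab: "a \<in> carrier (CS n)" "b \<in> carrier (CS n)"
      and eq: "coinv_class n (charge_map n a) = coinv_class n (charge_map n b)"
    have "Chg n (emb a - emb b) \<in> coinv_ideal n"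
      using eq ab by (simp add: charge_map_eq coinv_class_eq_iff polys Chg_diff)
    then have "emb a - emb b = 0"
      using ab by (intro Chg_inj GA_diff) (simp_all add: emb_carrier_iff)
    then show "a = b" by (intro inj_emb) simp
  next
    fix x assume "x \<in> (\<lambda>a. coinv_class n (charge_map n a)) ` carrier (CS n)"
    then show "x \<in> carrier (coinvariants n)" by (auto simp: coinvariants_carrier charge_map_eq polys)
  next
    fix x assume "x \<in> carrier (coinvariants n)"
    then obtain p where p: "p \<in> polys n" "x = coinv_class n p" by (auto simp: coinvariants_carrier)
    obtain b where b: "b \<in> GA n" "p - Chg n b \<in> coinv_ideal n" using Chg_surj[OF p(1)] by blast
    obtain a where a: "emb a = b" using emb_surj by blast
    then have "a \<in> carrier (CS n)" using b(1) by (simp add: emb_carrier_iff[symmetric])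
    moreover have "x = coinv_class n (charge_map n a)"
      using p b a calculation polys[OF calculation] by (simp add: charge_map_eq coinv_class_eq_iff)
    ultimately show "x \<in> (\<lambda>a. coinv_class n (charge_map n a)) ` carrier (CS n)" by blast
  qed
  fix \<sigma> a assume "\<sigma> \<in> carrier (sym_group n)" and a: "a \<in> carrier (CS n)"
  then have \<sigma>: "\<sigma> permutes {1..n}" by (simp add: sym_group_def)
  have "emb (left_mult n \<sigma> a) = gel \<sigma> * emb a" by (simp only: left_mult_def emb_mult emb_perm_elt)
  moreover from this have "left_mult n \<sigma> a \<in> carrier (CS n)"
    using a GA_mult[OF GA_gel[OF \<sigma>]] by (simp only: emb_carrier_iff[symmetric])
  ultimately show "coinv_class n (charge_map n (left_mult n \<sigma> a)) = coinv_act n \<sigma> (coinv_class n (charge_map n a))"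
    by (simp only: charge_map_eq[OF a] charge_map_eq coinv_act_class[OF \<sigma> polys[OF a]] Chg_mult act_gel)
qed

text \<open>The order is reversed because \<open>wpairs\<close> lists first the path whose projector
  stands on the right of the weight vector.\<close>

lemma same_shape_pairs_bij:
  "bij_betw (\<lambda>(T, T'). (path_of n T', path_of n T)) (same_shape_pairs n)
     {(t, u). t \<in> paths n \<and> u \<in> paths n \<and> t ` {1..n} = u ` {1..n}}"
  unfolding bij_betw_def
proof (intro conjI equalityI subsetI)
  have image: "path_of n T ` {1..n} = dom T" if "T \<in> standard_tableaux n" for T
    using std_tableau.path_of_image[OF std_tableau.intro[OF that]] .
  show "inj_on (\<lambda>(T, T'). (path_of n T', path_of n T)) (same_shape_pairs n)"
  proof (rule inj_onI)
    fix P Q assume PQ: "P \<in> same_shape_pairs n" "Q \<in> same_shape_pairs n"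
      "(case P of (T, T') \<Rightarrow> (path_of n T', path_of n T)) = (case Q of (T, T') \<Rightarrow> (path_of n T', path_of n T))"
    obtain T T' where P: "P = (T, T')" by fastforce
    obtain U U' where Q: "Q = (U, U')" by fastforce
    from PQ have eq: "path_of n T' = path_of n U'" "path_of n T = path_of n U" by (simp_all add: P Q)
    have "T \<in> standard_tableaux n" "T' \<in> standard_tableaux n" "U \<in> standard_tableaux n" "U' \<in> standard_tableaux n"
      using PQ(1,2) by (simp_all add: P Q same_shape_pairs_def)
    then show "P = Q"
      using inj_onD[OF bij_betw_imp_inj_on[OF path_of_bij[of n]], OF eq(1)]
        inj_onD[OF bij_betw_imp_inj_on[OF path_of_bij[of n]], OF eq(2)] by (simp add: P Q)
  qed
  fix x
  {
    assume "x \<in> (\<lambda>(T, T'). (path_of n T', path_of n T)) ` same_shape_pairs n"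
    then obtain T T' where "x = (path_of n T', path_of n T)" "T \<in> standard_tableaux n"
      "T' \<in> standard_tableaux n" "dom T = dom T'" by (auto simp: same_shape_pairs_def)
    then show "x \<in> {(t, u). t \<in> paths n \<and> u \<in> paths n \<and> t ` {1..n} = u ` {1..n}}"
      by (simp only: mem_Collect_eq case_prod_conv path_of_in_paths image)
  next
    assume "x \<in> {(t, u). t \<in> paths n \<and> u \<in> paths n \<and> t ` {1..n} = u ` {1..n}}"
    then obtain t u where x: "x = (t, u)" "t \<in> paths n" "u \<in> paths n" "t ` {1..n} = u ` {1..n}" by blast
    then obtain T T' where T: "T \<in> standard_tableaux n" "T' \<in> standard_tableaux n" "u = path_of n T" "t = path_of n T'"
      using bij_betw_imp_surj_on[OF path_of_bij[of n]] by (metis imageE)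
    then have "(T, T') \<in> same_shape_pairs n"
      using x(4) image[OF T(1)] image[OF T(2)] by (simp only: same_shape_pairs_def mem_Collect_eq case_prod_conv)
    then show "x \<in> (\<lambda>(T, T'). (path_of n T', path_of n T)) ` same_shape_pairs n"
      by (rule rev_image_eqI) (simp only: x(1) T(3,4) case_prod_conv)
  }
qed

lemma weight_vec_reindex:
  "\<exists>\<kappa>. bij_betw \<kappa> (same_shape_pairs n) (wpairs n) \<and>
     (\<forall>(T, T')\<in>same_shape_pairs n. weight_vec n T T' \<in> V_of n T' \<and>
       Chg n (emb (weight_vec n T T')) = wimg n (\<kappa> (T, T')))"
proof -
  define w :: "(nat \<Rightarrow> box) \<times> (nat \<Rightarrow> nat) \<Rightarrow> _" where "w = (\<lambda>(t, \<tau>). (t, t \<circ> \<tau>))"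
  define s where "s = (\<lambda>(T, T'). (path_of n T', path_of n T))"
  define \<kappa> where "\<kappa> = inv_into (wpairs n) w \<circ> s"
  note bs = same_shape_pairs_bij[of n, folded s_def] and bw = wpairs_bij[of n, folded w_def]
  have bij: "bij_betw \<kappa> (same_shape_pairs n) (wpairs n)"
    unfolding \<kappa>_def by (rule bij_betw_trans[OF bs bij_betw_inv_into[OF bw]])
  have "weight_vec n T T' \<in> V_of n T' \<and> Chg n (emb (weight_vec n T T')) = wimg n (\<kappa> (T, T'))"
    if TT: "(T, T') \<in> same_shape_pairs n" for T T'
  proof
    have T: "T \<in> standard_tableaux n" "T' \<in> standard_tableaux n" by (use TT in \<open>simp_all add: same_shape_pairs_def\<close>)
    obtain t \<tau> where k: "\<kappa> (T, T') = (t, \<tau>)" by fastforce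
    have ws: "w (\<kappa> (T, T')) = s (T, T')"
      unfolding \<kappa>_def comp_apply by (rule bij_betw_inv_into_right[OF bw bij_betw_apply[OF bs TT]])
    note t = conjunct1[OF ws[unfolded k w_def s_def case_prod_conv prod.inject]]
      conjunct2[OF ws[unfolded k w_def s_def case_prod_conv prod.inject], symmetric]
    have \<tau>: "\<tau> permutes {1..n}" using bij_betw_apply[OF bij TT] by (simp add: k wpairs_def)
    have \<sigma>: "sigma n T T' = pinv \<tau>" by (rule sigma_permutation[OF T \<tau>]) (unfold t, rule refl)
    then have "emb (weight_vec n T T') = S.wvec n t \<tau>"
      unfolding weight_vec_def emb_mult emb_perm_elt S.wvec_def emb_tableau_proj[OF T(1)] emb_tableau_proj[OF T(2)]
      by (simp only: t)
    then show "Chg n (emb (weight_vec n T T')) = wimg n (\<kappa> (T, T'))" by (simp only: k wimg_def case_prod_conv)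
    have "emb (perm_elt (sigma n T T')) \<in> GA n"
      unfolding emb_perm_elt \<sigma> by (rule GA_gel[OF permutes_inv[OF \<tau>]])
    then show "weight_vec n T T' \<in> V_of n T'"
      unfolding weight_vec_def V_of_def emb_carrier_iff
      using CS_mult_carrier[OF tableau_proj_carrier[OF T(1)]] by blast
  qed
  with bij show ?thesis by blast
qed

lemma coinvariants_finsum:
  assumes "finite I" and "\<And>i. i \<in> I \<Longrightarrow> f i \<in> polys n"
  shows "(\<Oplus>\<^bsub>coinvariants n\<^esub>i\<in>I. coinv_class n (f i)) = coinv_class n (\<Sum>i\<in>I. f i)"
proof -
  interpret M: vectorspace class_ring "coinvariants n" by (rule coinvariants_vectorspace)
  show ?thesis using assms
  proof (induction I rule: finite_induct)
    case (insert i I)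
    have "(\<Sum>i\<in>I. f i) \<in> polys n" using insert by (intro polys_sum) auto
    then show ?case using insert by (subst M.finsum_insert) (auto simp: coinvariants_carrier coinvariants_add)
  qed (simp add: coinvariants_zero)
qed

text \<open>This passes from families of polynomials to sets of classes, as \<open>basis\<close>
  speaks of a set; \<open>indep\<close> also excludes repetitions.\<close>

lemma coinvariants_basis:
  assumes fin: "finite J" and w: "\<And>j. j \<in> J \<Longrightarrow> w j \<in> polys n"
    and indep: "\<And>c k. (\<Sum>j\<in>J. const (c j) * w j) \<in> coinv_ideal n \<Longrightarrow> k \<in> J \<Longrightarrow> c k = 0"
    and span: "\<And>p. p \<in> polys n \<Longrightarrow> \<exists>c. p - (\<Sum>j\<in>J. const (c j) * w j) \<in> coinv_ideal n"
  shows "inj_on (\<lambda>j. coinv_class n (w j)) J"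
    and "vectorspace.basis class_ring (coinvariants n) ((\<lambda>j. coinv_class n (w j)) ` J)"
proof -
  let ?v = "\<lambda>j. coinv_class n (w j)"
  interpret M: vectorspace class_ring "coinvariants n" by (rule coinvariants_vectorspace)
  show inj: "inj_on ?v J"
  proof (rule inj_onI, rule ccontr)
    fix i j assume ij: "i \<in> J" "j \<in> J" "?v i = ?v j" "i \<noteq> j"
    \<comment> \<open>Two equal classes would give a relation with coefficients 1 and -1.\<close>
    define c :: "'a \<Rightarrow> complex" where "c k = (if k = i then 1 else if k = j then -1 else 0)" for k
    have "(\<Sum>k\<in>J. const (c k) * w k) = (\<Sum>k\<in>{i, j}. const (c k) * w k)"
      by (rule sum.mono_neutral_right[OF fin]) (use ij in \<open>auto simp: c_def const_simps\<close>)
    also have "\<dots> = w i - w j" using ij(4) by (simp add: c_def const_simps)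
    finally have "c i = 0" using indep[of c i] ij w by (simp add: coinv_class_eq_iff)
    then show False by (simp add: c_def)
  qed
  have lincomb: "M.lincomb a (?v ` J) = coinv_class n (\<Sum>j\<in>J. const (a (?v j)) * w j)" for a
  proof -
    have "M.lincomb a (?v ` J) = (\<Oplus>\<^bsub>coinvariants n\<^esub>j\<in>J. coinv_class n (const (a (?v j)) * w j))"
      unfolding M.lincomb_def using w
      by (subst M.finsum_reindex[OF _ inj], simp add: Pi_iff coinvariants_smult coinvariants_carrier polys_mult)
        (rule M.finsum_cong', simp_all add: Pi_iff coinvariants_smult coinvariants_carrier polys_mult)
    also have "\<dots> = coinv_class n (\<Sum>j\<in>J. const (a (?v j)) * w j)"
      using w by (intro coinvariants_finsum[OF fin] polys_mult) simp_all
    finally show ?thesis .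
  qed
  have polys: "(\<Sum>j\<in>J. const (c j) * w j) \<in> polys n" for c using w by (intro polys_sum polys_mult) simp_all
  have sub: "?v ` J \<subseteq> carrier (coinvariants n)" using w by (auto simp: coinvariants_carrier)
  show "M.basis (?v ` J)" unfolding M.basis_def
  proof (intro conjI sub)
    show "M.lin_indpt (?v ` J)"
    proof (rule M.finite_lin_indpt2[OF finite_imageI[OF fin] sub])
      fix a assume "M.lincomb a (?v ` J) = \<zero>\<^bsub>coinvariants n\<^esub>"
      then have "(\<Sum>j\<in>J. const (a (?v j)) * w j) \<in> coinv_ideal n"
        using polys by (simp add: lincomb coinvariants_zero coinv_class_eq_iff)
      then have "a (?v j) = 0" if "j \<in> J" for j using that by (rule indep)
      then show "\<forall>v\<in>?v ` J. a v = \<zero>\<^bsub>class_ring\<^esub>" by simp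
    qed
    show "M.span (?v ` J) = carrier (coinvariants n)"
    proof (intro equalityI M.span_is_subset2[OF sub] subsetI)
      fix x assume "x \<in> carrier (coinvariants n)"
      then obtain p where p: "p \<in> polys n" "x = coinv_class n p" by (auto simp: coinvariants_carrier)
      obtain c where c: "p - (\<Sum>j\<in>J. const (c j) * w j) \<in> coinv_ideal n" using span[OF p(1)] by blast
      have "(\<Sum>j\<in>J. const ((c \<circ> inv_into J ?v) (?v j)) * w j) = (\<Sum>j\<in>J. const (c j) * w j)"
        by (intro sum.cong refl) (simp add: inv_into_f_f[OF inj])
      then have "x = M.lincomb (c \<circ> inv_into J ?v) (?v ` J)"
        unfolding p(2) lincomb by (simp only: coinv_class_eq_iff[OF p(1) polys] c)
      then show "x \<in> M.span (?v ` J)" unfolding M.span_def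
        using fin by (intro CollectI exI conjI) (assumption, simp_all)
    qed
  qed
qed

theorem theorem4p2:
  fixes n :: nat
  assumes "n \<ge> 1"
  shows
    "G_module_iso (sym_group n) (CS n) (left_mult n) (coinvariants n) (coinv_act n)
        (\<lambda>a. coinv_class n (charge_map n a))
     \<and> (\<forall>(T, T') \<in> same_shape_pairs n.
          charge_map n (weight_vec n T T') =
            alg_act (tableau_proj n T \<otimes>\<^bsub>CS n\<^esub> perm_elt (sigma n T T') \<otimes>\<^bsub>CS n\<^esub> tableau_proj n T')
              (charge_monomial n T'))
     \<and> inj_on (\<lambda>(T, T'). coinv_class n (charge_map n (weight_vec n T T'))) (same_shape_pairs n)
     \<and> vectorspace.basis class_ring (coinvariants n)
          ((\<lambda>(T, T'). coinv_class n (charge_map n (weight_vec n T T'))) ` same_shape_pairs n)"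
proof -
  have std: "T \<in> standard_tableaux n" "T' \<in> standard_tableaux n" if "(T, T') \<in> same_shape_pairs n" for T T'
    using that by (simp_all add: same_shape_pairs_def)
  obtain \<kappa> where bij: "bij_betw \<kappa> (same_shape_pairs n) (wpairs n)"
    and reindex: "\<forall>(T, T')\<in>same_shape_pairs n. weight_vec n T T' \<in> V_of n T' \<and>
       Chg n (emb (weight_vec n T T')) = wimg n (\<kappa> (T, T'))"
    using weight_vec_reindex[of n] by blast
  have V: "weight_vec n T T' \<in> V_of n T'"
    and \<kappa>: "Chg n (emb (weight_vec n T T')) = wimg n (\<kappa> (T, T'))"
    if "(T, T') \<in> same_shape_pairs n" for T T'
    using bspec[OF reindex that] by simp_all
  have CS: "weight_vec n T T' \<in> carrier (CS n)" if "(T, T') \<in> same_shape_pairs n" for T T'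
    by (rule V_of_carrier[OF std(2)[OF that] V[OF that]])
  define w where "w = (\<lambda>(T, T'). charge_map n (weight_vec n T T'))"
  have w: "w P = wimg n (\<kappa> P)" if "P \<in> same_shape_pairs n" for P
    using that by (cases P) (simp add: w_def charge_map_eq CS \<kappa>)
  \<comment> \<open>Sums over pairs of tableaux are transported along \<open>\<kappa>\<close>, so
    that independence and spanning carry over from \<open>wimg\<close>.\<close>
  have sum_eq: "(\<Sum>P\<in>same_shape_pairs n. const (c P) * w P) =
      (\<Sum>j\<in>wpairs n. const (c (inv_into (same_shape_pairs n) \<kappa> j)) * wimg n j)" for c
    by (subst sum.reindex_bij_betw[OF bij, symmetric], rule sum.cong)
      (simp_all add: w bij_betw_inv_into_left[OF bij])
  have fin: "finite (same_shape_pairs n)" using bij_betw_finite[OF bij] finite_wpairs by blast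
  have polys: "w P \<in> polys n" if "P \<in> same_shape_pairs n" for P
    using that by (cases P) (simp add: w_def charge_map_eq CS polys_Chg emb_carrier_iff)
  have indep: "c k = 0" if "(\<Sum>P\<in>same_shape_pairs n. const (c P) * w P) \<in> coinv_ideal n"
    and "k \<in> same_shape_pairs n" for c k
    using wimg_independent[OF that(1)[unfolded sum_eq] bij_betw_apply[OF bij that(2)]]
    by (simp add: bij_betw_inv_into_left[OF bij that(2)])
  have span: "\<exists>c. p - (\<Sum>P\<in>same_shape_pairs n. const (c P) * w P) \<in> coinv_ideal n" if p: "p \<in> polys n" for p
  proof -
    obtain c where c: "p - (\<Sum>j\<in>wpairs n. const (c j) * wimg n j) \<in> coinv_ideal n"
      using wimg_span[OF p] by blast
    have "(\<Sum>P\<in>same_shape_pairs n. const ((c \<circ> \<kappa>) P) * w P) = (\<Sum>j\<in>wpairs n. const (c j) * wimg n j)"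
      unfolding sum_eq by (intro sum.cong refl) (simp add: bij_betw_inv_into_right[OF bij])
    with c show ?thesis by (intro exI[of _ "c \<circ> \<kappa>"]) simp
  qed
  have eq: "(\<lambda>(T, T'). coinv_class n (charge_map n (weight_vec n T T'))) = (\<lambda>P. coinv_class n (w P))"
    by (simp add: w_def fun_eq_iff split_beta)
  have "charge_map n (weight_vec n T T') = alg_act (weight_vec n T T') (charge_monomial n T')"
    if "(T, T') \<in> same_shape_pairs n" for T T'
    unfolding charge_map_eq[OF CS[OF that]] by (rule Chg_V_of[OF std(2)[OF that] V[OF that]])
  then have "\<forall>(T, T') \<in> same_shape_pairs n.
      charge_map n (weight_vec n T T') = alg_act (weight_vec n T T') (charge_monomial n T')"
    by (simp add: split_beta)
  moreover have "inj_on (\<lambda>P. coinv_class n (w P)) (same_shape_pairs n)"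
    by (rule coinvariants_basis(1)[where w = w, OF fin]) (fact polys indep span)+
  moreover have "vectorspace.basis class_ring (coinvariants n) ((\<lambda>P. coinv_class n (w P)) ` same_shape_pairs n)"
    by (rule coinvariants_basis(2)[where w = w, OF fin]) (fact polys indep span)+
  ultimately show ?thesis
    using charge_map_G_module_iso[of n] unfolding eq weight_vec_def[symmetric] by (intro conjI)
qed

end
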